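(* Let $H$ be a separable real Hilbert space, and let $\sigma$, $(A(t))_{t\ge0}$, $b$, $n(t,x;dy)$, $(e_n)_{n\ge1}$, the interval $I\subset[0,\infty)$, the Borel set $M\subset D(b)$, the class of test functions $\mathcal D$, and the parabolic integro-differential operator ${\sf L}=\frac{\partial}{\partial t}+{\sf L}_t$ on $\mathcal D$ be as described in the context. Let $F:=\{(t,x)\in[0,\infty)\times H: n(t,x;\cdot)=0\}$ and let $G$ be the interior of $F\cap(I\times M)$ relative to the trace topology on $I\times M$. Let $X$ be any càdlàg right Markov process on $I\times M$ with resolvent $\mathcal U=(U_\alpha)_{\alpha>0}$, and $\overline m$ a $\sigma$-finite measure on $I\times M$ such that: (i) for some $\alpha_0>0$ the resolvent $\mathcal U_{\alpha_0}:=(U_{\alpha_0+\alpha})_{\alpha>0}$ can be extended to a strongly continuous resolvent on $L^p(I\times M,\overline m)$ for some $1\le p<\infty$; (ii) $\mathcal D\cup{\sf L}(\mathcal D)\subset L^p(I\times M,\overline m)$; (iii) $X$ solves the martingale problem associated $\overline m$-a.e. to $({\sf L},\mathcal D)$. Then $X$ is a diffusion in $G$ $\overline m$-q.e.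
   Context: **Coefficients.** $(H,\langle\cdot,\cdot\rangle)$ carries the norm topology. - $\sigma:[0,\infty)\times H\to L_s(H)$ is measurable, $L_s(H)$ being the bounded symmetric linear operators on $H$. - $(A(t))_{t\ge0}$ is a family of densely defined linear operators on $H$ with adjoints $A^*(t)$ such that there is a countable set $(e_n)_{n\ge1}\subset\bigcap_{t\ge0}D(A^*(t))$ total in $H$, and $t\mapsto A^*(t)x\in H$ is measurable for every $x\in\bigcap_{t\ge0}D(A^*(t))$. - $b:[0,\infty)\times D(b)\to H$ is measurable, $D(b)\in\mathcal B(H)$. - $n(t,x;dy)$ is a Lévy measure on $H$ for each $(t,x)\in[0,\infty)\times H$, with $(t,x)\mapsto\int_B 1\wedge|y|^2\,n(t,x;dy)\in[0,\infty)$ measurable for all $B\in\mathcal B(H)$. **Operator.** For $t\ge0$, $x\in D(b)$ and $f(x)=\varphi(\langle x,e_1\rangle,\dots,\langle x,e_n\rangle)$ with $\varphi\in C_c^\infty(\mathbb R^n)$, $n\ge1$ (respectively $f\in C_c^\infty(\mathbb R^d)$ if $H=\mathbb R^d$), $${\sf L}_tf(x)=\tfrac12\mathrm{Tr}[\sigma(t,x)^2D^2f(x)]+\langle x,A^*(t)Df(x)\rangle+\langle b(t,x),Df(x)\rangle+\int_H\Big[f(x+y)-f(x)-\frac{\langle y,Df(x)\rangle}{1+|y|^2}\Big]n(t,x;dy).$$ $I\subset[0,\infty)$ is an interval, $M\subset D(b)$ is Borel in $H$, and $$\mathcal D:=\{f:I\times H\to\mathbb R:\ f(t,x)=\varphi(t,\langle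 x,e_1\rangle,\dots,\langle x,e_n\rangle),\ \varphi\in C_c^\infty(I\times\mathbb R^n),\ n\ge1\},\qquad {\sf L}f=\Big(\frac{\partial}{\partial t}+{\sf L}_t\Big)f .$$ **Right processes.** Let $S:=I\times M$ (a Lusin space with trace topology, Borel $\sigma$-algebra $\mathcal B(S)$). $\zeta$ is the lifetime, functions are extended by $0$ at the cemetery, $U_\alpha f(x)=\mathbb E^x\int_0^\infty e^{-\alpha t}f(X_t)dt$, $T_A:=\inf\{t>0:X_t\in A\}$. For $q\ge 0$, a Borel $v:S\to[0,\infty]$ is $q$-excessive if $\alpha U_{q+\alpha}v\le v$ for all $\alpha>0$ and $\sup_\alpha\alpha U_{q+\alpha}v=v$. A right process is a normal Markov process with right-continuous, universally augmented filtration and a.s. right continuous paths such that for $q>0$ and each $q$-excessive $f$, $f(X)$ is a.s. right continuous under every $\mathbb P^x$. Càdlàg: a.s. right continuous with left limits in $S$ on $[0,\zeta)$. Strong continuity on $L^p$: the kernels $U_\alpha$, $\alpha>\alpha_0$, extend to bounded operators on $L^p$ with $\lim_{\alpha\to\infty}\alpha U_\alpha f=f$ in $L^p$. **Martingale problem.** $X$ solves the martingale problem associated $\overline m$-a.e. to $({\sf L},\mathcal D)$ if for each $f\in\mathcal D$ (${\sf L}f$ being Borel measurable), $f(X_{t\wedge\zeta})-\int_0^{t\wedge\zeta}{\sf L}f(X_r)dr$, $t\ge0$, is an $(\mathcal F_t)$-martingale under $\mathbb P^x$ for $\overline m$-a.e. $x\in S$. **Diffusion.** A Borel set $N\subset S$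 is $\overline m$-inessential if $\overline m(N)=0$ and $\mathbb P^x(T_N<\infty)=0$ for $x\in S\setminus N$; $\overline m$-q.e. means outside an $\overline m$-inessential set. For $G\subset S$ open choose open $G_n\subset G$ with $\overline G_n\subset G_{n+1}$, $\bigcup_nG_n=G$; $S_n^1:=T_{G_n}$, $T_n^k:=S_n^k+T_{S\setminus G}\circ\theta_{S_n^k}$ ($k\ge1$), $S_n^k:=T_n^{k-1}+T_{G_n}\circ\theta_{T_n^{k-1}}$ ($k\ge2$); $I_G:=\bigcup_n\bigcup_k(S_n^k,T_n^k)$ (independent of the choice). $X$ is a diffusion in $G$ $\overline m$-q.e. if for $\overline m$-q.e. $x\in S$, $\mathbb P^x$-a.s. $I_G\cap[0,\zeta)\ni t\mapsto X_t$ is continuous (no condition where this set is empty). *)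

theory Defs
  imports "HOL-Probability.Probability"
begin

section \<open>Operators on a Hilbert space\<close>

text \<open>An unbounded operator is a domain together with a function whose values off the domain are
  irrelevant.\<close>

definition densely_defined :: "'h::real_inner set \<Rightarrow> ('h \<Rightarrow> 'h) \<Rightarrow> bool" where
  "densely_defined D A \<longleftrightarrow> subspace D \<and> closure D = UNIV \<and>
     (\<forall>x\<in>D. \<forall>y\<in>D. A (x + y) = A x + A y) \<and> (\<forall>c. \<forall>x\<in>D. A (c *\<^sub>R x) = c *\<^sub>R A x)"

definition adjoint_domain :: "'h::real_inner set \<Rightarrow> ('h \<Rightarrow> 'h) \<Rightarrow> 'h set" where
  "adjoint_domain D A = {y. \<exists>z. \<forall>x\<in>D. A x \<bullet> y = x \<bullet> z}"

definition adjoint_op :: "'h::real_inner set \<Rightarrow> ('h \<Rightarrow> 'h) \<Rightarrow> 'h \<Rightarrow> 'h" where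
  "adjoint_op D A y = (THE z. \<forall>x\<in>D. A x \<bullet> y = x \<bullet> z)"

definition orthonormal_basis :: "'h::real_inner set \<Rightarrow> bool" where
  "orthonormal_basis B \<longleftrightarrow> pairwise orthogonal B \<and> (\<forall>u\<in>B. norm u = 1) \<and> closure (span B) = UNIV"

text \<open>Meaningful for trace class operators only; it is applied to operators of finite rank.\<close>

definition op_trace :: "('h::real_inner \<Rightarrow> 'h) \<Rightarrow> real" where
  "op_trace T = (THE s. \<forall>B. orthonormal_basis B \<longrightarrow> ((\<lambda>u. T u \<bullet> u) has_sum s) B)"

definition grad :: "('h::real_inner \<Rightarrow> real) \<Rightarrow> 'h \<Rightarrow> 'h" where
  "grad f x = (THE D. GDERIV f x :> D)"

definition hessian :: "('h::real_inner \<Rightarrow> real) \<Rightarrow> 'h \<Rightarrow> 'h \<Rightarrow> 'h" where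
  "hessian f x = frechet_derivative (grad f) (at x)"


section \<open>Test functions\<close>

text \<open>The dimension \<open>n\<close> varies inside the class of test functions, so the points of
  \<open>I \<times> \<real>\<^sup>n\<close> are encoded as sequences \<open>z\<close> with time coordinate \<open>z 0\<close>, space coordinates
  \<open>z 1, \<dots>, z n\<close>, and \<open>z i = 0\<close> for \<open>i > n\<close>. The product topology of \<^typ>\<open>nat \<Rightarrow> real\<close>
  induces the Euclidean topology on this set.\<close>

definition time_space :: "real set \<Rightarrow> nat \<Rightarrow> (nat \<Rightarrow> real) set" where
  "time_space I n = {z. z 0 \<in> I \<and> (\<forall>i>n. z i = 0)}"

text \<open>The set over which the \<open>i\<close>-th coordinate may move is \<open>I\<close> for \<open>i = 0\<close> and the real line for
  \<open>1 \<le> i \<le> n\<close>: at an end point belonging to \<open>I\<close>, time derivatives are one-sided.\<close>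

primrec C_k :: "real set \<Rightarrow> nat \<Rightarrow> nat \<Rightarrow> ((nat \<Rightarrow> real) \<Rightarrow> real) \<Rightarrow> bool" where
  "C_k I n 0 \<phi> \<longleftrightarrow> continuous_on (time_space I n) \<phi>"
| "C_k I n (Suc k) \<phi> \<longleftrightarrow> continuous_on (time_space I n) \<phi> \<and>
     (\<forall>i\<le>n. \<exists>\<psi>. C_k I n k \<psi> \<and>
        (\<forall>z\<in>time_space I n. ((\<lambda>s. \<phi> (z(i := s))) has_real_derivative \<psi> z)
            (at (z i) within {s. z(i := s) \<in> time_space I n})))"

definition C_c_inf :: "real set \<Rightarrow> nat \<Rightarrow> ((nat \<Rightarrow> real) \<Rightarrow> real) \<Rightarrow> bool" where
  "C_c_inf I n \<phi> \<longleftrightarrow> (\<forall>k. C_k I n k \<phi>) \<and>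
     (\<exists>K. compact K \<and> K \<subseteq> time_space I n \<and> (\<forall>z\<in>time_space I n - K. \<phi> z = 0))"

text \<open>The members are functions on \<open>I \<times> H\<close>; their values at times outside \<open>I\<close> are unconstrained
  and never used.\<close>

definition test_functions :: "real set \<Rightarrow> (nat \<Rightarrow> 'h::real_inner) \<Rightarrow> (real \<times> 'h \<Rightarrow> real) set" where
  "test_functions I e = {f. \<exists>n\<ge>1. \<exists>\<phi>. C_c_inf I n \<phi> \<and>
     (\<forall>t\<in>I. \<forall>x. f (t, x) = \<phi> (\<lambda>i. if i = 0 then t else if i \<le> n then x \<bullet> e i else 0))}"


section \<open>The integro-differential operator\<close>

definition levy_measure :: "'h::real_inner measure \<Rightarrow> bool" where
  "levy_measure \<nu> \<longleftrightarrow> sets \<nu> = sets borel \<and> emeasure \<nu> {0} = 0 \<and>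
     (\<integral>\<^sup>+y. ennreal (min 1 ((norm y)\<^sup>2)) \<partial>\<nu>) < \<top>"

definition L_op :: "(real \<Rightarrow> 'h \<Rightarrow> 'h \<Rightarrow>\<^sub>L 'h) \<Rightarrow> (real \<Rightarrow> 'h set) \<Rightarrow> (real \<Rightarrow> 'h \<Rightarrow> 'h)
    \<Rightarrow> (real \<Rightarrow> 'h \<Rightarrow> 'h) \<Rightarrow> (real \<Rightarrow> 'h \<Rightarrow> 'h measure)
    \<Rightarrow> real \<Rightarrow> ('h::real_inner \<Rightarrow> real) \<Rightarrow> 'h \<Rightarrow> real" where
  "L_op \<sigma> DA A b n t f x =
     1/2 * op_trace (\<lambda>h. blinfun_apply (\<sigma> t x) (blinfun_apply (\<sigma> t x) (hessian f x h)))
     + x \<bullet> adjoint_op (DA t) (A t) (grad f x)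
     + b t x \<bullet> grad f x
     + (\<integral>y. (f (x + y) - f x - (y \<bullet> grad f x) / (1 + (norm y)\<^sup>2)) \<partial>n t x)"

definition parabolic_op :: "real set \<Rightarrow> (real \<Rightarrow> 'h \<Rightarrow> 'h \<Rightarrow>\<^sub>L 'h) \<Rightarrow> (real \<Rightarrow> 'h set)
    \<Rightarrow> (real \<Rightarrow> 'h \<Rightarrow> 'h) \<Rightarrow> (real \<Rightarrow> 'h \<Rightarrow> 'h) \<Rightarrow> (real \<Rightarrow> 'h \<Rightarrow> 'h measure)
    \<Rightarrow> (real \<times> 'h::real_inner \<Rightarrow> real) \<Rightarrow> real \<times> 'h \<Rightarrow> real" where
  "parabolic_op I \<sigma> DA A b n f = (\<lambda>(t, x).
     vector_derivative (\<lambda>s. f (s, x)) (at t within I) + L_op \<sigma> DA A b n t (\<lambda>y. f (t, y)) x)"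


section \<open>Right processes\<close>

text \<open>The cemetery is \<^const>\<open>None\<close>. Only times \<open>t \<ge> 0\<close> matter in the fields below, and only
  starting points in the state space matter in \<open>law\<close>.\<close>

record ('w, 's) process =
  events :: "'w measure"
  filt :: "real \<Rightarrow> 'w measure"
  path :: "real \<Rightarrow> 'w \<Rightarrow> 's option"
  shift :: "real \<Rightarrow> 'w \<Rightarrow> 'w"
  law :: "'s \<Rightarrow> 'w measure"

definition ext0 :: "('s \<Rightarrow> 'a::zero) \<Rightarrow> 's option \<Rightarrow> 'a" where
  "ext0 f y = (case y of None \<Rightarrow> 0 | Some x \<Rightarrow> f x)"

definition lifetime :: "('w, 's) process \<Rightarrow> 'w \<Rightarrow> ereal" where
  "lifetime Z \<omega> = Inf {ereal t | t. 0 \<le> t \<and> path Z t \<omega> = None}"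

definition hit :: "('w, 's) process \<Rightarrow> 's set \<Rightarrow> 'w \<Rightarrow> ereal" where
  "hit Z A \<omega> = Inf {ereal t | t. 0 < t \<and> path Z t \<omega> \<in> Some ` A}"

definition prob_on :: "'s::topological_space set \<Rightarrow> 's measure \<Rightarrow> bool" where
  "prob_on S \<mu> \<longleftrightarrow> prob_space \<mu> \<and> sets \<mu> = sets (restrict_space borel S)"

text \<open>\<open>P\<^sup>\<mu>\<close> for an initial distribution \<open>\<mu>\<close>. The map \<open>x \<mapsto> P\<^sup>x(A)\<close> is only universally measurable,
  hence the completion.\<close>

definition init_law :: "('w, 's) process \<Rightarrow> 's measure \<Rightarrow> 'w measure" where
  "init_law Z \<mu> = measure_of (space (events Z)) (sets (events Z))
     (\<lambda>A. \<integral>\<^sup>+x. emeasure (law Z x) A \<partial>completion \<mu>)"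

definition universal_augmentation ::
    "'s::topological_space set \<Rightarrow> ('w, 's) process \<Rightarrow> 'w set set \<Rightarrow> 'w set set" where
  "universal_augmentation S Z \<A> = {A. A \<subseteq> space (events Z) \<and>
     (\<forall>\<mu>. prob_on S \<mu> \<longrightarrow> (\<exists>B\<in>\<A>. \<exists>N\<in>null_sets (init_law Z \<mu>). (A - B) \<union> (B - A) \<subseteq> N))}"

definition resolvent :: "('w, 's) process \<Rightarrow> real \<Rightarrow> ('s \<Rightarrow> ennreal) \<Rightarrow> 's \<Rightarrow> ennreal" where
  "resolvent Z \<alpha> f x =
     (\<integral>\<^sup>+\<omega>. (\<integral>\<^sup>+t\<in>{0..}. ennreal (exp (- \<alpha> * t)) * ext0 f (path Z t \<omega>) \<partial>lborel) \<partial>law Z x)"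

definition excessive ::
    "'s::topological_space set \<Rightarrow> ('w, 's) process \<Rightarrow> real \<Rightarrow> ('s \<Rightarrow> ennreal) \<Rightarrow> bool" where
  "excessive S Z q v \<longleftrightarrow> v \<in> borel_measurable (restrict_space borel S) \<and>
     (\<forall>\<alpha>>0. \<forall>x\<in>S. ennreal \<alpha> * resolvent Z (q + \<alpha>) v x \<le> v x) \<and>
     (\<forall>x\<in>S. (SUP \<alpha>\<in>{0<..}. ennreal \<alpha> * resolvent Z (q + \<alpha>) v x) = v x)"

text \<open>Right continuity at times \<open>t\<close> with \<open>path Z t \<omega> = None\<close> is automatic, because the cemetery is
  absorbing. At the lifetime it forces the path to be in the cemetery.\<close>

definition right_continuous_path :: "('w, 's::topological_space) process \<Rightarrow> 'w \<Rightarrow> bool" where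
  "right_continuous_path Z \<omega> \<longleftrightarrow> (\<forall>t\<ge>0. \<forall>y. path Z t \<omega> = Some y \<longrightarrow>
     (\<forall>\<^sub>F s in at_right t. path Z s \<omega> \<noteq> None) \<and>
     ((\<lambda>s. the (path Z s \<omega>)) \<longlongrightarrow> y) (at_right t))"

locale normal_markov_process =
  fixes S :: "'s::topological_space set" and Z :: "('w, 's) process"
  assumes subalgebra_filt: "\<And>t. 0 \<le> t \<Longrightarrow> subalgebra (events Z) (filt Z t)"
    and filt_mono: "\<And>s t. 0 \<le> s \<Longrightarrow> s \<le> t \<Longrightarrow> sets (filt Z s) \<subseteq> sets (filt Z t)"
    and path_in: "\<And>t \<omega>. 0 \<le> t \<Longrightarrow> \<omega> \<in> space (events Z) \<Longrightarrow> path Z t \<omega> \<in> insert None (Some ` S)"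
    and absorbing: "\<And>s t \<omega>. 0 \<le> s \<Longrightarrow> s \<le> t \<Longrightarrow> \<omega> \<in> space (events Z) \<Longrightarrow>
          path Z s \<omega> = None \<Longrightarrow> path Z t \<omega> = None"
    and adapted: "\<And>t B. 0 \<le> t \<Longrightarrow> B \<in> sets (restrict_space borel S) \<Longrightarrow>
          {\<omega> \<in> space (events Z). path Z t \<omega> \<in> Some ` B} \<in> sets (filt Z t)"
    and shift_in: "\<And>t \<omega>. 0 \<le> t \<Longrightarrow> \<omega> \<in> space (events Z) \<Longrightarrow> shift Z t \<omega> \<in> space (events Z)"
    and path_shift: "\<And>s t \<omega>. 0 \<le> s \<Longrightarrow> 0 \<le> t \<Longrightarrow> \<omega> \<in> space (events Z) \<Longrightarrow>
          path Z s (shift Z t \<omega>) = path Z (s + t) \<omega>"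
    and prob_law: "\<And>x. x \<in> S \<Longrightarrow> prob_space (law Z x)"
    and sets_law: "\<And>x. x \<in> S \<Longrightarrow> sets (law Z x) = sets (events Z)"
    and law_universally_measurable: "\<And>A \<mu>. A \<in> sets (events Z) \<Longrightarrow> prob_on S \<mu> \<Longrightarrow>
          (\<lambda>x. emeasure (law Z x) A) \<in> borel_measurable (completion \<mu>)"
    and normal: "\<And>x. x \<in> S \<Longrightarrow> AE \<omega> in law Z x. path Z 0 \<omega> = Some x"
    and markov: "\<And>x s t A B. x \<in> S \<Longrightarrow> 0 \<le> s \<Longrightarrow> 0 \<le> t \<Longrightarrow> A \<in> sets (filt Z s) \<Longrightarrow>
          B \<in> sets (restrict_space borel S) \<Longrightarrow>
          emeasure (law Z x) {\<omega> \<in> A. path Z (s + t) \<omega> \<in> Some ` B} =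
          (\<integral>\<^sup>+\<omega>\<in>A. ext0 (\<lambda>y. emeasure (law Z y) {\<omega>' \<in> space (events Z). path Z t \<omega>' \<in> Some ` B})
             (path Z s \<omega>) \<partial>law Z x)"

text \<open>The resolvent consists of kernels on \<open>S\<close> with its Borel \<open>\<sigma>\<close>-algebra, i.e. the \<open>U\<^sub>\<alpha>\<close>
  preserve Borel functions.\<close>

locale right_process = normal_markov_process +
  assumes filt_right_continuous: "\<And>t. 0 \<le> t \<Longrightarrow> (\<Inter>s\<in>{t<..}. sets (filt Z s)) = sets (filt Z t)"
    and filt_augmented: "\<And>t. 0 \<le> t \<Longrightarrow>
          universal_augmentation S Z (sets (filt Z t)) = sets (filt Z t)"
    and paths_right_continuous: "\<And>x. x \<in> S \<Longrightarrow> AE \<omega> in law Z x. right_continuous_path Z \<omega>"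
    and resolvent_borel: "\<And>\<alpha> f. 0 < \<alpha> \<Longrightarrow> f \<in> borel_measurable (restrict_space borel S) \<Longrightarrow>
          resolvent Z \<alpha> f \<in> borel_measurable (restrict_space borel S)"
    and excessive_right_continuous: "\<And>q v x. 0 < q \<Longrightarrow> excessive S Z q v \<Longrightarrow> x \<in> S \<Longrightarrow>
          AE \<omega> in law Z x. \<forall>t\<ge>0. continuous (at_right t) (\<lambda>s. ext0 v (path Z s \<omega>))"

definition cadlag :: "'s::topological_space set \<Rightarrow> ('w, 's) process \<Rightarrow> bool" where
  "cadlag S Z \<longleftrightarrow> (\<forall>x\<in>S. AE \<omega> in law Z x. right_continuous_path Z \<omega> \<and>
     (\<forall>t>0. ereal t < lifetime Z \<omega> \<longrightarrow> (\<exists>l\<in>S. ((\<lambda>s. the (path Z s \<omega>)) \<longlongrightarrow> l) (at_left t))))"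


section \<open>Resolvents on Lebesgue spaces\<close>

definition Lp :: "'s measure \<Rightarrow> real \<Rightarrow> ('s \<Rightarrow> real) set" where
  "Lp m p = {f \<in> borel_measurable m. integrable m (\<lambda>x. \<bar>f x\<bar> powr p)}"

definition Lp_norm :: "'s measure \<Rightarrow> real \<Rightarrow> ('s \<Rightarrow> real) \<Rightarrow> real" where
  "Lp_norm m p f = (\<integral>x. \<bar>f x\<bar> powr p \<partial>m) powr (1 / p)"

text \<open>Bounded operators on classes modulo null functions, expressed on representatives; that
  equivalent functions have equivalent images follows from linearity and boundedness.\<close>

definition bounded_Lp_operator ::
    "'s measure \<Rightarrow> real \<Rightarrow> (('s \<Rightarrow> real) \<Rightarrow> 's \<Rightarrow> real) \<Rightarrow> bool" where
  "bounded_Lp_operator m p T \<longleftrightarrow> (\<forall>f\<in>Lp m p. T f \<in> Lp m p) \<and>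
     (\<forall>f\<in>Lp m p. \<forall>g\<in>Lp m p. AE x in m. T (\<lambda>y. f y + g y) x = T f x + T g x) \<and>
     (\<forall>c. \<forall>f\<in>Lp m p. AE x in m. T (\<lambda>y. c * f y) x = c * T f x) \<and>
     (\<exists>C. \<forall>f\<in>Lp m p. Lp_norm m p (T f) \<le> C * Lp_norm m p f)"

definition strongly_continuous_Lp :: "('w, 's) process \<Rightarrow> 's measure \<Rightarrow> real \<Rightarrow> real \<Rightarrow> bool" where
  "strongly_continuous_Lp Z m p \<alpha>\<^sub>0 \<longleftrightarrow> (\<exists>V.
     (\<forall>\<alpha>>\<alpha>\<^sub>0. bounded_Lp_operator m p (V \<alpha>) \<and>
        (\<forall>f\<in>Lp m p. (\<forall>x\<in>space m. 0 \<le> f x) \<longrightarrow>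
           (AE x in m. resolvent Z \<alpha> (\<lambda>y. ennreal (f y)) x < \<top> \<and>
              V \<alpha> f x = enn2real (resolvent Z \<alpha> (\<lambda>y. ennreal (f y)) x)))) \<and>
     (\<forall>f\<in>Lp m p. ((\<lambda>\<alpha>. Lp_norm m p (\<lambda>x. \<alpha> * V \<alpha> f x - f x)) \<longlongrightarrow> 0) at_top))"


section \<open>Martingale problem\<close>

definition martingale :: "'w measure \<Rightarrow> (real \<Rightarrow> 'w measure) \<Rightarrow> (real \<Rightarrow> 'w \<Rightarrow> real) \<Rightarrow> bool" where
  "martingale P F Y \<longleftrightarrow>
     (\<forall>t\<ge>0. Y t \<in> borel_measurable (F t) \<and> integrable P (Y t)) \<and>
     (\<forall>s t. 0 \<le> s \<and> s \<le> t \<longrightarrow> (AE \<omega> in P. real_cond_exp P (F s) (Y t) \<omega> = Y s \<omega>))"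

definition stop_at_lifetime :: "('w, 's) process \<Rightarrow> real \<Rightarrow> 'w \<Rightarrow> real" where
  "stop_at_lifetime Z t \<omega> = real_of_ereal (min (ereal t) (lifetime Z \<omega>))"

definition solves_martingale_problem ::
    "'s::topological_space set \<Rightarrow> ('w, 's) process \<Rightarrow> 's measure
     \<Rightarrow> ('s \<Rightarrow> real) set \<Rightarrow> (('s \<Rightarrow> real) \<Rightarrow> 's \<Rightarrow> real) \<Rightarrow> bool" where
  "solves_martingale_problem S Z m \<D> L \<longleftrightarrow> (\<forall>f\<in>\<D>.
     L f \<in> borel_measurable (restrict_space borel S) \<and>
     (AE x in m. martingale (law Z x) (filt Z)
        (\<lambda>t \<omega>. ext0 f (path Z (stop_at_lifetime Z t \<omega>) \<omega>)
           - (LBINT r:{0..stop_at_lifetime Z t \<omega>}. ext0 (L f) (path Z r \<omega>)))))"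


section \<open>Diffusions on an open set\<close>

definition inessential ::
    "'s::topological_space set \<Rightarrow> ('w, 's) process \<Rightarrow> 's measure \<Rightarrow> 's set \<Rightarrow> bool" where
  "inessential S Z m N \<longleftrightarrow> N \<in> sets (restrict_space borel S) \<and> emeasure m N = 0 \<and>
     (\<forall>x\<in>S - N. AE \<omega> in law Z x. \<not> hit Z N \<omega> < \<infinity>)"

definition quasi_everywhere ::
    "'s::topological_space set \<Rightarrow> ('w, 's) process \<Rightarrow> 's measure \<Rightarrow> ('s \<Rightarrow> bool) \<Rightarrow> bool" where
  "quasi_everywhere S Z m Q \<longleftrightarrow> (\<exists>N. inessential S Z m N \<and> (\<forall>x\<in>S - N. Q x))"

definition exhaustion :: "'s::topological_space set \<Rightarrow> 's set \<Rightarrow> (nat \<Rightarrow> 's set) \<Rightarrow> bool" where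
  "exhaustion S G \<G> \<longleftrightarrow> (\<forall>n. openin (top_of_set S) (\<G> n) \<and> \<G> n \<subseteq> G \<and>
     (top_of_set S closure_of \<G> n) \<subseteq> \<G> (Suc n)) \<and> (\<Union>n. \<G> n) = G"

text \<open>\<open>\<tau> + T\<^sub>A \<circ> \<theta>\<^sub>\<tau>\<close>, which is infinite where \<open>\<tau>\<close> is.\<close>

definition hit_after :: "('w, 's) process \<Rightarrow> 's set \<Rightarrow> ('w \<Rightarrow> ereal) \<Rightarrow> 'w \<Rightarrow> ereal" where
  "hit_after Z A \<tau> \<omega> =
     (if \<tau> \<omega> = \<infinity> then \<infinity> else \<tau> \<omega> + hit Z A (shift Z (real_of_ereal (\<tau> \<omega>)) \<omega>))"

text \<open>The index \<open>k\<close> starts at 0 here.\<close>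

primrec entry_time :: "'s set \<Rightarrow> ('w, 's) process \<Rightarrow> 's set \<Rightarrow> 's set \<Rightarrow> nat \<Rightarrow> 'w \<Rightarrow> ereal" where
  "entry_time S Z G G' 0 = hit Z G'"
| "entry_time S Z G G' (Suc k) = hit_after Z G' (hit_after Z (S - G) (entry_time S Z G G' k))"

definition exit_time :: "'s set \<Rightarrow> ('w, 's) process \<Rightarrow> 's set \<Rightarrow> 's set \<Rightarrow> nat \<Rightarrow> 'w \<Rightarrow> ereal" where
  "exit_time S Z G G' k = hit_after Z (S - G) (entry_time S Z G G' k)"

definition sojourn :: "'s set \<Rightarrow> ('w, 's) process \<Rightarrow> 's set \<Rightarrow> (nat \<Rightarrow> 's set) \<Rightarrow> 'w \<Rightarrow> real set" where
  "sojourn S Z G \<G> \<omega> = (\<Union>n. \<Union>k.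
     {t. entry_time S Z G (\<G> n) k \<omega> < ereal t \<and> ereal t < exit_time S Z G (\<G> n) k \<omega>})"

text \<open>Exhaustions exist since \<open>S\<close> is metrizable in the intended use, and the sojourn set of a
  cadlag path does not depend on the exhaustion; the definition asks for all of them.\<close>

definition diffusion_qe ::
    "'s::topological_space set \<Rightarrow> ('w, 's) process \<Rightarrow> 's measure \<Rightarrow> 's set \<Rightarrow> bool" where
  "diffusion_qe S Z m G \<longleftrightarrow> (\<forall>\<G>. exhaustion S G \<G> \<longrightarrow>
     quasi_everywhere S Z m (\<lambda>x. AE \<omega> in law Z x.
       continuous_on {t \<in> sojourn S Z G \<G> \<omega>. 0 \<le> t \<and> ereal t < lifetime Z \<omega>}
         (\<lambda>t. the (path Z t \<omega>))))"

end

theory Submission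
  imports Defs
begin

text \<open>If a test function \<open>\<psi> \<ge> 0\<close> vanishes at \<open>y\<close>, the martingale problem bounds \<open>E\<^sup>y \<psi>(X\<^sub>h)\<close> by
  the expected integral of \<open>|L \<psi>|\<close> along the path over \<open>[0, h]\<close>. Summing this over a fine time grid
  and restricting each step to an adapted event contained in \<open>\<psi> = 0\<close> shows that the jumps into
  \<open>\<psi> > 0\<close> that occur while the events hold are controlled by the integral of \<open>|L \<psi>|\<close> over the times
  at which they hold. For the event that the path is in a closed subset of \<open>G\<close> near which \<open>\<psi>\<close>
  vanishes, that integral is zero, because \<open>L\<close> is local where the Levy measure is null; hence there are
  no jumps out of points of \<open>G\<close>. While staying in \<open>G\<close> the path might still jump from a left limit on
  the boundary of \<open>G\<close>; but such a jump is announced by the approach to the boundary, and the times at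
  which the path has come \<open>1/n\<close>-close to the boundary without having reached it shrink to a single
  instant, so that the integral vanishes again in the limit.

  The martingale problem may fail on an \<open>m\<close>-null set \<open>N\<^sub>0\<close>. Its potential vanishes \<open>m\<close>-almost
  everywhere since the resolvent acts on \<open>L\<^sup>p\<close>, and the potential is excessive, so its zero set is
  absorbing: the points with positive potential form an inessential set. From every other point the
  path avoids \<open>N\<^sub>0\<close> at almost every time, which suffices to run the argument on suitable grids.\<close>

section \<open>Paths with a cemetery\<close>

text \<open>The martingale bound holds only from starting points outside a null set, and the Markov
  property is given at deterministic times. So jumps are counted on uniform grids, shifted by a
  start \<open>s\<close> for which the path almost surely avoids the null set at every grid point;
  by translation invariance almost every \<open>s\<close> will do, and a countable dense set of such
  starts is fixed. Since \<open>L \<psi>\<close> is known only to lie in \<open>L^p\<close>, its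
  integral along a path started at a given point need not have finite mean; it does on the event
  that the potential of its absolute value, evaluated at the state at time \<open>s\<close>, is at
  most \<open>K\<close>, and as \<open>K\<close> grows these events exhaust almost all paths alive
  at \<open>s\<close>. Each test function brings its own exceptional sets, so a countable family is
  needed; it has to contain, for a left limit \<open>y\<close> and a landing point \<open>z\<close>,
  a function vanishing near \<open>y\<close> and positive at \<open>z\<close>. Products of smooth
  bumps in finitely many coordinates, with rational parameters, do this. Laws depend only
  universally measurably on the starting point, hence the completions.\<close>

definition cemetery_space :: "'s::topological_space set \<Rightarrow> 's option measure" where
  "cemetery_space S = sigma (insert None (Some ` S)) ((`) Some ` sets (restrict_space borel S))"

lemma cemetery_generators:
  "(`) Some ` sets (restrict_space borel S) \<subseteq> Pow (insert None (Some ` S))"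
  by (auto dest!: sets.sets_into_space simp: space_restrict_space)

lemma space_cemetery_space [simp]: "space (cemetery_space S) = insert None (Some ` S)"
  unfolding cemetery_space_def using cemetery_generators by (rule space_measure_of)

lemma sets_cemetery_space:
  "sets (cemetery_space S) =
     sigma_sets (insert None (Some ` S)) ((`) Some ` sets (restrict_space borel S))"
  unfolding cemetery_space_def using cemetery_generators by (rule sets_measure_of)

lemma image_Some_in_cemetery_space:
  "B \<in> sets (restrict_space borel S) \<Longrightarrow> Some ` B \<in> sets (cemetery_space S)"
  by (auto simp: sets_cemetery_space)

lemma measurable_cemetery_space:
  assumes "\<And>\<omega>. \<omega> \<in> space M \<Longrightarrow> Y \<omega> \<in> insert None (Some ` S)"
    and "\<And>B. B \<in> sets (restrict_space borel S) \<Longrightarrow> {\<omega> \<in> space M. Y \<omega> \<in> Some ` B} \<in> sets M"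
  shows "Y \<in> measurable M (cemetery_space S)"
proof (rule measurable_sigma_sets[OF sets_cemetery_space cemetery_generators])
  show "Y \<in> space M \<rightarrow> insert None (Some ` S)"
    using assms(1) by auto
  fix A assume "A \<in> (`) Some ` sets (restrict_space borel S)"
  then obtain B where "B \<in> sets (restrict_space borel S)" "A = Some ` B" by auto
  moreover have "Y -` Some ` B \<inter> space M = {\<omega> \<in> space M. Y \<omega> \<in> Some ` B}" by auto
  ultimately show "Y -` A \<inter> space M \<in> sets M" using assms(2) by simp
qed

lemma ext0_simps [simp]: "ext0 f None = 0" "ext0 f (Some x) = f x"
  by (auto simp: ext0_def)

text \<open>The one set that the generators do not supply directly is the cemetery alone; it is the
  complement of the image of \<open>S\<close>.\<close>

lemma measurable_case_option_cemetery_space: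
  assumes f: "f \<in> measurable (restrict_space borel S) N" and c: "c \<in> space N"
  shows "case_option c f \<in> measurable (cemetery_space S) N"
proof (rule measurableI)
  fix y assume "y \<in> space (cemetery_space S)"
  then show "case_option c f y \<in> space N"
    using measurable_space[OF f] c by (auto simp: space_restrict_space)
next
  fix A assume A: "A \<in> sets N"
  have S: "S \<in> sets (restrict_space borel S)"
    using sets.top[of "restrict_space borel S"] by (simp add: space_restrict_space)
  have B: "f -` A \<inter> S \<in> sets (restrict_space borel S)"
    using measurable_sets[OF f A] by (simp add: space_restrict_space)
  have None: "{None} \<in> sets (cemetery_space S)"
  proof -
    have "{None} = space (cemetery_space S) - Some ` S" by auto
    then show ?thesis using image_Some_in_cemetery_space[OF S] by (metis sets.compl_sets)
  qed
  have "case_option c f -` A \<inter> space (cemetery_space S) = Some ` (f -` A \<inter> S) \<union> (if c \<in> A then {None} else {})"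
    by (auto split: option.splits if_splits)
  also have "\<dots> \<in> sets (cemetery_space S)"
    using None image_Some_in_cemetery_space[OF B]
    by (cases "c \<in> A") (auto simp del: Un_insert_right)
  finally show "case_option c f -` A \<inter> space (cemetery_space S) \<in> sets (cemetery_space S)" .
qed

lemma measurable_ext0:
  assumes "f \<in> measurable (restrict_space borel S) N" "0 \<in> space N"
  shows "ext0 f \<in> measurable (cemetery_space S) N"
proof -
  have "ext0 f = case_option 0 f"
    by (auto simp: ext0_def fun_eq_iff)
  then show ?thesis
    using measurable_case_option_cemetery_space[OF assms] by simp
qed

lemma in_restrict_borelE:
  assumes "B \<in> sets (restrict_space borel S)"
  obtains B' where "B' \<in> sets borel" "B = S \<inter> B'"
  using assms by (auto simp: sets_restrict_space)

text \<open>The least multiple of \<open>1 / (1 + k)\<close> strictly above \<open>t\<close>.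
  Strictness matters, since limits along \<open>at_right t\<close> ignore \<open>t\<close> itself;
  the discreteness of the values is what later gives measurability in \<open>t\<close>.\<close>

definition grid_above :: "nat \<Rightarrow> real \<Rightarrow> real" where
  "grid_above k t = (of_int \<lfloor>t * (1 + real k)\<rfloor> + 1) / (1 + real k)"

lemma grid_above_greater: "t < grid_above k t"
proof -
  have "t * (1 + real k) < of_int \<lfloor>t * (1 + real k)\<rfloor> + 1" by linarith
  then show ?thesis by (simp add: grid_above_def pos_less_divide_eq)
qed

lemma grid_above_le: "grid_above k t \<le> t + 1 / (1 + real k)"
proof -
  have "of_int \<lfloor>t * (1 + real k)\<rfloor> + 1 \<le> t * (1 + real k) + 1" by linarith
  then have "grid_above k t \<le> (t * (1 + real k) + 1) / (1 + real k)"
    unfolding grid_above_def by (intro divide_right_mono) auto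
  also have "\<dots> = t + 1 / (1 + real k)" by (simp add: add_divide_distrib)
  finally show ?thesis .
qed

lemma filterlim_at_right_grid_above: "filterlim (\<lambda>k. grid_above k t) (at_right t) sequentially"
proof -
  have "(\<lambda>k. grid_above k t) \<longlonglongrightarrow> t"
  proof (rule tendsto_sandwich)
    show "\<forall>\<^sub>F k in sequentially. t \<le> grid_above k t"
      using grid_above_greater[of t] by (auto intro!: always_eventually less_imp_le)
    show "\<forall>\<^sub>F k in sequentially. grid_above k t \<le> t + 1 / (1 + real k)"
      using grid_above_le[of _ t] by auto
    have "(\<lambda>k. t + 1 / (1 + real k)) \<longlonglongrightarrow> t + 0"
      using LIMSEQ_inverse_real_of_nat by (intro tendsto_intros) (simp add: inverse_eq_divide add.commute)
    then show "(\<lambda>k. t + 1 / (1 + real k)) \<longlonglongrightarrow> t" by simp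
  qed simp
  then show ?thesis
    using grid_above_greater[of t] by (auto simp: filterlim_at less_imp_neq[symmetric])
qed

section \<open>Joint measurability of the paths in time and sample point\<close>

locale metric_right_process = right_process S Z
  for S :: "'s::metric_space set" and Z :: "('w, 's) process"
begin

abbreviation BS :: "'s measure" where "BS \<equiv> restrict_space borel S"

abbreviation pos :: "real \<Rightarrow> 'w \<Rightarrow> 's" where "pos t \<omega> \<equiv> the (path Z t \<omega>)"

abbreviation solves_at :: "('s \<Rightarrow> real) \<Rightarrow> ('s \<Rightarrow> real) \<Rightarrow> 's \<Rightarrow> bool" where
  "solves_at f g y \<equiv> martingale (law Z y) (filt Z)
     (\<lambda>t \<omega>. ext0 f (path Z (stop_at_lifetime Z t \<omega>) \<omega>)
        - (LBINT r:{0..stop_at_lifetime Z t \<omega>}. ext0 g (path Z r \<omega>)))"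

lemma space_BS: "space BS = S"
  by (simp add: space_restrict_space)

lemma S_in_BS: "S \<in> sets BS"
  using sets.top[of BS] by (simp add: space_BS)

lemma space_law: "x \<in> S \<Longrightarrow> space (law Z x) = space (events Z)"
  using sets_law by (metis sets_eq_imp_space_eq)

lemma space_filt: "0 \<le> t \<Longrightarrow> space (filt Z t) = space (events Z)"
  using subalgebra_filt[of t] by (simp add: subalgebra_def)

lemma sets_filt_subset: "0 \<le> t \<Longrightarrow> sets (filt Z t) \<subseteq> sets (events Z)"
  using subalgebra_filt[of t] by (simp add: subalgebra_def)

lemma subalgebra_law: "x \<in> S \<Longrightarrow> 0 \<le> t \<Longrightarrow> subalgebra (law Z x) (filt Z t)"
  using sets_filt_subset[of t] by (simp add: subalgebra_def space_filt space_law sets_law)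

lemma measurable_path_filt: "0 \<le> t \<Longrightarrow> path Z t \<in> measurable (filt Z t) (cemetery_space S)"
  using path_in[of t] adapted[of t] by (intro measurable_cemetery_space) (auto simp: space_filt)

lemma measurable_path: "0 \<le> t \<Longrightarrow> x \<in> S \<Longrightarrow> path Z t \<in> measurable (law Z x) (cemetery_space S)"
  using measurable_from_subalg[OF subalgebra_law measurable_path_filt] by blast

lemma AE_space_law: "x \<in> S \<Longrightarrow> AE \<omega> in law Z x. \<omega> \<in> space (events Z)"
  using AE_space[of "law Z x"] by (simp add: space_law)

lemma measurable_path_ext0:
  "0 \<le> t \<Longrightarrow> x \<in> S \<Longrightarrow> f \<in> borel_measurable BS \<Longrightarrow>
     (\<lambda>\<omega>. ext0 f (path Z t \<omega>)) \<in> borel_measurable (law Z x)"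
  by (rule measurable_compose[OF measurable_path measurable_ext0]) auto

lemma right_continuous_pathD:
  assumes "right_continuous_path Z \<omega>" "0 \<le> t" "path Z t \<omega> = Some y"
    "filterlim r (at_right t) F"
  shows "\<forall>\<^sub>F k in F. path Z (r k) \<omega> \<noteq> None" "((\<lambda>k. pos (r k) \<omega>) \<longlongrightarrow> y) F"
proof -
  have *: "\<forall>\<^sub>F s in at_right t. path Z s \<omega> \<noteq> None" "((\<lambda>s. pos s \<omega>) \<longlongrightarrow> y) (at_right t)"
    using assms(1)[unfolded right_continuous_path_def, rule_format, OF assms(2,3)] by auto
  show "\<forall>\<^sub>F k in F. path Z (r k) \<omega> \<noteq> None"
    using *(1) assms(4) by (rule eventually_compose_filterlim)
  show "((\<lambda>k. pos (r k) \<omega>) \<longlongrightarrow> y) F"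
    using *(2) assms(4) by (rule filterlim_compose)
qed

text \<open>Turns a condition on the state at time \<open>t\<close> into countably many conditions
  at grid times. A state in \<open>U\<close> has positive distance from the complement, and so have
  the states at the grid times soon after; conversely the sets of points at distance at least
  \<open>1 / Suc j\<close> are closed and keep the limit inside \<open>U\<close>. The case
  \<open>U = UNIV\<close> is separate because \<open>infdist\<close> to the empty set is 0.\<close>

lemma path_open_iff:
  assumes \<omega>: "\<omega> \<in> space (events Z)" "right_continuous_path Z \<omega>" and t: "0 \<le> t" and U: "open U"
  shows "path Z t \<omega> \<in> Some ` (S \<inter> U) \<longleftrightarrow>
    (\<exists>j. \<forall>\<^sub>F k in sequentially. path Z (grid_above k t) \<omega> \<in> Some ` (S \<inter> {q. 1 / real (Suc j) \<le> infdist q (- U) \<or> U = UNIV}))"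
    (is "?L \<longleftrightarrow> (\<exists>j. \<forall>\<^sub>F k in sequentially. ?R j k)")
proof
  assume ?L
  then obtain y where y: "path Z t \<omega> = Some y" "y \<in> S" "y \<in> U" by auto
  note rc = right_continuous_pathD[OF \<omega>(2) t y(1) filterlim_at_right_grid_above]
  have inS: "\<forall>\<^sub>F k in sequentially. path Z (grid_above k t) \<omega> \<in> Some ` S"
    using rc(1)
  proof eventually_elim
    case (elim k)
    have "0 \<le> grid_above k t" using grid_above_greater[of t k] t by linarith
    then show ?case using path_in[of "grid_above k t" \<omega>] elim \<omega> by auto
  qed
  show "\<exists>j. \<forall>\<^sub>F k in sequentially. ?R j k"
  proof (cases "U = UNIV")
    case True then show ?thesis using inS by auto
  next
    case False
    then have pos: "0 < infdist y (- U)"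
      using U y(3) infdist_pos_not_in_closed[of "- U" y] by auto
    then obtain j where j: "1 / real (Suc j) < infdist y (- U)"
      by (metis nat_approx_posE of_nat_Suc)
    have "((\<lambda>k. infdist (pos (grid_above k t) \<omega>) (- U)) \<longlongrightarrow> infdist y (- U)) sequentially"
      by (rule tendsto_infdist[OF rc(2)])
    then have "\<forall>\<^sub>F k in sequentially. 1 / real (Suc j) < infdist (pos (grid_above k t) \<omega>) (- U)"
      using j by (rule order_tendstoD)
    with inS have "\<forall>\<^sub>F k in sequentially. ?R j k"
    proof eventually_elim
      case (elim k)
      then obtain z where "path Z (grid_above k t) \<omega> = Some z" "z \<in> S" by auto
      with elim show ?case by (auto simp: less_imp_le)
    qed
    then show ?thesis ..
  qed
next
  assume "\<exists>j. \<forall>\<^sub>F k in sequentially. ?R j k"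
  then obtain j where j: "\<forall>\<^sub>F k in sequentially. ?R j k" by blast
  have "path Z t \<omega> \<noteq> None"
  proof
    assume None: "path Z t \<omega> = None"
    obtain k where "?R j k" using eventually_happens[OF j] by auto
    moreover have "path Z (grid_above k t) \<omega> = None"
      using absorbing[OF t _ \<omega>(1) None] grid_above_greater[of t k] by auto
    ultimately show False by auto
  qed
  then obtain y where y: "path Z t \<omega> = Some y" "y \<in> S" using path_in[OF t \<omega>(1)] by auto
  note rc = right_continuous_pathD[OF \<omega>(2) t y(1) filterlim_at_right_grid_above]
  have "U = UNIV \<or> 1 / real (Suc j) \<le> infdist y (- U)"
  proof (cases "U = UNIV")
    case False
    have "((\<lambda>k. infdist (pos (grid_above k t) \<omega>) (- U)) \<longlongrightarrow> infdist y (- U)) sequentially"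
      by (rule tendsto_infdist[OF rc(2)])
    moreover have "\<forall>\<^sub>F k in sequentially. 1 / real (Suc j) \<le> infdist (pos (grid_above k t) \<omega>) (- U)"
      using j by eventually_elim (use False in auto)
    ultimately have "1 / real (Suc j) \<le> infdist y (- U)"
      by (rule tendsto_lowerbound) simp
    then show ?thesis ..
  qed simp
  moreover have "y \<in> U" if "1 / real (Suc j) \<le> infdist y (- U)"
  proof (rule ccontr)
    assume "y \<notin> U"
    then have "infdist y (- U) = 0" by (intro infdist_zero) simp
    with that show False by simp
  qed
  ultimately show ?L using y by auto
qed

end

lemma (in metric_right_process) grid_above_nonneg: "0 \<le> t \<Longrightarrow> 0 \<le> grid_above k t"
  using grid_above_greater[of t k] by linarith

context metric_right_process
begin

lemma AE_good:
  assumes "x \<in> S"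
  shows "AE \<omega> in law Z x. \<omega> \<in> space (events Z) \<and> right_continuous_path Z \<omega>"
  using AE_space_law[OF assms] paths_right_continuous[OF assms] by eventually_elim simp

text \<open>Right continuity holds only almost surely and the product sigma-algebra need not be
  complete, so the version \<open>Y\<close> is declared dead on an exceptional set and at negative
  times.\<close>

lemma jointly_measurable_path:
  assumes x: "x \<in> S"
  shows "\<exists>Y. (\<lambda>(t, \<omega>). Y t \<omega>) \<in> measurable (borel \<Otimes>\<^sub>M law Z x) (cemetery_space S) \<and>
    (AE \<omega> in law Z x. \<forall>t\<ge>0. Y t \<omega> = path Z t \<omega>)"
proof -
  obtain N where N: "{\<omega> \<in> space (law Z x). \<not> (\<omega> \<in> space (events Z) \<and> right_continuous_path Z \<omega>)} \<subseteq> N"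
    "emeasure (law Z x) N = 0" "N \<in> sets (law Z x)"
    using AE_E[OF AE_good[OF x]] by blast
  define Y where "Y t \<omega> = (if \<omega> \<in> N \<or> t < 0 then None else path Z t \<omega>)" for t :: real and \<omega>
  let ?M = "borel \<Otimes>\<^sub>M law Z x :: (real \<times> 'w) measure"
  have good: "\<omega> \<in> space (events Z)" "right_continuous_path Z \<omega>" if "\<omega> \<in> space (law Z x)" "\<omega> \<notin> N" for \<omega>
    using N(1) that by auto
  \<comment> \<open>For fixed \<open>k\<close> the grid time takes countably many values, and each
    of them gives a measurable function of the sample point.\<close>
  have step: "{p \<in> space ?M. path Z (grid_above k (max 0 (fst p))) (snd p) \<in> Some ` B} \<in> sets ?M"
    if B: "B \<in> sets BS" for B k
  proof -
    define i where "i p = nat \<lfloor>max 0 (fst p) * (1 + real k)\<rfloor>" for p :: "real \<times> 'w"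
    have 1: "Measurable.pred ?M (\<lambda>p. path Z ((real j + 1) / (1 + real k)) (snd p) \<in> Some ` B)" for j :: nat
    proof -
      have "0 \<le> (real j + 1) / (1 + real k)" by simp
      from measurable_path[OF this x]
      have "(\<lambda>p. path Z ((real j + 1) / (1 + real k)) (snd p)) \<in> measurable ?M (cemetery_space S)"
        by (rule measurable_compose[OF measurable_snd])
      from measurable_sets[OF this image_Some_in_cemetery_space[OF B]]
      show ?thesis by (simp add: pred_def vimage_def Int_def conj_commute)
    qed
    have 2: "i \<in> measurable ?M (count_space UNIV)"
      unfolding i_def by measurable
    have "Measurable.pred ?M (\<lambda>p. (\<lambda>j p. path Z ((real j + 1) / (1 + real k)) (snd p) \<in> Some ` B) (i p) p)"
      using 1 2 by (rule measurable_compose_countable)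
    moreover have "(real (i p) + 1) / (1 + real k) = grid_above k (max 0 (fst p))" for p
      by (simp add: grid_above_def i_def)
    ultimately show ?thesis by (simp add: pred_def)
  qed
  have base: "{p \<in> space ?M. Y (fst p) (snd p) \<in> Some ` (S \<inter> U)} \<in> sets ?M" if U: "open U" for U
  proof -
    define F where "F j = S \<inter> {q. 1 / real (Suc j) \<le> infdist q (- U) \<or> U = UNIV}" for j
    have F: "F j \<in> sets BS" for j
    proof -
      have "closed {q. 1 / real (Suc j) \<le> infdist q (- U)}"
        by (intro closed_Collect_le continuous_intros)
      then have "closed {q. 1 / real (Suc j) \<le> infdist q (- U) \<or> U = UNIV}"
        by (cases "U = UNIV") auto
      then show ?thesis unfolding F_def by (auto simp: sets_restrict_space)
    qed
    have "{p \<in> space ?M. Y (fst p) (snd p) \<in> Some ` (S \<inter> U)} =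
      {p \<in> space ?M. snd p \<notin> N \<and> 0 \<le> fst p \<and>
         (\<exists>j. \<forall>\<^sub>F k in sequentially. path Z (grid_above k (max 0 (fst p))) (snd p) \<in> Some ` F j)}"
    proof (intro Collect_cong conj_cong refl)
      fix p assume p: "p \<in> space ?M"
      show "Y (fst p) (snd p) \<in> Some ` (S \<inter> U) \<longleftrightarrow> snd p \<notin> N \<and> 0 \<le> fst p \<and>
         (\<exists>j. \<forall>\<^sub>F k in sequentially. path Z (grid_above k (max 0 (fst p))) (snd p) \<in> Some ` F j)"
      proof (cases "snd p \<notin> N \<and> 0 \<le> fst p")
        case True
        then have "max 0 (fst p) = fst p" by simp
        moreover have "snd p \<in> space (law Z x)" using p by (auto simp: space_pair_measure)
        ultimately show ?thesis
          using True path_open_iff[OF good[of "snd p"] _ U, of "fst p"] by (simp add: Y_def F_def)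
      qed (auto simp: Y_def)
    qed
    also have "\<dots> \<in> sets ?M"
    proof -
      have [measurable]: "Measurable.pred ?M (\<lambda>p. path Z (grid_above k (max 0 (fst p))) (snd p) \<in> Some ` F j)" for j k
        using step[OF F[of j], of k] by (simp add: pred_def)
      have [measurable]: "N \<in> sets (law Z x)" by fact
      show ?thesis
        unfolding eventually_sequentially by measurable
    qed
    finally show ?thesis .
  qed
  have Yin: "Y (fst p) (snd p) \<in> insert None (Some ` S)" if "p \<in> space ?M" for p
    using that path_in[of "fst p" "snd p"] by (auto simp: Y_def space_pair_measure space_law[OF x])
  have sets: "{p \<in> space ?M. Y (fst p) (snd p) \<in> Some ` (S \<inter> B)} \<in> sets ?M"
    if "B \<in> sigma_sets UNIV {U. open U}" for B
    using that
  proof induction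
    case (Basic U) then show ?case using base by simp
  next
    case Empty show ?case by simp
  next
    case (Compl B)
    have "{p \<in> space ?M. Y (fst p) (snd p) \<in> Some ` (S \<inter> (UNIV - B))} =
      {p \<in> space ?M. Y (fst p) (snd p) \<in> Some ` (S \<inter> UNIV)} - {p \<in> space ?M. Y (fst p) (snd p) \<in> Some ` (S \<inter> B)}"
      by auto
    also have "\<dots> \<in> sets ?M" using base[OF open_UNIV] Compl(2) by (rule sets.Diff)
    finally show ?case .
  next
    case (Union B)
    have "{p \<in> space ?M. Y (fst p) (snd p) \<in> Some ` (S \<inter> (\<Union>i. B i))} =
      (\<Union>i. {p \<in> space ?M. Y (fst p) (snd p) \<in> Some ` (S \<inter> B i)})"
      by auto
    also have "\<dots> \<in> sets ?M" using Union by (intro sets.countable_UN) auto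
    finally show ?case .
  qed
  have "(\<lambda>p. Y (fst p) (snd p)) \<in> measurable ?M (cemetery_space S)"
  proof (rule measurable_cemetery_space[OF Yin])
    fix B assume "B \<in> sets BS"
    then obtain B' where "B' \<in> sets borel" "B = S \<inter> B'" by (rule in_restrict_borelE)
    then show "{p \<in> space ?M. Y (fst p) (snd p) \<in> Some ` B} \<in> sets ?M"
      using sets[of B'] by (simp add: borel_def)
  qed
  moreover have "AE \<omega> in law Z x. \<forall>t\<ge>0. Y t \<omega> = path Z t \<omega>"
  proof -
    have "AE \<omega> in law Z x. \<omega> \<notin> N" using N by (intro AE_not_in) auto
    then show ?thesis by eventually_elim (auto simp: Y_def)
  qed
  ultimately show ?thesis by (auto simp: case_prod_beta')
qed

section \<open>The transition function\<close>

definition transition :: "real \<Rightarrow> ('s \<Rightarrow> ennreal) \<Rightarrow> 's \<Rightarrow> ennreal" where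
  "transition t f y = (\<integral>\<^sup>+\<omega>. ext0 f (path Z t \<omega>) \<partial>law Z y)"

lemma transition_cong:
  assumes "y \<in> S" "0 \<le> t" "\<And>q. q \<in> S \<Longrightarrow> f q = f' q"
  shows "transition t f y = transition t f' y"
  unfolding transition_def
proof (rule nn_integral_cong)
  fix \<omega> assume "\<omega> \<in> space (law Z y)"
  then have "path Z t \<omega> \<in> insert None (Some ` S)"
    using path_in assms by (simp add: space_law)
  then show "ext0 f (path Z t \<omega>) = ext0 f' (path Z t \<omega>)"
    using assms(3) by auto
qed

lemma transition_indicator:
  assumes "y \<in> S" "0 \<le> t" "B \<in> sets BS"
  shows "transition t (indicator B) y = emeasure (law Z y) {\<omega> \<in> space (events Z). path Z t \<omega> \<in> Some ` B}"
proof -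
  have "transition t (indicator B) y = (\<integral>\<^sup>+\<omega>. indicator {\<omega> \<in> space (events Z). path Z t \<omega> \<in> Some ` B} \<omega> \<partial>law Z y)"
    unfolding transition_def
    by (rule nn_integral_cong)
       (auto simp: ext0_def space_law[OF assms(1)] indicator_def split: option.splits)
  moreover have "{\<omega> \<in> space (events Z). path Z t \<omega> \<in> Some ` B} \<in> sets (law Z y)"
    using adapted[OF assms(2,3)] sets_filt_subset[OF assms(2)] sets_law[OF assms(1)] by auto
  ultimately show ?thesis by simp
qed

lemma transition_le_1:
  assumes "y \<in> S" "\<And>q. f q \<le> 1"
  shows "transition t f y \<le> 1"
proof -
  interpret prob_space "law Z y" using prob_law[OF assms(1)] .
  have "transition t f y \<le> (\<integral>\<^sup>+\<omega>. 1 \<partial>law Z y)"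
    unfolding transition_def using assms(2)
    by (intro nn_integral_mono) (auto simp: ext0_def split: option.splits)
  then show ?thesis by (simp add: emeasure_space_1)
qed

lemma transition_SUP:
  assumes "y \<in> S" "0 \<le> t" "\<And>i. U i \<in> borel_measurable BS" "incseq U"
  shows "transition t (SUP i. U i) y = (SUP i. transition t (U i) y)"
proof -
  have "transition t (SUP i. U i) y = (\<integral>\<^sup>+\<omega>. (SUP i. ext0 (U i) (path Z t \<omega>)) \<partial>law Z y)"
    unfolding transition_def
    by (rule nn_integral_cong) (simp add: ext0_def image_comp split: option.splits)
  also have "\<dots> = (SUP i. transition t (U i) y)"
    unfolding transition_def using assms
    by (intro nn_integral_monotone_convergence_SUP measurable_path_ext0)
       (auto simp: incseq_def le_fun_def ext0_def split: option.splits)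
  finally show ?thesis .
qed

lemma transition_cmult:
  assumes "y \<in> S" "0 \<le> t" "u \<in> borel_measurable BS"
  shows "transition t (\<lambda>q. c * u q) y = c * transition t u y"
proof -
  have "transition t (\<lambda>q. c * u q) y = (\<integral>\<^sup>+\<omega>. c * ext0 u (path Z t \<omega>) \<partial>law Z y)"
    unfolding transition_def by (rule nn_integral_cong) (simp add: ext0_def split: option.splits)
  then show ?thesis
    unfolding transition_def using assms by (simp add: nn_integral_cmult measurable_path_ext0)
qed

lemma transition_add:
  assumes "y \<in> S" "0 \<le> t" "u \<in> borel_measurable BS" "v \<in> borel_measurable BS"
  shows "transition t (\<lambda>q. u q + v q) y = transition t u y + transition t v y"
proof -
  have "transition t (\<lambda>q. u q + v q) y = (\<integral>\<^sup>+\<omega>. ext0 u (path Z t \<omega>) + ext0 v (path Z t \<omega>) \<partial>law Z y)"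
    unfolding transition_def by (rule nn_integral_cong) (simp add: ext0_def split: option.splits)
  then show ?thesis
    unfolding transition_def using assms by (simp add: nn_integral_add measurable_path_ext0)
qed

text \<open>Laws depend only universally measurably on the starting point, hence the completions.\<close>

lemma transition_universally_measurable:
  assumes f: "f \<in> borel_measurable BS" and t: "0 \<le> t" and \<mu>: "prob_on S \<mu>"
  shows "transition t f \<in> borel_measurable (completion \<mu>)"
  using f
proof (induction rule: borel_measurable_induct)
  have sp: "space (completion \<mu>) = S"
    using \<mu> by (auto simp: prob_on_def space_BS dest: sets_eq_imp_space_eq)
  note [simp] = space_BS
  {
    case (cong f g)
    then show ?case
      using transition_cong[of _ t f g] t sp by (subst measurable_cong[of _ _ "transition t g"]) auto
  next
    case (set A)
    have "{\<omega> \<in> space (events Z). path Z t \<omega> \<in> Some ` A} \<in> sets (events Z)"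
      using adapted[OF t set] sets_filt_subset[OF t] by auto
    from law_universally_measurable[OF this \<mu>] show ?case
      using transition_indicator[OF _ t set] sp
      by (subst measurable_cong[of _ _ "\<lambda>y. emeasure (law Z y) {\<omega> \<in> space (events Z). path Z t \<omega> \<in> Some ` A}"]) auto
  next
    case (mult u c)
    have "transition t (\<lambda>x. c * u x) y = c * transition t u y" if "y \<in> space (completion \<mu>)" for y
      using transition_cmult[OF _ t mult.hyps(2)] that sp by auto
    from measurable_cong[OF this, of "completion \<mu>"] show ?case using mult by simp
  next
    case (add u v)
    have "transition t (\<lambda>x. v x + u x) y = transition t v y + transition t u y" if "y \<in> space (completion \<mu>)" for y
      using transition_add[OF _ t add.hyps(3,1)] that sp by auto
    from measurable_cong[OF this, of "completion \<mu>"] show ?case using add by simp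
  next
    case (seq U)
    have "transition t (SUP i. U i) y = (SUP i. transition t (U i) y)" if "y \<in> space (completion \<mu>)" for y
      using transition_SUP[OF _ t seq.hyps(1,3)] that sp by auto
    then have "transition t (SUP i. U i) \<in> borel_measurable (completion \<mu>) \<longleftrightarrow>
      (\<lambda>y. SUP i. transition t (U i) y) \<in> borel_measurable (completion \<mu>)"
      by (rule measurable_cong)
    also have "\<dots>" using seq.IH by (intro borel_measurable_SUP) auto
    finally show ?case .
  }
qed

text \<open>Bounded convergence along almost surely right continuous paths; a path dead at
  \<open>r\<close> is dead at the later grid times as well.\<close>

lemma transition_grid_tendsto:
  assumes f: "continuous_on UNIV f" "\<And>q. 0 \<le> f q" "\<And>q. f q \<le> (1::real)" and y: "y \<in> S" and r: "0 \<le> r"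
  shows "(\<lambda>k. transition (grid_above k r) (\<lambda>q. ennreal (f q)) y) \<longlonglongrightarrow> transition r (\<lambda>q. ennreal (f q)) y"
  unfolding transition_def
proof (rule nn_integral_dominated_convergence[where w = "\<lambda>_. 1"])
  interpret prob_space "law Z y" using prob_law[OF y] .
  have [measurable]: "f \<in> borel_measurable borel"
    using f(1) by (rule borel_measurable_continuous_onI)
  have "(\<lambda>q. ennreal (f q)) \<in> borel_measurable BS"
    by (intro measurable_restrict_space1) measurable
  then show "(\<lambda>\<omega>. ext0 (\<lambda>q. ennreal (f q)) (path Z (grid_above k r) \<omega>)) \<in> borel_measurable (law Z y)"
    "(\<lambda>\<omega>. ext0 (\<lambda>q. ennreal (f q)) (path Z r \<omega>)) \<in> borel_measurable (law Z y)" for k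
    using y r grid_above_nonneg by (auto intro!: measurable_path_ext0)
  show "AE \<omega> in law Z y. ext0 (\<lambda>q. ennreal (f q)) (path Z (grid_above j r) \<omega>) \<le> 1" for j
    using f(3) by (auto simp: ext0_def split: option.splits)
  show "(\<integral>\<^sup>+ \<omega>. 1 \<partial>law Z y) < \<infinity>"
    by (simp add: emeasure_space_1)
  show "(\<lambda>_. 1) \<in> borel_measurable (law Z y)"
    by simp
  show "AE \<omega> in law Z y. (\<lambda>k. ext0 (\<lambda>q. ennreal (f q)) (path Z (grid_above k r) \<omega>)) \<longlonglongrightarrow> ext0 (\<lambda>q. ennreal (f q)) (path Z r \<omega>)"
    using AE_good[OF y]
  proof eventually_elim
    case (elim \<omega>)
    show ?case
    proof (cases "path Z r \<omega>")
      case None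
      then have "path Z (grid_above k r) \<omega> = None" for k
        using absorbing[OF r _ _ None, of "grid_above k r"] elim grid_above_greater[of r k] by simp
      then show ?thesis using None by simp
    next
      case (Some q)
      note rc = right_continuous_pathD[OF _ r Some filterlim_at_right_grid_above]
      have "(\<lambda>k. ennreal (f (pos (grid_above k r) \<omega>))) \<longlonglongrightarrow> ennreal (f q)"
        using elim rc(2) f(1)
        by (intro tendsto_ennrealI tendsto_compose[where f = "\<lambda>k. pos (grid_above k r) \<omega>" and g = f])
           (auto simp: continuous_on_eq_continuous_at continuous_at)
      moreover have "\<forall>\<^sub>F k in sequentially. ennreal (f (pos (grid_above k r) \<omega>)) = ext0 (\<lambda>q. ennreal (f q)) (path Z (grid_above k r) \<omega>)"
        using rc(1) elim by (auto elim!: eventually_mono)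
      ultimately show ?thesis
        using Some by (simp add: tendsto_cong)
    qed
  qed
qed

text \<open>For bounded continuous functions the grid approximation reduces joint measurability to
  measurability in the starting point. Continuous approximations of indicators of open sets,
  disjoint induction over an intersection-stable generator and monotone limits carry this to all
  Borel functions. The truncation \<open>max 0\<close> lets the time variable range over all
  reals.\<close>

lemma jointly_measurable_transition:
  assumes f: "f \<in> borel_measurable BS" and \<mu>: "prob_on S \<mu>"
  shows "(\<lambda>p. transition (max 0 (fst p)) f (snd p)) \<in> borel_measurable (borel \<Otimes>\<^sub>M completion \<mu>)"
proof -
  let ?M = "borel \<Otimes>\<^sub>M completion \<mu> :: (real \<times> 's) measure"
  have sp: "space (completion \<mu>) = S"
    using \<mu> by (auto simp: prob_on_def space_BS dest: sets_eq_imp_space_eq)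
  then have snd: "snd p \<in> S" if "p \<in> space ?M" for p
    using that by (auto simp: space_pair_measure)
  have cont: "(\<lambda>p. transition (max 0 (fst p)) (\<lambda>q. ennreal (f q)) (snd p)) \<in> borel_measurable ?M"
    if f: "continuous_on UNIV f" "\<And>q. 0 \<le> f q" "\<And>q. f q \<le> (1::real)" for f
  proof (rule borel_measurable_LIMSEQ_order)
    fix k
    define i where "i p = nat \<lfloor>max 0 (fst p) * (1 + real k)\<rfloor>" for p :: "real \<times> 's"
    have [measurable]: "f \<in> borel_measurable borel"
      using f(1) by (rule borel_measurable_continuous_onI)
    have fB: "(\<lambda>q. ennreal (f q)) \<in> borel_measurable BS"
      by (intro measurable_restrict_space1) measurable
    have "transition ((real j + 1) / (1 + real k)) (\<lambda>q. ennreal (f q)) \<in> borel_measurable (completion \<mu>)" for j :: nat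
      by (rule transition_universally_measurable[OF fB _ \<mu>]) simp
    from measurable_compose[OF measurable_snd this]
    have 1: "(\<lambda>p. transition ((real j + 1) / (1 + real k)) (\<lambda>q. ennreal (f q)) (snd p)) \<in> borel_measurable ?M" for j :: nat .
    have 2: "i \<in> measurable ?M (count_space UNIV)"
      unfolding i_def by measurable
    have "(\<lambda>p. (\<lambda>j p. transition ((real j + 1) / (1 + real k)) (\<lambda>q. ennreal (f q)) (snd p)) (i p) p) \<in> borel_measurable ?M"
      using 1 2 by (rule measurable_compose_countable)
    moreover have "(real (i p) + 1) / (1 + real k) = grid_above k (max 0 (fst p))" for p
      by (simp add: grid_above_def i_def)
    ultimately show "(\<lambda>p. transition (grid_above k (max 0 (fst p))) (\<lambda>q. ennreal (f q)) (snd p)) \<in> borel_measurable ?M"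
      by simp
  next
    fix p assume "p \<in> space ?M"
    then show "(\<lambda>k. transition (grid_above k (max 0 (fst p))) (\<lambda>q. ennreal (f q)) (snd p)) \<longlonglongrightarrow>
        transition (max 0 (fst p)) (\<lambda>q. ennreal (f q)) (snd p)"
      using f snd by (intro transition_grid_tendsto) auto
  qed
  have base: "(\<lambda>p. transition (max 0 (fst p)) (indicator U) (snd p)) \<in> borel_measurable ?M" if U: "open U" for U
  proof -
    \<comment> \<open>Continuous functions increasing to the indicator of \<open>U\<close>: cut-off
      multiples of the distance to the complement.\<close>
    define f where "f j q = (if U = UNIV then 1 else min 1 (real j * infdist q (- U)))" for j q
    have cf: "continuous_on UNIV (f j)" for j
      unfolding f_def by (cases "U = UNIV") (auto intro!: continuous_intros)
    have [measurable]: "f j \<in> borel_measurable borel" for j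
      using cf by (rule borel_measurable_continuous_onI)
    have fB: "(\<lambda>q. ennreal (f j q)) \<in> borel_measurable BS" for j
      by (intro measurable_restrict_space1) measurable
    have inc: "incseq (\<lambda>j q. ennreal (f j q))"
      by (auto simp: incseq_def le_fun_def f_def intro!: ennreal_leI min.mono mult_right_mono infdist_nonneg)
    have SUP: "(SUP j. (\<lambda>q. ennreal (f j q))) = indicator U"
    proof
      fix q
      show "(SUP j. (\<lambda>q. ennreal (f j q))) q = indicator U q"
      proof (cases "q \<in> U")
        case True
        have "\<exists>j. f j q = 1"
        proof (cases "U = UNIV")
          case False
          then have "0 < infdist q (- U)"
            using U True infdist_pos_not_in_closed[of "- U" q] by auto
          then obtain j :: nat where "1 < real j * infdist q (- U)"
            using ex_less_of_nat_mult by blast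
          then show ?thesis using False by (intro exI[of _ j]) (simp add: f_def)
        qed (simp add: f_def)
        then obtain j0 where "f j0 q = 1" ..
        then have "1 \<le> (SUP j. ennreal (f j q))"
          by (intro SUP_upper2[of j0]) auto
        moreover have "(SUP j. ennreal (f j q)) \<le> 1"
          by (intro SUP_least) (simp add: f_def)
        ultimately have "(SUP j. ennreal (f j q)) = 1"
          by (rule antisym[rotated])
        then show ?thesis using True by (simp add: image_comp)
      next
        case False
        then have "f j q = 0" for j by (auto simp: f_def)
        then show ?thesis using False by (simp add: image_comp)
      qed
    qed
    have "(\<lambda>p. transition (max 0 (fst p)) (indicator U) (snd p)) \<in> borel_measurable ?M \<longleftrightarrow>
      (\<lambda>p. SUP j. transition (max 0 (fst p)) (\<lambda>q. ennreal (f j q)) (snd p)) \<in> borel_measurable ?M"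
      unfolding SUP[symmetric] using snd fB inc by (intro measurable_cong transition_SUP) auto
    also have "\<dots>"
      using cf by (intro borel_measurable_SUP cont) (auto simp: f_def infdist_nonneg)
    finally show ?thesis .
  qed
  have ind: "(\<lambda>p. transition (max 0 (fst p)) (indicator B) (snd p)) \<in> borel_measurable ?M"
    if "B \<in> sigma_sets UNIV {U. open U}" for B
  proof -
    have BS: "indicator A \<in> borel_measurable BS" if "A \<in> sigma_sets UNIV {U. open U}" for A
      using that by (intro measurable_restrict_space1 borel_measurable_indicator) (simp add: borel_def)
    have "Int_stable {U::'s set. open U}" by (auto simp: Int_stable_def)
    moreover have "{U::'s set. open U} \<subseteq> Pow UNIV" by simp
    ultimately show ?thesis using that
    proof (induction rule: sigma_sets_induct_disjoint)
      case (basic U) then show ?case using base by simp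
    next
      case empty
      show ?case using base[OF open_empty] .
    next
      case (compl B)
      have "transition (max 0 (fst p)) (indicator (UNIV - B)) (snd p) =
        transition (max 0 (fst p)) (indicator UNIV) (snd p) - transition (max 0 (fst p)) (indicator B) (snd p)"
        if p: "p \<in> space ?M" for p
      proof -
        have "transition (max 0 (fst p)) (\<lambda>q. indicator (UNIV - B) q + indicator B q) (snd p) =
          transition (max 0 (fst p)) (indicator (UNIV - B)) (snd p) + transition (max 0 (fst p)) (indicator B) (snd p)"
          using snd[OF p] BS[OF compl(1)] BS[OF sigma_sets.Compl[OF compl(1)]]
          by (intro transition_add) auto
        moreover have "(\<lambda>q. indicator (UNIV - B) q + indicator B q :: ennreal) = indicator UNIV"
          by (auto simp: indicator_def)
        \<comment> \<open>Finiteness is what allows the subtraction: in \<open>ennreal\<close> only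
          finite terms cancel.\<close>
        moreover have "transition (max 0 (fst p)) (indicator B) (snd p) \<noteq> \<top>"
        proof -
          have "indicator B q \<le> (1::ennreal)" for q by (simp add: indicator_def)
          from transition_le_1[where f = "indicator B", OF snd[OF p] this, of "max 0 (fst p)"] show ?thesis
            by (auto simp: top_unique)
        qed
        ultimately show ?thesis by simp
      qed
      then have "(\<lambda>p. transition (max 0 (fst p)) (indicator (UNIV - B)) (snd p)) \<in> borel_measurable ?M \<longleftrightarrow>
        (\<lambda>p. transition (max 0 (fst p)) (indicator UNIV) (snd p) - transition (max 0 (fst p)) (indicator B) (snd p)) \<in> borel_measurable ?M"
        by (rule measurable_cong)
      also have "\<dots>" using base[OF open_UNIV] compl by auto
      finally show ?case .
    next
      case (union A)
      have "transition (max 0 (fst p)) (indicator (\<Union>i. A i)) (snd p) =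
        (\<Sum>i. transition (max 0 (fst p)) (indicator (A i)) (snd p))" if p: "p \<in> space ?M" for p
      proof -
        have "transition (max 0 (fst p)) (indicator (\<Union>i. A i)) (snd p) =
          (\<integral>\<^sup>+\<omega>. (\<Sum>i. ext0 (indicator (A i)) (path Z (max 0 (fst p)) \<omega>)) \<partial>law Z (snd p))"
          unfolding transition_def
          by (rule nn_integral_cong) (simp add: ext0_def suminf_indicator union split: option.splits)
        also have "\<dots> = (\<Sum>i. transition (max 0 (fst p)) (indicator (A i)) (snd p))"
          unfolding transition_def
          using snd[OF p] union(2) by (intro nn_integral_suminf measurable_path_ext0 BS) auto
        finally show ?thesis .
      qed
      then have "(\<lambda>p. transition (max 0 (fst p)) (indicator (\<Union>i. A i)) (snd p)) \<in> borel_measurable ?M \<longleftrightarrow>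
        (\<lambda>p. \<Sum>i. transition (max 0 (fst p)) (indicator (A i)) (snd p)) \<in> borel_measurable ?M"
        by (rule measurable_cong)
      also have "\<dots>" using union(3) by (intro borel_measurable_suminf_order)
      finally show ?case .
    qed
  qed
  from f show ?thesis
  proof (induction rule: borel_measurable_induct)
    note [simp] = space_BS
    {
      case (cong f g)
      have "transition (max 0 (fst p)) f (snd p) = transition (max 0 (fst p)) g (snd p)" if "p \<in> space ?M" for p
        using snd[OF that] cong(3) by (intro transition_cong) auto
      from measurable_cong[of ?M, OF this] cong show ?case by simp
    next
      case (set A)
      then obtain B where B: "B \<in> sets borel" "A = S \<inter> B" by (rule in_restrict_borelE)
      have "transition (max 0 (fst p)) (indicator A) (snd p) = transition (max 0 (fst p)) (indicator B) (snd p)" if "p \<in> space ?M" for p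
        using snd[OF that] B(2) by (intro transition_cong) (auto simp: indicator_def)
      from measurable_cong[of ?M, OF this] ind[of B] B(1) show ?case by (simp add: borel_def)
    next
      case (mult u c)
      have "transition (max 0 (fst p)) (\<lambda>x. c * u x) (snd p) = c * transition (max 0 (fst p)) u (snd p)" if "p \<in> space ?M" for p
        using transition_cmult[OF snd[OF that] _ mult.hyps(2)] by simp
      from measurable_cong[of ?M, OF this] mult show ?case by simp
    next
      case (add u v)
      have "transition (max 0 (fst p)) (\<lambda>x. v x + u x) (snd p) = transition (max 0 (fst p)) v (snd p) + transition (max 0 (fst p)) u (snd p)" if "p \<in> space ?M" for p
        using transition_add[OF snd[OF that] _ add.hyps(3,1)] by simp
      from measurable_cong[of ?M, OF this] add show ?case by simp
    next
      case (seq U)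
      have "transition (max 0 (fst p)) (SUP i. U i) (snd p) = (SUP i. transition (max 0 (fst p)) (U i) (snd p))" if "p \<in> space ?M" for p
        using transition_SUP[OF snd[OF that] _ seq.hyps(1,3)] by simp
      then have "(\<lambda>p. transition (max 0 (fst p)) (SUP i. U i) (snd p)) \<in> borel_measurable ?M \<longleftrightarrow>
        (\<lambda>p. SUP i. transition (max 0 (fst p)) (U i) (snd p)) \<in> borel_measurable ?M"
        by (rule measurable_cong)
      also have "\<dots>" using seq.IH by (intro borel_measurable_SUP) auto
      finally show ?case .
    }
  qed
qed

end

section \<open>Potentials and the Markov property\<close>

lemma ext0_cmult: "ext0 (\<lambda>q. c * u q :: ennreal) y = c * ext0 u y"
  by (simp add: ext0_def split: option.splits)

lemma ext0_add: "ext0 (\<lambda>q. u q + v q :: ennreal) y = ext0 u y + ext0 v y"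
  by (simp add: ext0_def split: option.splits)

text \<open>Every subset of a null set is measurable in the completion, so changing a function on
  one is harmless there.\<close>

lemma completion_AE_cong:
  fixes f g :: "'a \<Rightarrow> ennreal"
  assumes f: "f \<in> borel_measurable M" and ae: "AE x in M. f x = g x"
  shows "g \<in> borel_measurable (completion M)"
proof -
  obtain N where N: "{x \<in> space M. f x \<noteq> g x} \<subseteq> N" "N \<in> null_sets M"
    using ae by (auto elim!: AE_E intro: null_setsI)
  have sub: "A \<in> sets (completion M)" if "A \<subseteq> N" for A
    using that N(2) null_sets_completion by auto
  show ?thesis
  proof (rule measurableI)
    fix B :: "ennreal set" assume B: "B \<in> sets borel"
    have "g -` B \<inter> space (completion M) =
        (f -` B \<inter> space M - N) \<union> (g -` B \<inter> space M \<inter> N)"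
      using N(1) by auto
    also have "\<dots> \<in> sets (completion M)"
      using sets_completionI_sets[of "f -` B \<inter> space M - N" M] measurable_sets[OF f B] N(2)
        sub[of "g -` B \<inter> space M \<inter> N"]
      by auto
    finally show "g -` B \<inter> space (completion M) \<in> sets (completion M)" .
  qed simp
qed

lemma nn_integral_exp_half_line: "(\<integral>\<^sup>+s\<in>{0..}. ennreal (exp (- s)) \<partial>lborel) = 1"
proof -
  interpret prob_space "density lborel (exponential_density 1)"
    by (rule prob_space_exponential_density) simp
  have "1 = emeasure (density lborel (exponential_density 1)) UNIV"
    using emeasure_space_1 by simp
  also have "\<dots> = (\<integral>\<^sup>+s\<in>{0..}. ennreal (exp (- s)) \<partial>lborel)"
    by (subst emeasure_density) (auto intro!: nn_integral_cong simp: exponential_density_def indicator_def)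
  finally show ?thesis by simp
qed

context metric_right_process
begin

lemma transition_time_measurable:
  assumes "f \<in> borel_measurable BS" and x: "x \<in> S"
  shows "(\<lambda>r. transition (max 0 r) f x) \<in> borel_measurable borel"
proof -
  obtain Y where Y: "(\<lambda>(t, \<omega>). Y t \<omega>) \<in> measurable (borel \<Otimes>\<^sub>M law Z x) (cemetery_space S)"
    "AE \<omega> in law Z x. \<forall>t\<ge>0. Y t \<omega> = path Z t \<omega>"
    using jointly_measurable_path[OF x] by blast
  interpret prob_space "law Z x" using prob_law[OF x] .
  have "(\<lambda>(t, \<omega>). ext0 f (Y (max 0 t) \<omega>)) \<in> borel_measurable (borel \<Otimes>\<^sub>M law Z x)"
  proof -
    have "(\<lambda>p. (max 0 (fst p) :: real, snd p)) \<in> measurable (borel \<Otimes>\<^sub>M law Z x) (borel \<Otimes>\<^sub>M law Z x)"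
      by measurable
    from measurable_compose[OF measurable_compose[OF this Y(1)] measurable_ext0[OF assms(1)]]
    show ?thesis by (simp add: case_prod_beta')
  qed
  from borel_measurable_nn_integral[OF this]
  have "(\<lambda>t. \<integral>\<^sup>+\<omega>. ext0 f (Y (max 0 t) \<omega>) \<partial>law Z x) \<in> borel_measurable borel" by simp
  moreover have "(\<integral>\<^sup>+\<omega>. ext0 f (Y (max 0 t) \<omega>) \<partial>law Z x) = transition (max 0 t) f x" for t
    unfolding transition_def using Y(2) by (intro nn_integral_cong_AE) auto
  ultimately show ?thesis by simp
qed

text \<open>The exceptional set does not depend on \<open>r\<close>, because the jointly measurable
  version agrees with the path at all nonnegative times at once.\<close>

lemma path_occupation_measurable:
  assumes f: "f \<in> borel_measurable BS" and x: "x \<in> S" and s: "0 \<le> s"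
    and w: "(w :: real \<Rightarrow> ennreal) \<in> borel_measurable borel"
  shows "\<exists>h. (\<lambda>(r, \<omega>). h r \<omega>) \<in> borel_measurable (borel \<Otimes>\<^sub>M law Z x) \<and>
    (AE \<omega> in law Z x. \<forall>r. h r \<omega> = w r * ext0 f (path Z (s + r) \<omega>) * indicator {0..} r)"
proof -
  obtain Y where Y: "(\<lambda>(t, \<omega>). Y t \<omega>) \<in> measurable (borel \<Otimes>\<^sub>M law Z x) (cemetery_space S)"
    "AE \<omega> in law Z x. \<forall>t\<ge>0. Y t \<omega> = path Z t \<omega>"
    using jointly_measurable_path[OF x] by blast
  define h where "h r \<omega> = w r * ext0 f (Y (s + r) \<omega>) * indicator {0..} r" for r \<omega>
  have "(\<lambda>p. (s + fst p :: real, snd p)) \<in> measurable (borel \<Otimes>\<^sub>M law Z x) (borel \<Otimes>\<^sub>M law Z x)"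
    by measurable
  from measurable_compose[OF measurable_compose[OF this Y(1)] measurable_ext0[OF f]]
  have hY: "(\<lambda>p. ext0 f (Y (s + fst p) (snd p))) \<in> borel_measurable (borel \<Otimes>\<^sub>M law Z x)"
    by simp
  have "(\<lambda>(r, \<omega>). h r \<omega>) \<in> borel_measurable (borel \<Otimes>\<^sub>M law Z x)"
    unfolding h_def case_prod_beta'
    by (intro borel_measurable_times_ennreal hY measurable_compose[OF measurable_fst w]
        measurable_compose[OF measurable_fst borel_measurable_indicator]) auto
  moreover have "AE \<omega> in law Z x. \<forall>r. h r \<omega> = w r * ext0 f (path Z (s + r) \<omega>) * indicator {0..} r"
    using Y(2) by eventually_elim (use s in \<open>auto simp: h_def indicator_def\<close>)
  ultimately show ?thesis by blast
qed

lemma path_occupation_time_measurable: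
  assumes f: "f \<in> borel_measurable BS" and x: "x \<in> S" and s: "0 \<le> s"
    and w: "(w :: real \<Rightarrow> ennreal) \<in> borel_measurable borel"
  shows "AE \<omega> in law Z x. (\<lambda>r. w r * ext0 f (path Z (s + r) \<omega>) * indicator {0..} r) \<in> borel_measurable lborel"
proof -
  obtain h where h: "(\<lambda>(r, \<omega>). h r \<omega>) \<in> borel_measurable (borel \<Otimes>\<^sub>M law Z x)"
    "AE \<omega> in law Z x. \<forall>r. h r \<omega> = w r * ext0 f (path Z (s + r) \<omega>) * indicator {0..} r"
    using path_occupation_measurable[OF assms] by blast
  show ?thesis
    using h(2) AE_space
  proof eventually_elim
    case (elim \<omega>)
    have "(\<lambda>r. h r \<omega>) \<in> borel_measurable borel"
      using measurable_compose[OF measurable_Pair2'[OF elim(2)] h(1)] by simp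
    then show ?case using elim(1) by simp
  qed
qed

text \<open>Tonelli's theorem for the jointly measurable version. The path agrees with it only
  almost surely, hence the completion in the first claim; the second is unaffected, since
  \<open>nn_integral\<close> depends only on the almost sure class of its integrand.\<close>

lemma path_occupation_Fubini:
  assumes f: "f \<in> borel_measurable BS" and x: "x \<in> S" and s: "0 \<le> s"
    and w: "(w :: real \<Rightarrow> ennreal) \<in> borel_measurable borel" and A: "A \<in> sets (law Z x)"
  shows "(\<lambda>\<omega>. (\<integral>\<^sup>+r\<in>{0..}. w r * ext0 f (path Z (s + r) \<omega>) \<partial>lborel) * indicator A \<omega>)
      \<in> borel_measurable (completion (law Z x))"
    and "(\<integral>\<^sup>+\<omega>\<in>A. (\<integral>\<^sup>+r\<in>{0..}. w r * ext0 f (path Z (s + r) \<omega>) \<partial>lborel) \<partial>law Z x) =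
      (\<integral>\<^sup>+r\<in>{0..}. w r * (\<integral>\<^sup>+\<omega>\<in>A. ext0 f (path Z (s + r) \<omega>) \<partial>law Z x) \<partial>lborel)"
proof -
  obtain h where h: "(\<lambda>(r, \<omega>). h r \<omega>) \<in> borel_measurable (borel \<Otimes>\<^sub>M law Z x)"
    and hae: "AE \<omega> in law Z x. \<forall>r. h r \<omega> = w r * ext0 f (path Z (s + r) \<omega>) * indicator {0..} r"
    using path_occupation_measurable[OF f x s w] by blast
  interpret prob_space "law Z x" using prob_law[OF x] .
  interpret pair_sigma_finite lborel "law Z x" ..
  have [measurable]: "(\<lambda>p. h (fst p) (snd p)) \<in> borel_measurable (lborel \<Otimes>\<^sub>M law Z x)"
    using h by (simp add: case_prod_beta' cong: measurable_cong_sets)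
  note [measurable] = A
  have hA: "(\<lambda>p. h (fst p) (snd p) * indicator A (snd p)) \<in> borel_measurable (lborel \<Otimes>\<^sub>M law Z x)"
    by measurable
  have [measurable]: "(\<lambda>p. h (snd p) (fst p)) \<in> borel_measurable (law Z x \<Otimes>\<^sub>M lborel)"
    using measurable_compose[OF measurable_pair_swap' \<open>(\<lambda>p. h (fst p) (snd p)) \<in> _\<close>]
    by (simp add: case_prod_beta')
  have m: "(\<lambda>\<omega>. (\<integral>\<^sup>+r. h r \<omega> \<partial>lborel) * indicator A \<omega>) \<in> borel_measurable (law Z x)"
    by measurable
  have ae: "AE \<omega> in law Z x. (\<integral>\<^sup>+r. h r \<omega> \<partial>lborel) * indicator A \<omega> =
    (\<integral>\<^sup>+r\<in>{0..}. w r * ext0 f (path Z (s + r) \<omega>) \<partial>lborel) * indicator A \<omega>"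
    using hae by eventually_elim simp
  show "(\<lambda>\<omega>. (\<integral>\<^sup>+r\<in>{0..}. w r * ext0 f (path Z (s + r) \<omega>) \<partial>lborel) * indicator A \<omega>)
      \<in> borel_measurable (completion (law Z x))"
    using m ae by (rule completion_AE_cong)
  show "(\<integral>\<^sup>+\<omega>\<in>A. (\<integral>\<^sup>+r\<in>{0..}. w r * ext0 f (path Z (s + r) \<omega>) \<partial>lborel) \<partial>law Z x) =
      (\<integral>\<^sup>+r\<in>{0..}. w r * (\<integral>\<^sup>+\<omega>\<in>A. ext0 f (path Z (s + r) \<omega>) \<partial>law Z x) \<partial>lborel)"
  proof -
    have "(\<integral>\<^sup>+\<omega>\<in>A. (\<integral>\<^sup>+r\<in>{0..}. w r * ext0 f (path Z (s + r) \<omega>) \<partial>lborel) \<partial>law Z x) =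
      (\<integral>\<^sup>+\<omega>. (\<integral>\<^sup>+r. h r \<omega> \<partial>lborel) * indicator A \<omega> \<partial>law Z x)"
      using ae by (intro nn_integral_cong_AE) auto
    also have "\<dots> = (\<integral>\<^sup>+\<omega>. (\<integral>\<^sup>+r. h r \<omega> * indicator A \<omega> \<partial>lborel) \<partial>law Z x)"
    proof (rule nn_integral_cong)
      fix \<omega> assume "\<omega> \<in> space (law Z x)"
      then have "(\<lambda>r. h r \<omega>) \<in> borel_measurable lborel"
        using measurable_compose[OF measurable_Pair2' h] by simp
      then show "(\<integral>\<^sup>+r. h r \<omega> \<partial>lborel) * indicator A \<omega> = (\<integral>\<^sup>+r. h r \<omega> * indicator A \<omega> \<partial>lborel)"
        by (simp add: nn_integral_multc)
    qed
    also have "\<dots> = (\<integral>\<^sup>+r. (\<integral>\<^sup>+\<omega>. h r \<omega> * indicator A \<omega> \<partial>law Z x) \<partial>lborel)"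
      using Fubini'[of "\<lambda>r \<omega>. h r \<omega> * indicator A \<omega>"] hA by (simp add: case_prod_beta')
    also have "\<dots> = (\<integral>\<^sup>+r\<in>{0..}. w r * (\<integral>\<^sup>+\<omega>\<in>A. ext0 f (path Z (s + r) \<omega>) \<partial>law Z x) \<partial>lborel)"
    proof (rule nn_integral_cong)
      fix r :: real
      have "(\<integral>\<^sup>+\<omega>. h r \<omega> * indicator A \<omega> \<partial>law Z x) =
        (\<integral>\<^sup>+\<omega>. w r * indicator {0..} r * (ext0 f (path Z (s + r) \<omega>) * indicator A \<omega>) \<partial>law Z x)"
        using hae by (intro nn_integral_cong_AE) (auto simp: mult_ac)
      also have "\<dots> = w r * indicator {0..} r * (\<integral>\<^sup>+\<omega>. ext0 f (path Z (s + r) \<omega>) * indicator A \<omega> \<partial>law Z x)"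
      proof (cases "0 \<le> r")
        case True
        then have "(\<lambda>\<omega>. ext0 f (path Z (s + r) \<omega>)) \<in> borel_measurable (law Z x)"
          using f x s by (intro measurable_path_ext0) auto
        then show ?thesis by (intro nn_integral_cmult) auto
      qed simp
      finally show "(\<integral>\<^sup>+\<omega>. h r \<omega> * indicator A \<omega> \<partial>law Z x) =
        w r * (\<integral>\<^sup>+\<omega>\<in>A. ext0 f (path Z (s + r) \<omega>) \<partial>law Z x) * indicator {0..} r"
        by (simp add: mult_ac)
    qed
    finally show ?thesis .
  qed
qed

text \<open>Two weights matter: \<open>exp (- \<alpha> * r)\<close> gives the resolvent, and the
  indicator of \<open>{0..h}\<close> gives the expected integral of \<open>f\<close> along the path
  up to time \<open>h\<close>.\<close>

definition potential :: "(real \<Rightarrow> ennreal) \<Rightarrow> ('s \<Rightarrow> ennreal) \<Rightarrow> 's \<Rightarrow> ennreal" where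
  "potential w f y = (\<integral>\<^sup>+r\<in>{0..}. w r * transition r f y \<partial>lborel)"

lemma potential_eq:
  assumes "f \<in> borel_measurable BS" "x \<in> S" "w \<in> borel_measurable borel"
  shows "potential w f x = (\<integral>\<^sup>+\<omega>. (\<integral>\<^sup>+r\<in>{0..}. w r * ext0 f (path Z r \<omega>) \<partial>lborel) \<partial>law Z x)"
proof -
  have "(\<integral>\<^sup>+\<omega>. (\<integral>\<^sup>+r\<in>{0..}. w r * ext0 f (path Z r \<omega>) \<partial>lborel) \<partial>law Z x) =
    (\<integral>\<^sup>+\<omega>\<in>space (law Z x). (\<integral>\<^sup>+r\<in>{0..}. w r * ext0 f (path Z (0 + r) \<omega>) \<partial>lborel) \<partial>law Z x)"
    by (auto intro!: nn_integral_cong)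
  also have "\<dots> = (\<integral>\<^sup>+r\<in>{0..}. w r * (\<integral>\<^sup>+\<omega>\<in>space (law Z x). ext0 f (path Z (0 + r) \<omega>) \<partial>law Z x) \<partial>lborel)"
    using assms by (intro path_occupation_Fubini(2)) auto
  also have "\<dots> = potential w f x"
    unfolding potential_def transition_def
    by (intro nn_integral_cong arg_cong2[where f = "(*)"] refl) auto
  finally show ?thesis by simp
qed

lemma resolvent_eq_potential:
  assumes "f \<in> borel_measurable BS" "x \<in> S"
  shows "resolvent Z \<alpha> f x = potential (\<lambda>r. ennreal (exp (- \<alpha> * r))) f x"
  using assms by (simp add: potential_eq resolvent_def)

text \<open>A universally measurable function of the state at time \<open>s\<close> is measurable
  for the completed law: complete the distribution of that state and use that the inverse images of
  its null sets are null.\<close>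

lemma markov_measurable:
  assumes f: "f \<in> borel_measurable BS" and x: "x \<in> S" and s: "0 \<le> s"
  shows "(\<lambda>p. ext0 (transition (max 0 (fst p)) f) (path Z s (snd p)))
    \<in> borel_measurable (borel \<Otimes>\<^sub>M completion (law Z x))"
proof -
  interpret prob_space "law Z x" using prob_law[OF x] .
  \<comment> \<open>Dead paths are sent to the arbitrary point \<open>x\<close>, so that the state
    has a distribution on \<open>S\<close>; the factor \<open>ext0 (\<lambda>_. 1)\<close> below
    removes their contribution again.\<close>
  define \<kappa> where "\<kappa> = (\<lambda>\<omega>. case_option x (\<lambda>y. y) (path Z s \<omega>))"
  have \<kappa>: "\<kappa> \<in> measurable (law Z x) BS"
    unfolding \<kappa>_def
    by (rule measurable_compose[OF measurable_path[OF s x] measurable_case_option_cemetery_space])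
       (auto simp: space_BS x)
  define \<mu> where "\<mu> = distr (law Z x) BS \<kappa>"
  have \<mu>: "prob_on S \<mu>"
    unfolding prob_on_def \<mu>_def using prob_space_distr[OF \<kappa>] by simp
  have \<kappa>\<mu>: "\<kappa> \<in> measurable (completion (law Z x)) \<mu>"
    using measurable_completion[OF \<kappa>] by (simp add: \<mu>_def)
  have "complete_measure (completion (law Z x))" ..
  moreover have "null_sets \<mu> \<subseteq> null_sets (distr (completion (law Z x)) \<mu> \<kappa>)"
  proof -
    have "distr (completion (law Z x)) \<mu> \<kappa> = distr (law Z x) \<mu> \<kappa>"
      using \<kappa> by (intro distr_completion) (simp add: \<mu>_def)
    also have "\<dots> = \<mu>" unfolding \<mu>_def by (intro distr_cong) auto
    finally show ?thesis by simp
  qed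
  ultimately have "\<kappa> \<in> measurable (completion (law Z x)) (completion \<mu>)"
    using complete_measure.measurable_completion2 \<kappa>\<mu> by blast
  then have "(\<lambda>p. (fst p, \<kappa> (snd p))) \<in> measurable (borel \<Otimes>\<^sub>M completion (law Z x)) (borel \<Otimes>\<^sub>M completion \<mu>)"
    by (intro measurable_Pair measurable_compose[OF measurable_snd]) auto
  from measurable_compose[OF this jointly_measurable_transition[OF f \<mu>]]
  have [measurable]: "(\<lambda>p. transition (max 0 (fst p)) f (\<kappa> (snd p))) \<in> borel_measurable (borel \<Otimes>\<^sub>M completion (law Z x))"
    by simp
  have "(\<lambda>\<omega>. ext0 (\<lambda>_. 1) (path Z s \<omega>)) \<in> borel_measurable (completion (law Z x))"
    by (intro measurable_completion measurable_path_ext0 s x) simp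
  from measurable_compose[OF measurable_snd this]
  have "(\<lambda>p. ext0 (\<lambda>_. 1) (path Z s (snd p)) * transition (max 0 (fst p)) f (\<kappa> (snd p))) \<in> borel_measurable (borel \<Otimes>\<^sub>M completion (law Z x))"
    by measurable
  moreover have "ext0 (\<lambda>_. 1) (path Z s (snd p)) * transition (max 0 (fst p)) f (\<kappa> (snd p)) =
    ext0 (transition (max 0 (fst p)) f) (path Z s (snd p))" for p
    by (simp add: \<kappa>_def split: option.splits)
  ultimately show ?thesis by simp
qed

lemma markov_measurable_at:
  assumes f: "f \<in> borel_measurable BS" and x: "x \<in> S" and s: "0 \<le> s" and t: "0 \<le> t"
  shows "(\<lambda>\<omega>. ext0 (transition t f) (path Z s \<omega>)) \<in> borel_measurable (completion (law Z x))"
  using measurable_compose[OF measurable_Pair1'[of t borel "completion (law Z x)"] markov_measurable[OF f x s]] t by simp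

text \<open>The assumption \<open>markov\<close> is the case of indicators; linearity and monotone
  convergence do the rest. The induction runs in the completed law, where the integrands on the
  right are measurable.\<close>

lemma markov_function:
  assumes f: "f \<in> borel_measurable BS" and x: "x \<in> S" and s: "0 \<le> s" and t: "0 \<le> t"
    and A: "A \<in> sets (filt Z s)"
  shows "(\<integral>\<^sup>+\<omega>\<in>A. ext0 f (path Z (s + t) \<omega>) \<partial>law Z x) =
    (\<integral>\<^sup>+\<omega>\<in>A. ext0 (transition t f) (path Z s \<omega>) \<partial>law Z x)"
proof -
  let ?Q = "completion (law Z x)"
  have AQ [measurable]: "A \<in> sets (law Z x)" "A \<in> sets ?Q"
    using A sets_filt_subset[OF s] sets_law[OF x] by auto
  have st: "0 \<le> s + t" using s t by simp
  have inS: "path Z s \<omega> \<in> insert None (Some ` S)" "path Z (s + t) \<omega> \<in> insert None (Some ` S)"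
    if "\<omega> \<in> space ?Q" for \<omega>
    using that path_in s st by (auto simp: space_law[OF x])
  note m1 = measurable_completion[OF measurable_path_ext0[OF st x]]
  note m2 = markov_measurable_at[OF _ x s t]
  have "(\<integral>\<^sup>+\<omega>. ext0 f (path Z (s + t) \<omega>) * indicator A \<omega> \<partial>?Q) =
    (\<integral>\<^sup>+\<omega>. ext0 (transition t f) (path Z s \<omega>) * indicator A \<omega> \<partial>?Q)"
    using f
  proof (induction rule: borel_measurable_induct)
    note [simp] = space_BS
    {
      case (cong f g)
      have "(\<integral>\<^sup>+\<omega>. ext0 f (path Z (s + t) \<omega>) * indicator A \<omega> \<partial>?Q) = (\<integral>\<^sup>+\<omega>. ext0 g (path Z (s + t) \<omega>) * indicator A \<omega> \<partial>?Q)"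
        using inS(2) cong(3) by (intro nn_integral_cong) fastforce
      moreover have "(\<integral>\<^sup>+\<omega>. ext0 (transition t f) (path Z s \<omega>) * indicator A \<omega> \<partial>?Q) = (\<integral>\<^sup>+\<omega>. ext0 (transition t g) (path Z s \<omega>) * indicator A \<omega> \<partial>?Q)"
      proof (rule nn_integral_cong)
        fix \<omega> assume "\<omega> \<in> space ?Q"
        from inS(1)[OF this] show "ext0 (transition t f) (path Z s \<omega>) * indicator A \<omega> = ext0 (transition t g) (path Z s \<omega>) * indicator A \<omega>"
          using transition_cong[OF _ t, of _ f g] cong(3) by auto
      qed
      ultimately show ?case using cong by simp
    next
      case (set B)
      have "{\<omega> \<in> space (events Z). path Z (s + t) \<omega> \<in> Some ` B} \<in> sets (events Z)"
        using adapted[OF st set] sets_filt_subset[OF st] by auto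
      then have m: "{\<omega> \<in> A. path Z (s + t) \<omega> \<in> Some ` B} \<in> sets (law Z x)"
      proof -
        have "{\<omega> \<in> A. path Z (s + t) \<omega> \<in> Some ` B} = A \<inter> {\<omega> \<in> space (events Z). path Z (s + t) \<omega> \<in> Some ` B}"
          using sets.sets_into_space[OF AQ(1)] space_law[OF x] by auto
        then show ?thesis
          using \<open>_ \<in> sets (events Z)\<close> AQ(1) sets_law[OF x] by auto
      qed
      have "(\<integral>\<^sup>+\<omega>. ext0 (indicator B) (path Z (s + t) \<omega>) * indicator A \<omega> \<partial>?Q) =
        (\<integral>\<^sup>+\<omega>. indicator {\<omega> \<in> A. path Z (s + t) \<omega> \<in> Some ` B} \<omega> \<partial>law Z x)"
        unfolding nn_integral_completion
        by (rule nn_integral_cong) (auto simp: ext0_def indicator_def split: option.splits)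
      also have "\<dots> = emeasure (law Z x) {\<omega> \<in> A. path Z (s + t) \<omega> \<in> Some ` B}"
        using m by simp
      also have "\<dots> = (\<integral>\<^sup>+\<omega>\<in>A. ext0 (\<lambda>y. emeasure (law Z y) {\<omega>' \<in> space (events Z). path Z t \<omega>' \<in> Some ` B}) (path Z s \<omega>) \<partial>law Z x)"
        by (rule markov[OF x s t A set])
      also have "\<dots> = (\<integral>\<^sup>+\<omega>. ext0 (transition t (indicator B)) (path Z s \<omega>) * indicator A \<omega> \<partial>?Q)"
        unfolding nn_integral_completion
      proof (rule nn_integral_cong)
        fix \<omega> assume "\<omega> \<in> space (law Z x)"
        with inS(1)[of \<omega>] show "ext0 (\<lambda>y. emeasure (law Z y) {\<omega>' \<in> space (events Z). path Z t \<omega>' \<in> Some ` B}) (path Z s \<omega>) * indicator A \<omega> =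
          ext0 (transition t (indicator B)) (path Z s \<omega>) * indicator A \<omega>"
          using transition_indicator[OF _ t set] by auto
      qed
      finally show ?case .
    next
      case (mult u c)
      have "(\<integral>\<^sup>+\<omega>. ext0 (transition t (\<lambda>q. c * u q)) (path Z s \<omega>) * indicator A \<omega> \<partial>?Q) =
        (\<integral>\<^sup>+\<omega>. c * (ext0 (transition t u) (path Z s \<omega>) * indicator A \<omega>) \<partial>?Q)"
      proof (rule nn_integral_cong)
        fix \<omega> assume "\<omega> \<in> space ?Q"
        from inS(1)[OF this] show "ext0 (transition t (\<lambda>q. c * u q)) (path Z s \<omega>) * indicator A \<omega> = c * (ext0 (transition t u) (path Z s \<omega>) * indicator A \<omega>)"
          using transition_cmult[OF _ t mult.hyps(2)] by (auto simp: mult_ac)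
      qed
      then show ?case
        using mult.IH m1[OF mult.hyps(2)] m2[OF mult.hyps(2)] by (simp add: ext0_cmult mult.assoc nn_integral_cmult)
    next
      case (add u v)
      have "(\<integral>\<^sup>+\<omega>. ext0 (transition t (\<lambda>q. v q + u q)) (path Z s \<omega>) * indicator A \<omega> \<partial>?Q) =
        (\<integral>\<^sup>+\<omega>. ext0 (transition t v) (path Z s \<omega>) * indicator A \<omega> + ext0 (transition t u) (path Z s \<omega>) * indicator A \<omega> \<partial>?Q)"
      proof (rule nn_integral_cong)
        fix \<omega> assume "\<omega> \<in> space ?Q"
        from inS(1)[OF this] show "ext0 (transition t (\<lambda>q. v q + u q)) (path Z s \<omega>) * indicator A \<omega> =
            ext0 (transition t v) (path Z s \<omega>) * indicator A \<omega> + ext0 (transition t u) (path Z s \<omega>) * indicator A \<omega>"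
          using transition_add[OF _ t add.hyps(3,1)] by (auto simp: distrib_right)
      qed
      then show ?case
        using add.IH m1[OF add.hyps(1)] m2[OF add.hyps(1)] m1[OF add.hyps(3)] m2[OF add.hyps(3)]
        by (simp add: ext0_add distrib_right nn_integral_add)
    next
      case (seq U)
      have mono: "incseq (\<lambda>i. ext0 (U i) y)" for y
        using seq.hyps(3) by (auto simp: incseq_def le_fun_def ext0_def split: option.splits)
      have mono2: "incseq (\<lambda>i. ext0 (transition t (U i)) y)" for y
        using mono by (auto simp: incseq_def ext0_def transition_def split: option.splits intro!: nn_integral_mono)
      have "(\<integral>\<^sup>+\<omega>. ext0 (SUP i. U i) (path Z (s + t) \<omega>) * indicator A \<omega> \<partial>?Q) =
        (\<integral>\<^sup>+\<omega>. (SUP i. ext0 (U i) (path Z (s + t) \<omega>) * indicator A \<omega>) \<partial>?Q)"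
        by (intro nn_integral_cong)
           (auto simp: ext0_def image_comp SUP_mult_right_ennreal indicator_def split: option.splits)
      also have "\<dots> = (SUP i. \<integral>\<^sup>+\<omega>. ext0 (U i) (path Z (s + t) \<omega>) * indicator A \<omega> \<partial>?Q)"
        using mono m1[OF seq.hyps(1)]
        by (intro nn_integral_monotone_convergence_SUP) (auto simp: incseq_def le_fun_def intro!: mult_right_mono)
      also have "\<dots> = (SUP i. \<integral>\<^sup>+\<omega>. ext0 (transition t (U i)) (path Z s \<omega>) * indicator A \<omega> \<partial>?Q)"
        using seq.IH by simp
      also have "\<dots> = (\<integral>\<^sup>+\<omega>. (SUP i. ext0 (transition t (U i)) (path Z s \<omega>) * indicator A \<omega>) \<partial>?Q)"
        using mono2 m2[OF seq.hyps(1)]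
        by (intro nn_integral_monotone_convergence_SUP[symmetric]) (auto simp: incseq_def le_fun_def intro!: mult_right_mono)
      also have "\<dots> = (\<integral>\<^sup>+\<omega>. ext0 (transition t (SUP i. U i)) (path Z s \<omega>) * indicator A \<omega> \<partial>?Q)"
      proof (rule nn_integral_cong)
        fix \<omega> assume "\<omega> \<in> space ?Q"
        from inS(1)[OF this] show "(SUP i. ext0 (transition t (U i)) (path Z s \<omega>) * indicator A \<omega>) =
            ext0 (transition t (SUP i. U i)) (path Z s \<omega>) * indicator A \<omega>"
          using transition_SUP[OF _ t seq.hyps(1,3)] by (auto simp: SUP_mult_right_ennreal indicator_def simp del: Sup_apply SUP_apply)
      qed
      finally show ?case .
    }
  qed
  then show ?thesis by (simp add: nn_integral_completion)
qed

text \<open>Integrates \<open>markov_function\<close> over the elapsed time \<open>r\<close> with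
  weight \<open>w\<close>, exchanging the integrals on both sides.\<close>

lemma markov_potential:
  assumes f: "f \<in> borel_measurable BS" and x: "x \<in> S" and s: "0 \<le> s"
    and w: "w \<in> borel_measurable borel" and A: "A \<in> sets (filt Z s)"
  shows "(\<integral>\<^sup>+\<omega>\<in>A. ext0 (potential w f) (path Z s \<omega>) \<partial>law Z x) =
    (\<integral>\<^sup>+\<omega>\<in>A. (\<integral>\<^sup>+r\<in>{0..}. w r * ext0 f (path Z (s + r) \<omega>) \<partial>lborel) \<partial>law Z x)"
proof -
  let ?Q = "completion (law Z x)"
  interpret P: prob_space "law Z x" using prob_law[OF x] .
  interpret Q: prob_space ?Q by (rule P.prob_space_completion)
  interpret pair_sigma_finite lborel ?Q ..
  have A': "A \<in> sets (law Z x)" and [measurable]: "A \<in> sets ?Q"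
    using A sets_filt_subset[OF s] sets_law[OF x] by auto
  have [measurable]: "(\<lambda>p. ext0 (transition (max 0 (fst p)) f) (path Z s (snd p))) \<in> borel_measurable (lborel \<Otimes>\<^sub>M ?Q)"
    using markov_measurable[OF f x s] by (simp cong: measurable_cong_sets)
  note [measurable] = w
  have m: "(\<lambda>p. w (fst p) * ext0 (transition (max 0 (fst p)) f) (path Z s (snd p)) * indicator {0..} (fst p) * indicator A (snd p)) \<in> borel_measurable (lborel \<Otimes>\<^sub>M ?Q)"
    by measurable
  have "(\<integral>\<^sup>+\<omega>\<in>A. ext0 (potential w f) (path Z s \<omega>) \<partial>law Z x) =
    (\<integral>\<^sup>+\<omega>. (\<integral>\<^sup>+r. w r * ext0 (transition (max 0 r) f) (path Z s \<omega>) * indicator {0..} r * indicator A \<omega> \<partial>lborel) \<partial>?Q)"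
    unfolding nn_integral_completion
    by (intro nn_integral_cong)
       (auto simp: ext0_def potential_def indicator_def split: option.splits intro!: nn_integral_cong)
  also have "\<dots> = (\<integral>\<^sup>+r. (\<integral>\<^sup>+\<omega>. w r * ext0 (transition (max 0 r) f) (path Z s \<omega>) * indicator {0..} r * indicator A \<omega> \<partial>?Q) \<partial>lborel)"
    using Fubini'[of "\<lambda>r \<omega>. w r * ext0 (transition (max 0 r) f) (path Z s \<omega>) * indicator {0..} r * indicator A \<omega>"] m by (simp add: case_prod_beta')
  also have "\<dots> = (\<integral>\<^sup>+r\<in>{0..}. w r * (\<integral>\<^sup>+\<omega>\<in>A. ext0 f (path Z (s + r) \<omega>) \<partial>law Z x) \<partial>lborel)"
  proof (rule nn_integral_cong)
    fix r :: real
    show "(\<integral>\<^sup>+\<omega>. w r * ext0 (transition (max 0 r) f) (path Z s \<omega>) * indicator {0..} r * indicator A \<omega> \<partial>?Q) =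
      w r * (\<integral>\<^sup>+\<omega>\<in>A. ext0 f (path Z (s + r) \<omega>) \<partial>law Z x) * indicator {0..} r"
    proof (cases "0 \<le> r")
      case True
      then have "(\<integral>\<^sup>+\<omega>. w r * ext0 (transition (max 0 r) f) (path Z s \<omega>) * indicator {0..} r * indicator A \<omega> \<partial>?Q) =
        (\<integral>\<^sup>+\<omega>. w r * (ext0 (transition r f) (path Z s \<omega>) * indicator A \<omega>) \<partial>?Q)"
        by (simp add: mult_ac)
      also have "\<dots> = w r * (\<integral>\<^sup>+\<omega>. ext0 (transition r f) (path Z s \<omega>) * indicator A \<omega> \<partial>?Q)"
        using markov_measurable_at[OF f x s True] by (intro nn_integral_cmult) auto
      finally show ?thesis
        using True by (simp add: markov_function[OF f x s True A] nn_integral_completion)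
    qed simp
  qed
  also have "\<dots> = (\<integral>\<^sup>+\<omega>\<in>A. (\<integral>\<^sup>+r\<in>{0..}. w r * ext0 f (path Z (s + r) \<omega>) \<partial>lborel) \<partial>law Z x)"
    using path_occupation_Fubini(2)[OF f x s w A'] by simp
  finally show ?thesis .
qed

end

lemma ext0_ennreal: "ext0 (\<lambda>q. ennreal (f q)) y = ennreal (ext0 f y)"
  by (simp add: ext0_def split: option.splits)

lemma ennreal_integral_le_nn_integral:
  fixes f :: "'a \<Rightarrow> real"
  shows "integrable M f \<Longrightarrow> ennreal (\<integral>x. f x \<partial>M) \<le> (\<integral>\<^sup>+x. ennreal (f x) \<partial>M)"
proof -
  assume f: "integrable M f"
  have "(\<integral>x. f x \<partial>M) \<le> enn2real (\<integral>\<^sup>+x. ennreal (f x) \<partial>M)"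
    by (simp add: real_lebesgue_integral_def[OF f])
  then have "ennreal (\<integral>x. f x \<partial>M) \<le> ennreal (enn2real (\<integral>\<^sup>+x. ennreal (f x) \<partial>M))"
    by (rule ennreal_leI)
  also have "\<dots> \<le> (\<integral>\<^sup>+x. ennreal (f x) \<partial>M)"
    by (cases "(\<integral>\<^sup>+x. ennreal (f x) \<partial>M)") auto
  finally show ?thesis .
qed

text \<open>No integrability is assumed: a divergent Bochner integral is 0.\<close>

lemma ennreal_set_lebesgue_integral_le:
  fixes f :: "'a \<Rightarrow> real"
  shows "ennreal (set_lebesgue_integral M A f) \<le> (\<integral>\<^sup>+x\<in>A. ennreal \<bar>f x\<bar> \<partial>M)"
proof (cases "set_integrable M A f")
  case True
  then have "ennreal (set_lebesgue_integral M A f) \<le> (\<integral>\<^sup>+x. ennreal (indicator A x *\<^sub>R f x) \<partial>M)"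
    unfolding set_integrable_def set_lebesgue_integral_def by (rule ennreal_integral_le_nn_integral)
  also have "\<dots> \<le> (\<integral>\<^sup>+x\<in>A. ennreal \<bar>f x\<bar> \<partial>M)"
    by (intro nn_integral_mono) (auto simp: indicator_def intro!: ennreal_leI)
  finally show ?thesis .
next
  case False
  then show ?thesis
    unfolding set_integrable_def set_lebesgue_integral_def by (simp add: not_integrable_integral_eq)
qed

context metric_right_process
begin

section \<open>Resolvents as excessive functions, and their zero sets\<close>

lemma transition_potential:
  assumes f: "f \<in> borel_measurable BS" and x: "x \<in> S" and s: "0 \<le> s" and w: "w \<in> borel_measurable borel"
  shows "transition s (potential w f) x = (\<integral>\<^sup>+r\<in>{0..}. w r * transition (s + r) f x \<partial>lborel)"
proof -
  let ?A = "space (events Z)"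
  have A: "?A \<in> sets (filt Z s)" "?A \<in> sets (law Z x)"
    using sets.top[of "filt Z s"] sets.top[of "law Z x"] by (simp_all add: space_filt[OF s] space_law[OF x])
  have drop: "(\<integral>\<^sup>+\<omega>\<in>?A. F \<omega> \<partial>law Z x) = (\<integral>\<^sup>+\<omega>. F \<omega> \<partial>law Z x)" for F
    by (rule nn_integral_cong) (simp add: space_law[OF x])
  show ?thesis
    using markov_potential[OF f x s w A(1)] path_occupation_Fubini(2)[OF f x s w A(2)]
    unfolding drop transition_def by simp
qed

text \<open>Everything follows from the monotonicity of \<open>k x\<close>: it bounds the averages
  by \<open>u x\<close>, with monotone convergence it makes their supremum equal to
  \<open>u x\<close>, and where \<open>u x = 0\<close> it forces the mean of \<open>u\<close> at
  every later time to be 0.\<close>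

lemma excessive_resolvent:
  assumes f: "f \<in> borel_measurable BS" and \<alpha>: "0 < \<alpha>"
  shows "excessive S Z \<alpha> (resolvent Z \<alpha> f)"
    and "\<And>x s. x \<in> S \<Longrightarrow> 0 \<le> s \<Longrightarrow> resolvent Z \<alpha> f x = 0 \<Longrightarrow> transition s (resolvent Z \<alpha> f) x = 0"
proof -
  define u where "u = resolvent Z \<alpha> f"
  have u: "u \<in> borel_measurable BS"
    unfolding u_def by (rule resolvent_borel[OF \<alpha> f])
  define g where "g x r = ennreal (exp (- \<alpha> * r)) * transition (max 0 r) f x" for x r
  \<comment> \<open>\<open>k x s\<close> is \<open>exp (- \<alpha> s) P\<^sub>s u x\<close>; it decreases in \<open>s\<close> and tends to \<open>u x\<close> as \<open>s\<close> decreases to 0,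
    and \<open>\<beta> U\<^sub>\<alpha>\<^sub>+\<^sub>\<beta> u x\<close> is its average over an exponential time of rate \<open>\<beta>\<close>.\<close>
  define k where "k x s = (\<integral>\<^sup>+r\<in>{s..}. g x r \<partial>lborel)" for x s
  have g [measurable]: "g x \<in> borel_measurable borel" if "x \<in> S" for x
    unfolding g_def using transition_time_measurable[OF f that] by measurable
  have u_k: "u x = k x 0" if "x \<in> S" for x
    unfolding u_def resolvent_eq_potential[OF f that] potential_def k_def
    by (rule nn_integral_cong) (auto simp: g_def indicator_def)
  have k: "ennreal (exp (- \<alpha> * s)) * transition s u x = k x s" if x: "x \<in> S" and s: "0 \<le> s" for x s
  proof -
    have [measurable]: "g x \<in> borel_measurable borel" by (rule g[OF x])
    have "transition s u x = transition s (potential (\<lambda>r. ennreal (exp (- \<alpha> * r))) f) x"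
      unfolding u_def by (intro transition_cong x s resolvent_eq_potential f)
    also have "\<dots> = (\<integral>\<^sup>+r\<in>{0..}. ennreal (exp (- \<alpha> * r)) * transition (s + r) f x \<partial>lborel)"
      by (rule transition_potential[OF f x s]) simp
    also have "ennreal (exp (- \<alpha> * s)) * \<dots> = (\<integral>\<^sup>+r. g x (s + 1 * r) * indicator {s..} (s + 1 * r) \<partial>lborel)"
    proof -
      have eq: "ennreal (exp (- \<alpha> * s)) * (ennreal (exp (- \<alpha> * r)) * transition (s + r) f x * indicator {0..} r) =
        g x (s + 1 * r) * indicator {s..} (s + 1 * r)" for r
      proof (cases "0 \<le> r")
        case True
        have "ennreal (exp (- \<alpha> * s)) * ennreal (exp (- \<alpha> * r)) = ennreal (exp (- \<alpha> * (s + r)))"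
          by (simp add: ennreal_mult[symmetric] exp_add[symmetric] algebra_simps)
        then show ?thesis using True s by (simp add: g_def mult.assoc[symmetric])
      qed simp
      have "(\<lambda>r. ennreal (exp (- \<alpha> * r)) * transition (s + r) f x * indicator {0..} r) \<in> borel_measurable lborel"
      proof -
        have meas: "(\<lambda>r. ennreal (exp (\<alpha> * s)) * (g x (s + 1 * r) * indicator {s..} (s + 1 * r))) \<in> borel_measurable lborel"
          by measurable
        have eq': "ennreal (exp (\<alpha> * s)) * (g x (s + 1 * r) * indicator {s..} (s + 1 * r)) =
          ennreal (exp (- \<alpha> * r)) * transition (s + r) f x * indicator {0..} r" for r
          unfolding eq[symmetric] mult.assoc[symmetric]
          by (simp add: ennreal_mult[symmetric] exp_add[symmetric])
        show ?thesis using meas unfolding eq' .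
      qed
      from nn_integral_cmult[OF this, of "ennreal (exp (- \<alpha> * s))"] show ?thesis
        unfolding eq by simp
    qed
    also have "\<dots> = k x s"
      unfolding k_def by (subst nn_integral_real_affine[where c = 1 and t = s]) simp_all
    finally show ?thesis .
  qed
  have k_anti: "k x t \<le> k x s" if "s \<le> t" for x s t
    unfolding k_def using that by (intro nn_integral_mono) (auto simp: indicator_def)
  have k_meas: "k x \<in> borel_measurable borel" if x: "x \<in> S" for x
  proof -
    have [measurable]: "g x \<in> borel_measurable borel" by (rule g[OF x])
    have "(\<lambda>p. g x (snd p) * indicator {p. fst p \<le> snd p} p) \<in> borel_measurable (borel \<Otimes>\<^sub>M lborel)"
      by measurable
    then have "(\<lambda>s. \<integral>\<^sup>+r. g x r * indicator {p. fst p \<le> snd p} (s, r) \<partial>lborel) \<in> borel_measurable borel"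
      by (intro lborel.borel_measurable_nn_integral) (simp add: case_prod_beta')
    then show ?thesis
      unfolding k_def by (simp add: indicator_def)
  qed
  \<comment> \<open>Substituting \<open>s / \<beta>\<close> moves \<open>\<beta>\<close> out of the
    weight, so that monotone convergence applies along the rates \<open>Suc n\<close>.\<close>
  have scaled: "ennreal \<beta> * resolvent Z (\<alpha> + \<beta>) u x = (\<integral>\<^sup>+s\<in>{0..}. ennreal (exp (- s)) * k x (s / \<beta>) \<partial>lborel)"
    if x: "x \<in> S" and \<beta>: "0 < \<beta>" for x \<beta>
  proof -
    have [measurable]: "k x \<in> borel_measurable borel" by (rule k_meas[OF x])
    have "ennreal \<beta> * resolvent Z (\<alpha> + \<beta>) u x = ennreal \<beta> * (\<integral>\<^sup>+s\<in>{0..}. ennreal (exp (- \<beta> * s)) * k x s \<partial>lborel)"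
      unfolding resolvent_eq_potential[OF u x] potential_def
    proof (rule arg_cong[where f = "(*) (ennreal \<beta>)"], rule nn_integral_cong)
      fix s :: real
      show "ennreal (exp (- (\<alpha> + \<beta>) * s)) * transition s u x * indicator {0..} s = ennreal (exp (- \<beta> * s)) * k x s * indicator {0..} s"
      proof (cases "0 \<le> s")
        case True
        have "ennreal (exp (- (\<alpha> + \<beta>) * s)) = ennreal (exp (- \<beta> * s)) * ennreal (exp (- \<alpha> * s))"
          by (simp add: ennreal_mult[symmetric] exp_add[symmetric] algebra_simps)
        then show ?thesis by (simp add: k[OF x True, symmetric] mult.assoc)
      qed simp
    qed
    also have "(\<integral>\<^sup>+s\<in>{0..}. ennreal (exp (- \<beta> * s)) * k x s \<partial>lborel) =
      ennreal (1 / \<beta>) * (\<integral>\<^sup>+s\<in>{0..}. ennreal (exp (- s)) * k x (s / \<beta>) \<partial>lborel)"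
    proof -
      have ind: "indicator {0..} (s / \<beta>) = (indicator {0..} s :: ennreal)" for s
        using \<beta> by (auto simp: indicator_def zero_le_divide_iff)
      show ?thesis
        using \<beta> by (subst nn_integral_real_affine[where c = "1 / \<beta>" and t = 0]) (simp_all add: ind)
    qed
    finally show ?thesis
      using \<beta> by (simp add: mult.assoc[symmetric] ennreal_mult[symmetric])
  qed
  have exp_k0: "(\<integral>\<^sup>+s\<in>{0..}. ennreal (exp (- s)) * c \<partial>lborel) = c" for c
  proof -
    have "(\<integral>\<^sup>+s\<in>{0..}. ennreal (exp (- s)) * c \<partial>lborel) = (\<integral>\<^sup>+s. ennreal (exp (- s)) * indicator {0..} s * c \<partial>lborel)"
      by (intro nn_integral_cong) (simp add: mult_ac)
    also have "\<dots> = c" by (subst nn_integral_multc) (simp_all add: nn_integral_exp_half_line)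
    finally show ?thesis .
  qed
  have le: "ennreal \<beta> * resolvent Z (\<alpha> + \<beta>) u x \<le> u x" if x: "x \<in> S" and \<beta>: "0 < \<beta>" for x \<beta>
  proof -
    have "ennreal \<beta> * resolvent Z (\<alpha> + \<beta>) u x \<le> (\<integral>\<^sup>+s\<in>{0..}. ennreal (exp (- s)) * k x 0 \<partial>lborel)"
      unfolding scaled[OF x \<beta>]
      using \<beta> by (intro nn_integral_mono) (auto simp: indicator_def intro!: mult_left_mono k_anti)
    then show ?thesis by (simp add: exp_k0 u_k[OF x])
  qed
  have ge: "u x \<le> (SUP \<beta>\<in>{0<..}. ennreal \<beta> * resolvent Z (\<alpha> + \<beta>) u x)" if x: "x \<in> S" for x
  proof -
    have [measurable]: "k x \<in> borel_measurable borel" "g x \<in> borel_measurable borel"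
      by (rule k_meas[OF x], rule g[OF x])
    \<comment> \<open>The half-lines from \<open>s / Suc n\<close> increase and cover all positive
      reals, but may miss 0; the null set \<open>r = 0\<close> is therefore left out.\<close>
    have SUPk: "(SUP n. k x (s / real (Suc n))) = k x 0" if s: "0 \<le> s" for s
    proof -
      have "(SUP n. k x (s / real (Suc n))) = (\<integral>\<^sup>+r. (SUP n. g x r * indicator {s / real (Suc n)..} r) \<partial>lborel)"
        unfolding k_def
      proof (rule nn_integral_monotone_convergence_SUP[symmetric])
        have "s / real (Suc n) \<le> s / real (Suc m)" if "m \<le> n" for m n
          using s that by (intro divide_left_mono) auto
        then show "incseq (\<lambda>n r. g x r * indicator {s / real (Suc n)..} r)"
          by (auto simp: incseq_def le_fun_def indicator_def intro: order_trans)
      qed measurable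
      also have "\<dots> = k x 0"
        unfolding k_def
      proof (rule nn_integral_cong_AE)
        have "AE r in lborel. r \<noteq> (0::real)" by (rule AE_lborel_singleton)
        then show "AE r in lborel. (SUP n. g x r * indicator {s / real (Suc n)..} r) = g x r * indicator {0..} r"
        proof eventually_elim
          case (elim r)
          show ?case
          proof (cases "r < 0")
            case True
            have "r < s / real (Suc n)" for n
              using True s by (meson divide_nonneg_nonneg less_le_trans of_nat_0_le_iff)
            then show ?thesis using True by (simp add: not_le)
          next
            case False
            then have r: "0 < r" using elim by simp
            obtain n where "s < real n * r" using ex_less_of_nat_mult[OF r] by blast
            then have "s / real (Suc n) \<le> r"
              using r by (simp add: pos_divide_le_eq) (smt (verit) mult.commute distrib_left mult_cancel_left2)
            then have "g x r \<le> (SUP n. g x r * indicator {s / real (Suc n)..} r)"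
              by (intro SUP_upper2[of n]) auto
            moreover have "(SUP n. g x r * indicator {s / real (Suc n)..} r) \<le> g x r"
              by (intro SUP_least) (auto simp: indicator_def)
            ultimately show ?thesis using r by simp
          qed
        qed
      qed
      finally show ?thesis .
    qed
    have "u x = (\<integral>\<^sup>+s\<in>{0..}. ennreal (exp (- s)) * k x 0 \<partial>lborel)"
      by (simp add: exp_k0 u_k[OF x])
    also have "\<dots> = (\<integral>\<^sup>+s. (SUP n. ennreal (exp (- s)) * k x (s / real (Suc n)) * indicator {0..} s) \<partial>lborel)"
    proof (rule nn_integral_cong)
      fix s :: real
      show "ennreal (exp (- s)) * k x 0 * indicator {0..} s = (SUP n. ennreal (exp (- s)) * k x (s / real (Suc n)) * indicator {0..} s)"
      proof (cases "0 \<le> s")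
        case True
        have "ennreal (exp (- s)) * k x 0 = (SUP n. ennreal (exp (- s)) * k x (s / real (Suc n)))"
          unfolding SUPk[OF True, symmetric] by (rule SUP_mult_left_ennreal)
        then show ?thesis using True by simp
      qed simp
    qed
    also have "\<dots> = (SUP n. \<integral>\<^sup>+s. ennreal (exp (- s)) * k x (s / real (Suc n)) * indicator {0..} s \<partial>lborel)"
    proof (rule nn_integral_monotone_convergence_SUP)
      show "incseq (\<lambda>n s. ennreal (exp (- s)) * k x (s / real (Suc n)) * indicator {0..} s)"
        by (auto simp: incseq_def le_fun_def indicator_def intro!: mult_left_mono k_anti divide_left_mono)
    qed measurable
    also have "\<dots> = (SUP n. ennreal (real (Suc n)) * resolvent Z (\<alpha> + real (Suc n)) u x)"
      by (intro SUP_cong refl scaled[OF x, symmetric]) simp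
    also have "\<dots> \<le> (SUP \<beta>\<in>{0<..}. ennreal \<beta> * resolvent Z (\<alpha> + \<beta>) u x)"
      by (intro SUP_mono) (metis UNIV_I greaterThan_iff of_nat_0_less_iff order_refl zero_less_Suc)
    finally show ?thesis .
  qed
  show "excessive S Z \<alpha> (resolvent Z \<alpha> f)"
    unfolding excessive_def u_def[symmetric]
    using u le ge by (auto intro!: antisym SUP_least)
  show "transition s (resolvent Z \<alpha> f) x = 0" if "x \<in> S" "0 \<le> s" "resolvent Z \<alpha> f x = 0" for x s
  proof -
    have "k x s \<le> k x 0" by (rule k_anti[OF that(2)])
    then have "ennreal (exp (- \<alpha> * s)) * transition s u x = 0"
      using u_k[OF that(1)] that(3) k[OF that(1,2)] by (simp add: u_def)
    then show ?thesis by (auto simp: u_def)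
  qed
qed

text \<open>At each fixed time the vanishing holds almost surely, hence at all grid times
  simultaneously; right continuity of excessive functions along the paths extends it to all
  times.\<close>

lemma resolvent_zero_absorbing:
  assumes f: "f \<in> borel_measurable BS" and \<alpha>: "0 < \<alpha>" and x: "x \<in> S" and 0: "resolvent Z \<alpha> f x = 0"
  shows "AE \<omega> in law Z x. \<forall>t\<ge>0. ext0 (resolvent Z \<alpha> f) (path Z t \<omega>) = 0"
proof -
  let ?u = "resolvent Z \<alpha> f"
  have u: "?u \<in> borel_measurable BS" by (rule resolvent_borel[OF \<alpha> f])
  have "AE \<omega> in law Z x. ext0 ?u (path Z ((real i + 1) / (1 + real k)) \<omega>) = 0" for i k :: nat
  proof -
    have t: "0 \<le> (real i + 1) / (1 + real k)" by simp
    have "(\<integral>\<^sup>+\<omega>. ext0 ?u (path Z ((real i + 1) / (1 + real k)) \<omega>) \<partial>law Z x) = 0"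
      using excessive_resolvent(2)[OF f \<alpha> x t 0] by (simp add: transition_def)
    then show ?thesis
      by (subst (asm) nn_integral_0_iff_AE) (auto intro!: measurable_path_ext0 u x)
  qed
  then have "AE \<omega> in law Z x. \<forall>i k :: nat. ext0 ?u (path Z ((real i + 1) / (1 + real k)) \<omega>) = 0"
    by (simp add: AE_all_countable)
  with excessive_right_continuous[OF \<alpha> excessive_resolvent(1)[OF f \<alpha>] x]
  show ?thesis
  proof eventually_elim
    case (elim \<omega>)
    show ?case
    proof (intro allI impI)
      fix t :: real assume t: "0 \<le> t"
      have "((\<lambda>s. ext0 ?u (path Z s \<omega>)) \<longlongrightarrow> ext0 ?u (path Z t \<omega>)) (at_right t)"
        using elim(1) t by (simp add: continuous_within)
      then have lim: "(\<lambda>k. ext0 ?u (path Z (grid_above k t) \<omega>)) \<longlonglongrightarrow> ext0 ?u (path Z t \<omega>)"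
        by (rule filterlim_compose[OF _ filterlim_at_right_grid_above])
      have "grid_above k t = (real (nat \<lfloor>t * (1 + real k)\<rfloor>) + 1) / (1 + real k)" for k
        using t by (simp add: grid_above_def)
      then have "ext0 ?u (path Z (grid_above k t) \<omega>) = 0" for k
        using elim(2) by simp
      with lim show "ext0 ?u (path Z t \<omega>) = 0"
        by (simp add: LIMSEQ_const_iff)
    qed
  qed
qed

text \<open>The exponential weight is positive, so a zero integral forces the other factor to vanish
  at almost every time.\<close>

lemma resolvent_zero_transition:
  assumes f: "f \<in> borel_measurable BS" and x: "x \<in> S" and 0: "resolvent Z \<alpha> f x = 0"
  shows "AE r in lborel. 0 \<le> r \<longrightarrow> transition r f x = 0"
proof -
  have [measurable]: "(\<lambda>r. transition (max 0 r) f x) \<in> borel_measurable borel"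
    by (rule transition_time_measurable[OF f x])
  have "(\<integral>\<^sup>+r. ennreal (exp (- \<alpha> * r)) * transition (max 0 r) f x * indicator {0..} r \<partial>lborel) = 0"
    using 0 unfolding resolvent_eq_potential[OF f x] potential_def
    by (subst nn_integral_cong[of _ _ "\<lambda>r. ennreal (exp (- \<alpha> * r)) * transition r f x * indicator {0..} r"])
       (auto simp: indicator_def)
  then have "AE r in lborel. ennreal (exp (- \<alpha> * r)) * transition (max 0 r) f x * indicator {0..} r = 0"
    by (subst (asm) nn_integral_0_iff_AE) auto
  then show ?thesis by eventually_elim (auto simp: max_def)
qed

section \<open>The lifetime, and the martingale problem as a bound on the transition
  function\<close>

lemma lifetime_nonneg: "0 \<le> lifetime Z \<omega>"
  unfolding lifetime_def by (rule Inf_greatest) auto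

lemma alive_before_lifetime: "0 \<le> t \<Longrightarrow> ereal t < lifetime Z \<omega> \<Longrightarrow> path Z t \<omega> \<noteq> None"
  using Inf_lower[of "ereal t" "{ereal t | t. 0 \<le> t \<and> path Z t \<omega> = None}"]
  unfolding lifetime_def by (auto simp: not_le[symmetric])

lemma dead_after_lifetime:
  assumes "\<omega> \<in> space (events Z)" "lifetime Z \<omega> < ereal t"
  shows "path Z t \<omega> = None"
proof -
  obtain s where "0 \<le> s" "path Z s \<omega> = None" "ereal s < ereal t"
    using assms(2) unfolding lifetime_def by (auto simp: Inf_less_iff)
  then show ?thesis using absorbing[of s t \<omega>] assms(1) by simp
qed

lemma dead_at_lifetime:
  assumes "\<omega> \<in> space (events Z)" "right_continuous_path Z \<omega>" "lifetime Z \<omega> = ereal t"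
  shows "path Z t \<omega> = None"
proof (rule ccontr)
  assume "path Z t \<omega> \<noteq> None"
  then obtain y where y: "path Z t \<omega> = Some y" by auto
  have t: "0 \<le> t" using lifetime_nonneg[of \<omega>] assms(3) by simp
  obtain k where "path Z (grid_above k t) \<omega> \<noteq> None"
    using eventually_happens[OF right_continuous_pathD(1)[OF assms(2) t y filterlim_at_right_grid_above]] by auto
  then show False
    using dead_after_lifetime[OF assms(1), of "grid_above k t"] assms(3) grid_above_greater[of t k] by simp
qed

lemma stop_at_lifetime_bounds: "0 \<le> t \<Longrightarrow> 0 \<le> stop_at_lifetime Z t \<omega> \<and> stop_at_lifetime Z t \<omega> \<le> t"
  unfolding stop_at_lifetime_def using lifetime_nonneg[of \<omega>]
  by (cases "lifetime Z \<omega>") (auto simp: min_def)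

text \<open>Right continuity puts the path into the cemetery at its lifetime already, so stopping
  there changes no value.\<close>

lemma ext0_path_stopped:
  assumes "\<omega> \<in> space (events Z)" "right_continuous_path Z \<omega>" "0 \<le> t"
  shows "ext0 f (path Z (stop_at_lifetime Z t \<omega>) \<omega>) = ext0 f (path Z t \<omega>)"
proof (cases "ereal t \<le> lifetime Z \<omega>")
  case True
  then show ?thesis by (simp add: stop_at_lifetime_def min_def)
next
  case False
  then obtain r where r: "lifetime Z \<omega> = ereal r" "r < t"
    using lifetime_nonneg[of \<omega>] by (cases "lifetime Z \<omega>") auto
  then have "stop_at_lifetime Z t \<omega> = r" by (simp add: stop_at_lifetime_def min_def)
  then show ?thesis
    using dead_at_lifetime[OF assms(1,2) r(1)] dead_after_lifetime[OF assms(1), of t] r by simp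
qed

text \<open>As \<open>\<psi> y = 0\<close>, the martingale starts at 0 and has mean 0, so the mean
  of \<open>\<psi>\<close> at time \<open>h\<close> is the mean of the integral of \<open>g\<close>
  up to \<open>h\<close> or the lifetime. Absolute values let the bound be stated in
  \<open>ennreal\<close> with no integrability of \<open>g\<close>.\<close>

lemma martingale_transition_bound:
  fixes \<psi> g :: "'s \<Rightarrow> real"
  assumes y: "y \<in> S" and \<psi>: "\<psi> \<in> borel_measurable BS" and g: "g \<in> borel_measurable BS"
    and bounds: "\<And>q. q \<in> S \<Longrightarrow> 0 \<le> \<psi> q" "\<And>q. q \<in> S \<Longrightarrow> \<psi> q \<le> c" and 0: "\<psi> y = 0"
    and mart: "solves_at \<psi> g y"
    and h: "0 \<le> h"
  shows "transition h (\<lambda>q. ennreal (\<psi> q)) y \<le> potential (indicator {0..h}) (\<lambda>q. ennreal \<bar>g q\<bar>) y"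
proof -
  interpret prob_space "law Z y" using prob_law[OF y] .
  interpret F: finite_measure_subalgebra "law Z y" "filt Z 0"
    by unfold_locales (rule subalgebra_law[OF y order_refl])
  define Y where "Y t \<omega> = ext0 \<psi> (path Z (stop_at_lifetime Z t \<omega>) \<omega>)
           - (LBINT r:{0..stop_at_lifetime Z t \<omega>}. ext0 g (path Z r \<omega>))" for t \<omega>
  have int: "integrable (law Z y) (Y h)" and Y0: "AE \<omega> in law Z y. real_cond_exp (law Z y) (filt Z 0) (Y h) \<omega> = Y 0 \<omega>"
    using mart h unfolding martingale_def Y_def by auto
  have "(\<integral>\<omega>. Y h \<omega> \<partial>law Z y) = (\<integral>\<omega>. real_cond_exp (law Z y) (filt Z 0) (Y h) \<omega> \<partial>law Z y)"
    using F.real_cond_exp_int(2)[OF int] by simp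
  also have "\<dots> = (\<integral>\<omega>. 0 \<partial>law Z y)"
  proof (rule integral_cong_AE)
    show "AE \<omega> in law Z y. real_cond_exp (law Z y) (filt Z 0) (Y h) \<omega> = 0"
      using Y0 normal[OF y] AE_good[OF y]
    proof eventually_elim
      case (elim \<omega>)
      have "stop_at_lifetime Z 0 \<omega> = 0" using stop_at_lifetime_bounds[of 0 \<omega>] by simp
      moreover have "(LBINT r:{0..0::real}. ext0 g (path Z r \<omega>)) = 0"
        unfolding set_lebesgue_integral_def
        using AE_lborel_singleton[of "0::real"] by (intro integral_eq_zero_AE) (auto elim: eventually_mono)
      ultimately show ?case using elim 0 by (simp add: Y_def)
    qed
  qed simp_all
  finally have EY: "(\<integral>\<omega>. Y h \<omega> \<partial>law Z y) = 0" by simp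
  define \<Psi> where "\<Psi> \<omega> = ext0 \<psi> (path Z h \<omega>)" for \<omega>
  have \<Psi>_bounds: "0 \<le> \<Psi> \<omega>" "\<Psi> \<omega> \<le> max 0 c" if "\<omega> \<in> space (law Z y)" for \<omega>
  proof -
    have "path Z h \<omega> \<in> insert None (Some ` S)" using path_in[OF h] that by (simp add: space_law[OF y])
    then show "0 \<le> \<Psi> \<omega>" "\<Psi> \<omega> \<le> max 0 c" using bounds by (auto simp: \<Psi>_def le_max_iff_disj)
  qed
  have \<Psi>m: "\<Psi> \<in> borel_measurable (law Z y)"
    unfolding \<Psi>_def by (rule measurable_path_ext0[OF h y \<psi>])
  have \<Psi>int: "integrable (law Z y) \<Psi>"
    using \<Psi>_bounds \<Psi>m by (intro integrable_const_bound[of _ "max 0 c"]) auto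
  have "transition h (\<lambda>q. ennreal (\<psi> q)) y = (\<integral>\<^sup>+\<omega>. ennreal (\<Psi> \<omega>) \<partial>law Z y)"
    unfolding transition_def \<Psi>_def by (simp add: ext0_ennreal)
  also have "\<dots> = ennreal (\<integral>\<omega>. \<Psi> \<omega> \<partial>law Z y)"
    using \<Psi>_bounds by (intro nn_integral_eq_integral \<Psi>int) auto
  \<comment> \<open>Subtracting the mean-zero martingale leaves exactly the integral term, whose
    integrability thus comes from that of \<open>\<Psi>\<close> and \<open>Y h\<close>.\<close>
  also have "(\<integral>\<omega>. \<Psi> \<omega> \<partial>law Z y) = (\<integral>\<omega>. \<Psi> \<omega> - Y h \<omega> \<partial>law Z y)"
    using EY \<Psi>int int by simp
  also have "ennreal \<dots> \<le> (\<integral>\<^sup>+\<omega>. ennreal (\<Psi> \<omega> - Y h \<omega>) \<partial>law Z y)"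
    using \<Psi>int int by (intro ennreal_integral_le_nn_integral) auto
  also have "\<dots> \<le> (\<integral>\<^sup>+\<omega>. (\<integral>\<^sup>+r\<in>{0..}. indicator {0..h} r * ext0 (\<lambda>q. ennreal \<bar>g q\<bar>) (path Z r \<omega>) \<partial>lborel) \<partial>law Z y)"
  proof (rule nn_integral_mono_AE)
    show "AE \<omega> in law Z y. ennreal (\<Psi> \<omega> - Y h \<omega>) \<le> (\<integral>\<^sup>+r\<in>{0..}. indicator {0..h} r * ext0 (\<lambda>q. ennreal \<bar>g q\<bar>) (path Z r \<omega>) \<partial>lborel)"
      using AE_good[OF y]
    proof eventually_elim
      case (elim \<omega>)
      have "\<Psi> \<omega> - Y h \<omega> = (LBINT r:{0..stop_at_lifetime Z h \<omega>}. ext0 g (path Z r \<omega>))"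
        using ext0_path_stopped[of \<omega> h \<psi>] elim h by (simp add: Y_def \<Psi>_def)
      also have "ennreal \<dots> \<le> (\<integral>\<^sup>+r\<in>{0..stop_at_lifetime Z h \<omega>}. ennreal \<bar>ext0 g (path Z r \<omega>)\<bar> \<partial>lborel)"
        by (rule ennreal_set_lebesgue_integral_le)
      also have "\<dots> \<le> (\<integral>\<^sup>+r\<in>{0..}. indicator {0..h} r * ext0 (\<lambda>q. ennreal \<bar>g q\<bar>) (path Z r \<omega>) \<partial>lborel)"
        using stop_at_lifetime_bounds[OF h, of \<omega>]
        by (intro nn_integral_mono) (auto simp: indicator_def ext0_def split: option.splits)
      finally show ?case .
    qed
  qed
  also have "\<dots> = potential (indicator {0..h}) (\<lambda>q. ennreal \<bar>g q\<bar>) y"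
    using g by (intro potential_eq[symmetric] y) auto
  finally show ?thesis .
qed

end

section \<open>Compensated jumps\<close>

text \<open>The half-open cells are disjoint, so at most one summand survives, that of the cell
  containing \<open>r\<close>.\<close>

lemma sum_indicator_grid:
  fixes c :: "nat \<Rightarrow> ennreal" and h r :: real
  assumes h: "0 < h"
  shows "(\<Sum>i<n. indicator {real i * h..<real i * h + h} r * c i) =
    indicator {0..<real n * h} r * c (nat \<lfloor>r / h\<rfloor>)"
proof -
  have mem: "r \<in> {real i * h..<real i * h + h} \<longleftrightarrow> 0 \<le> r \<and> i = nat \<lfloor>r / h\<rfloor>" for i
  proof -
    have "r \<in> {real i * h..<real i * h + h} \<longleftrightarrow> of_int (int i) \<le> r / h \<and> r / h < of_int (int i) + 1"
      using h by (simp add: pos_le_divide_eq pos_divide_less_eq algebra_simps)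
    also have "\<dots> \<longleftrightarrow> \<lfloor>r / h\<rfloor> = int i" by (auto simp: floor_eq_iff)
    also have "\<dots> \<longleftrightarrow> 0 \<le> r \<and> i = nat \<lfloor>r / h\<rfloor>"
    proof -
      have "0 \<le> r \<longleftrightarrow> 0 \<le> \<lfloor>r / h\<rfloor>" using h by (simp add: zero_le_divide_iff)
      moreover have "a = int i \<longleftrightarrow> 0 \<le> a \<and> i = nat a" for a by auto
      ultimately show ?thesis by metis
    qed
    finally show ?thesis .
  qed
  have lt: "nat \<lfloor>r / h\<rfloor> < n \<longleftrightarrow> r < real n * h" if "0 \<le> r"
  proof -
    have "nat \<lfloor>r / h\<rfloor> < n \<longleftrightarrow> \<lfloor>r / h\<rfloor> < int n" using that h by (simp add: nat_less_iff)
    also have "\<dots> \<longleftrightarrow> r / h < real n" by (simp add: floor_less_iff)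
    also have "\<dots> \<longleftrightarrow> r < real n * h" using h by (simp add: pos_divide_less_eq)
    finally show ?thesis .
  qed
  have "(\<Sum>i<n. indicator {real i * h..<real i * h + h} r * c i) =
    (\<Sum>i<n. if i = nat \<lfloor>r / h\<rfloor> then indicator {0..} r * c i else 0)"
  proof (rule sum.cong[OF refl])
    fix i
    show "indicator {real i * h..<real i * h + h} r * c i = (if i = nat \<lfloor>r / h\<rfloor> then indicator {0..} r * c i else 0)"
      using mem[of i] unfolding indicator_def by auto
  qed
  also have "\<dots> = indicator {0..<real n * h} r * c (nat \<lfloor>r / h\<rfloor>)"
    using lt by (auto simp: sum.delta indicator_def)
  finally show ?thesis .
qed

context metric_right_process
begin

text \<open>The Markov property at time \<open>t\<close> is applied on both sides; the comparison is
  required only at the states visited on \<open>A\<close>.\<close>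

lemma step_bound:
  assumes \<psi>: "\<psi> \<in> borel_measurable BS" and g: "g \<in> borel_measurable BS" and x: "x \<in> S"
    and t: "0 \<le> t" and h: "0 \<le> h" and A: "A \<in> sets (filt Z t)"
    and bound: "AE \<omega> in law Z x. \<omega> \<in> A \<longrightarrow> ext0 (transition h \<psi>) (path Z t \<omega>) \<le> ext0 (potential (indicator {0..h}) g) (path Z t \<omega>)"
  shows "(\<integral>\<^sup>+\<omega>\<in>A. ext0 \<psi> (path Z (t + h) \<omega>) \<partial>law Z x) \<le>
    (\<integral>\<^sup>+\<omega>\<in>A. (\<integral>\<^sup>+r\<in>{0..}. indicator {0..h} r * ext0 g (path Z (t + r) \<omega>) \<partial>lborel) \<partial>law Z x)"
proof -
  have "(\<integral>\<^sup>+\<omega>\<in>A. ext0 \<psi> (path Z (t + h) \<omega>) \<partial>law Z x) = (\<integral>\<^sup>+\<omega>\<in>A. ext0 (transition h \<psi>) (path Z t \<omega>) \<partial>law Z x)"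
    by (rule markov_function[OF \<psi> x t h A])
  also have "\<dots> \<le> (\<integral>\<^sup>+\<omega>\<in>A. ext0 (potential (indicator {0..h}) g) (path Z t \<omega>) \<partial>law Z x)"
    using bound by (intro nn_integral_mono_AE) (auto simp: indicator_def elim!: eventually_mono)
  also have "\<dots> = (\<integral>\<^sup>+\<omega>\<in>A. (\<integral>\<^sup>+r\<in>{0..}. indicator {0..h} r * ext0 g (path Z (t + r) \<omega>) \<partial>lborel) \<partial>law Z x)"
    by (rule markov_potential[OF g x t _ A]) simp
  finally show ?thesis .
qed

text \<open>Sums the one-step bounds. The cell integrals fit together into one integral over time,
  in which the event active at \<open>r\<close> is that of the cell containing
  \<open>r\<close>.\<close>

lemma grid_bound:
  assumes \<psi>: "\<psi> \<in> borel_measurable BS" and g: "g \<in> borel_measurable BS" and x: "x \<in> S"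
    and s: "0 \<le> s" and h: "0 < h" and A: "\<And>i. A i \<in> sets (filt Z (s + real i * h))"
    and bound: "\<And>i. i < n \<Longrightarrow> AE \<omega> in law Z x. \<omega> \<in> A i \<longrightarrow>
      ext0 (transition h \<psi>) (path Z (s + real i * h) \<omega>) \<le> ext0 (potential (indicator {0..h}) g) (path Z (s + real i * h) \<omega>)"
  shows "(\<integral>\<^sup>+\<omega>. (\<Sum>i<n. indicator (A i) \<omega> * ext0 \<psi> (path Z (s + real (Suc i) * h) \<omega>)) \<partial>law Z x) \<le>
    (\<integral>\<^sup>+\<omega>. (\<integral>\<^sup>+r. indicator {0..<real n * h} r * indicator (A (nat \<lfloor>r / h\<rfloor>)) \<omega> * ext0 g (path Z (s + r) \<omega>) \<partial>lborel) \<partial>law Z x)"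
proof -
  have t: "0 \<le> s + real i * h" for i using s h by simp
  have AL: "A i \<in> sets (law Z x)" for i
    using A[of i] sets_filt_subset[OF t[of i]] sets_law[OF x] by auto
  define F where "F i \<omega> = (\<integral>\<^sup>+r\<in>{0..}. indicator {0..h} r * ext0 g (path Z ((s + real i * h) + r) \<omega>) \<partial>lborel) * indicator (A i) \<omega>" for i \<omega>
  have F: "F i \<in> borel_measurable (completion (law Z x))" for i
    unfolding F_def by (rule path_occupation_Fubini(1)[OF g x t _ AL]) simp
  have "(\<integral>\<^sup>+\<omega>. (\<Sum>i<n. indicator (A i) \<omega> * ext0 \<psi> (path Z (s + real (Suc i) * h) \<omega>)) \<partial>law Z x) =
    (\<Sum>i<n. \<integral>\<^sup>+\<omega>\<in>A i. ext0 \<psi> (path Z ((s + real i * h) + h) \<omega>) \<partial>law Z x)"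
  proof (subst nn_integral_sum)
    fix i
    have "(\<lambda>\<omega>. ext0 \<psi> (path Z (s + real (Suc i) * h) \<omega>)) \<in> borel_measurable (law Z x)"
      by (rule measurable_path_ext0[OF t x \<psi>])
    then show "(\<lambda>\<omega>. indicator (A i) \<omega> * ext0 \<psi> (path Z (s + real (Suc i) * h) \<omega>)) \<in> borel_measurable (law Z x)"
      using AL by (intro borel_measurable_times_ennreal) auto
  qed (simp add: algebra_simps)
  also have "\<dots> \<le> (\<Sum>i<n. \<integral>\<^sup>+\<omega>. F i \<omega> \<partial>law Z x)"
    unfolding F_def using h by (intro sum_mono step_bound \<psi> g x t A bound) auto
  also have "\<dots> = (\<integral>\<^sup>+\<omega>. (\<Sum>i<n. F i \<omega>) \<partial>law Z x)"
    using nn_integral_sum[of "{..<n}" F "completion (law Z x)"] F by (simp add: nn_integral_completion)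
  also have "\<dots> = (\<integral>\<^sup>+\<omega>. (\<integral>\<^sup>+r. indicator {0..<real n * h} r * indicator (A (nat \<lfloor>r / h\<rfloor>)) \<omega> * ext0 g (path Z (s + r) \<omega>) \<partial>lborel) \<partial>law Z x)"
  proof (rule nn_integral_cong_AE)
    have "AE \<omega> in law Z x. (\<lambda>r. ext0 g (path Z (s + r) \<omega>) * indicator {0..} r) \<in> borel_measurable borel"
      using path_occupation_time_measurable[OF g x s, of "\<lambda>_. 1"] by simp
    then show "AE \<omega> in law Z x. (\<Sum>i<n. F i \<omega>) =
      (\<integral>\<^sup>+r. indicator {0..<real n * h} r * indicator (A (nat \<lfloor>r / h\<rfloor>)) \<omega> * ext0 g (path Z (s + r) \<omega>) \<partial>lborel)"
    proof eventually_elim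
      case (elim \<omega>)
      define G where "G r = ext0 g (path Z (s + r) \<omega>) * indicator {0..} r" for r
      have [measurable]: "G \<in> borel_measurable borel" using elim by (simp add: G_def[abs_def])
      have Fi: "F i \<omega> = (\<integral>\<^sup>+r. indicator {real i * h..<real i * h + h} r * (indicator (A i) \<omega> * G r) \<partial>lborel)" for i
      proof -
        define p where "p = real i * h"
        have p: "0 \<le> p" using h by (simp add: p_def)
        have 1: "indicator {p..p + h} (p + 1 * r) * G (p + 1 * r) =
            indicator {0..h} r * ext0 g (path Z (s + p + r) \<omega>) * indicator {0..} r" for r
          using p by (auto simp: G_def indicator_def add.assoc)
        have "(\<integral>\<^sup>+r. indicator {p..p + h} r * G r \<partial>lborel) =
          (\<integral>\<^sup>+r. indicator {0..h} r * ext0 g (path Z (s + p + r) \<omega>) * indicator {0..} r \<partial>lborel)"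
        proof -
          have "(\<lambda>r. indicator {p..p + h} r * G r) \<in> borel_measurable borel" by measurable
          from nn_integral_real_affine[OF this, of 1 p] show ?thesis
            unfolding 1 by simp
        qed
        then have "F i \<omega> = (\<integral>\<^sup>+r. indicator {p..p + h} r * G r \<partial>lborel) * indicator (A i) \<omega>"
          by (simp add: F_def p_def)
        also have "\<dots> = (\<integral>\<^sup>+r. indicator {p..p + h} r * G r * indicator (A i) \<omega> \<partial>lborel)"
          by (rule nn_integral_multc[symmetric]) measurable
        \<comment> \<open>The integrals over \<open>{0..h}\<close> give closed cells; dropping the
          right end point, a null set, makes them disjoint.\<close>
        also have "\<dots> = (\<integral>\<^sup>+r. indicator {p..<p + h} r * (indicator (A i) \<omega> * G r) \<partial>lborel)"
          using AE_lborel_singleton[of "p + h"]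
          by (intro nn_integral_cong_AE) (auto simp: indicator_def elim!: eventually_mono)
        finally show ?thesis by (simp add: p_def)
      qed
      have "(\<Sum>i<n. F i \<omega>) = (\<integral>\<^sup>+r. (\<Sum>i<n. indicator {real i * h..<real i * h + h} r * (indicator (A i) \<omega> * G r)) \<partial>lborel)"
        unfolding Fi by (rule nn_integral_sum[symmetric]) measurable
      also have "\<dots> = (\<integral>\<^sup>+r. indicator {0..<real n * h} r * indicator (A (nat \<lfloor>r / h\<rfloor>)) \<omega> * ext0 g (path Z (s + r) \<omega>) \<partial>lborel)"
        unfolding sum_indicator_grid[OF h] by (intro nn_integral_cong) (auto simp: G_def indicator_def)
      finally show ?case .
    qed
  qed
  finally show ?thesis .
qed

text \<open>The left end of the cell containing \<open>r\<close>, that is, the grid time whose event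
  governs \<open>r\<close>. With mesh \<open>T / Suc k\<close> exactly \<open>Suc k\<close> cells
  fill the time from 0 to \<open>T\<close>.\<close>

definition grid_below :: "real \<Rightarrow> nat \<Rightarrow> real \<Rightarrow> real" where
  "grid_below T k r = real (nat \<lfloor>r / (T / real (Suc k))\<rfloor>) * (T / real (Suc k))"

text \<open>The index \<open>k\<close> refines the grid, \<open>n\<close> shrinks the events; the limit in \<open>k\<close> is taken first, and
  Fatou's lemma is applied once for each.\<close>

theorem no_compensated_jumps:
  fixes A :: "nat \<Rightarrow> real \<Rightarrow> 'w set"
  assumes \<psi>: "\<psi> \<in> borel_measurable BS" and g: "g \<in> borel_measurable BS" and x: "x \<in> S"
    and s: "0 \<le> s" and T: "0 < T"
    and A: "\<And>n r. 0 \<le> r \<Longrightarrow> A n r \<in> sets (filt Z (s + r))"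
    and \<Lambda>: "\<Lambda> \<in> sets (filt Z s)" and A\<Lambda>: "\<And>n r. 0 \<le> r \<Longrightarrow> A n r \<subseteq> \<Lambda>"
    and fin: "(\<integral>\<^sup>+\<omega>\<in>\<Lambda>. (\<integral>\<^sup>+r\<in>{0..}. indicator {0..<T} r * ext0 g (path Z (s + r) \<omega>) \<partial>lborel) \<partial>law Z x) < \<infinity>"
    and bound: "\<And>n k i h. 0 \<le> h \<Longrightarrow> AE \<omega> in law Z x. \<omega> \<in> A n (real i * (T / real (Suc k))) \<longrightarrow>
      ext0 (transition h \<psi>) (path Z (s + real i * (T / real (Suc k))) \<omega>) \<le>
      ext0 (potential (indicator {0..h}) g) (path Z (s + real i * (T / real (Suc k))) \<omega>)"
    and vanish: "AE \<omega> in law Z x. AE r in lborel. 0 \<le> r \<longrightarrow> r < T \<longrightarrow> ext0 g (path Z (s + r) \<omega>) \<noteq> 0 \<longrightarrow>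
      (\<exists>n0. \<forall>n\<ge>n0. \<forall>\<^sub>F k in sequentially. \<omega> \<notin> A n (grid_below T k r))"
  shows "AE \<omega> in law Z x. \<not> (\<exists>c>0. \<forall>n. \<forall>\<^sub>F k in sequentially.
    c \<le> (\<Sum>i<Suc k. indicator (A n (real i * (T / real (Suc k)))) \<omega> * ext0 \<psi> (path Z (s + real (Suc i) * (T / real (Suc k))) \<omega>)))"
proof -
  interpret P: prob_space "law Z x" using prob_law[OF x] .
  interpret pair_sigma_finite lborel "law Z x" ..
  let ?M = "lborel \<Otimes>\<^sub>M law Z x :: (real \<times> 'w) measure"
  define J where "J n k \<omega> = (\<Sum>i<Suc k. indicator (A n (real i * (T / real (Suc k)))) \<omega> * ext0 \<psi> (path Z (s + real (Suc i) * (T / real (Suc k))) \<omega>))" for n k \<omega>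
  have AL: "A n r \<in> sets (law Z x)" if "0 \<le> r" for n r
    using A[OF that, of n] sets_filt_subset[of "s + r"] sets_law[OF x] s that by auto
  have \<Lambda>L: "\<Lambda> \<in> sets (law Z x)"
    using \<Lambda> sets_filt_subset[OF s] sets_law[OF x] by auto
  have J [measurable]: "J n k \<in> borel_measurable (law Z x)" for n k
    unfolding J_def
    using s T by (intro borel_measurable_sum borel_measurable_times_ennreal borel_measurable_indicator AL measurable_path_ext0 \<psi> x) auto
  obtain h where h: "(\<lambda>(r, \<omega>). h r \<omega>) \<in> borel_measurable (borel \<Otimes>\<^sub>M law Z x)"
    and hae: "AE \<omega> in law Z x. \<forall>r. h r \<omega> = indicator {0..<T} r * ext0 g (path Z (s + r) \<omega>) * indicator {0..} r"
    using path_occupation_measurable[OF g x s, of "indicator {0..<T}"] by auto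
  have [measurable]: "(\<lambda>p. h (fst p) (snd p)) \<in> borel_measurable ?M"
    using h by (simp add: case_prod_beta' cong: measurable_cong_sets)
  define u where "u n k p = indicator (A n (grid_below T k (fst p))) (snd p) * h (fst p) (snd p)" for n k p
  have u [measurable]: "u n k \<in> borel_measurable ?M" for n k
  proof -
    define i where "i p = nat \<lfloor>fst p / (T / real (Suc k))\<rfloor>" for p :: "real \<times> 'w"
    have 1: "(\<lambda>p. indicator (A n (real j * (T / real (Suc k)))) (snd p) :: ennreal) \<in> borel_measurable ?M" for j :: nat
      using T by (intro measurable_compose[OF measurable_snd] borel_measurable_indicator AL) auto
    have 2: "i \<in> measurable ?M (count_space UNIV)"
      unfolding i_def by measurable
    have "(\<lambda>p. (\<lambda>j p. indicator (A n (real j * (T / real (Suc k)))) (snd p) :: ennreal) (i p) p) \<in> borel_measurable ?M"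
      using 1 2 by (rule measurable_compose_countable)
    then have [measurable]: "(\<lambda>p. indicator (A n (grid_below T k (fst p))) (snd p) :: ennreal) \<in> borel_measurable ?M"
      by (simp add: grid_below_def i_def)
    show ?thesis unfolding u_def by measurable
  qed
  have EJ: "(\<integral>\<^sup>+\<omega>. J n k \<omega> \<partial>law Z x) \<le> (\<integral>\<^sup>+p. u n k p \<partial>?M)" for n k
  proof -
    have "(\<integral>\<^sup>+\<omega>. J n k \<omega> \<partial>law Z x) \<le> (\<integral>\<^sup>+\<omega>. (\<integral>\<^sup>+r. indicator {0..<real (Suc k) * (T / real (Suc k))} r *
        indicator (A n (real (nat \<lfloor>r / (T / real (Suc k))\<rfloor>) * (T / real (Suc k)))) \<omega> * ext0 g (path Z (s + r) \<omega>) \<partial>lborel) \<partial>law Z x)"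
      unfolding J_def using T
      by (intro grid_bound[where A = "\<lambda>i. A n (real i * (T / real (Suc k)))"] \<psi> g x s A bound) auto
    also have "\<dots> = (\<integral>\<^sup>+\<omega>. (\<integral>\<^sup>+r. u n k (r, \<omega>) \<partial>lborel) \<partial>law Z x)"
      using hae
      by (intro nn_integral_cong_AE)
         (auto simp: u_def grid_below_def indicator_def elim!: eventually_mono intro!: nn_integral_cong)
    also have "\<dots> = (\<integral>\<^sup>+p. u n k p \<partial>?M)"
      by (rule nn_integral_snd) (rule u)
    finally show ?thesis .
  qed
  \<comment> \<open>The common integrable bound of all \<open>u n k\<close>; it is what permits the
    reverse Fatou lemma in both limits.\<close>
  define w where "w p = indicator \<Lambda> (snd p) * h (fst p) (snd p)" for p
  note [measurable] = \<Lambda>L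
  have w [measurable]: "w \<in> borel_measurable ?M"
    unfolding w_def by measurable
  have w_fin: "(\<integral>\<^sup>+p. w p \<partial>?M) < \<infinity>"
  proof -
    have "(\<integral>\<^sup>+p. w p \<partial>?M) = (\<integral>\<^sup>+\<omega>. (\<integral>\<^sup>+r. w (r, \<omega>) \<partial>lborel) \<partial>law Z x)"
      by (rule nn_integral_snd[symmetric]) (rule w)
    also have "\<dots> = (\<integral>\<^sup>+\<omega>\<in>\<Lambda>. (\<integral>\<^sup>+r\<in>{0..}. indicator {0..<T} r * ext0 g (path Z (s + r) \<omega>) \<partial>lborel) \<partial>law Z x)"
      using hae by (intro nn_integral_cong_AE) (auto simp: w_def indicator_def elim!: eventually_mono)
    finally show ?thesis using fin by simp
  qed
  have grid_nonneg: "0 \<le> grid_below T k r" for k r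
    using T by (simp add: grid_below_def)
  have uw: "u n k p \<le> w p" for n k p
    using A\<Lambda>[OF grid_nonneg, of n k "fst p"] by (auto simp: u_def w_def indicator_def)
  define v where "v n p = limsup (\<lambda>k. u n k p)" for n p
  have v [measurable]: "v n \<in> borel_measurable ?M" for n
    unfolding v_def by measurable
  have vw: "v n p \<le> w p" for n p
    unfolding v_def using uw by (intro Limsup_bounded always_eventually allI)
  have "limsup (\<lambda>n. \<integral>\<^sup>+p. v n p \<partial>?M) \<le> (\<integral>\<^sup>+p. limsup (\<lambda>n. v n p) \<partial>?M)"
    using vw w_fin by (intro nn_integral_limsup[where w = w]) auto
  also have "\<dots> = (\<integral>\<^sup>+\<omega>. (\<integral>\<^sup>+r. limsup (\<lambda>n. v n (r, \<omega>)) \<partial>lborel) \<partial>law Z x)"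
    by (rule nn_integral_snd[symmetric]) measurable
  also have "\<dots> = (\<integral>\<^sup>+\<omega>. 0 \<partial>law Z x)"
  proof (rule nn_integral_cong_AE)
    show "AE \<omega> in law Z x. (\<integral>\<^sup>+r. limsup (\<lambda>n. v n (r, \<omega>)) \<partial>lborel) = 0"
      using hae vanish
    proof eventually_elim
      case (elim \<omega>)
      have "AE r in lborel. limsup (\<lambda>n. v n (r, \<omega>)) = 0"
        using elim(2)
      proof eventually_elim
        case (elim r)
        show ?case
        proof (cases "h r \<omega> = 0")
          case True
          then have "v n (r, \<omega>) = 0" for n
            using vw[of n "(r, \<omega>)"] by (simp add: w_def)
          then show ?thesis by (simp add: Limsup_const)
        next
          case False
          then have "0 \<le> r" "r < T" "ext0 g (path Z (s + r) \<omega>) \<noteq> 0"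
            using \<open>\<forall>r. h r \<omega> = _ r\<close> by (auto simp: indicator_def split: if_splits)
          then obtain n0 where n0: "\<And>n. n \<ge> n0 \<Longrightarrow> \<forall>\<^sub>F k in sequentially. \<omega> \<notin> A n (grid_below T k r)"
            using elim by blast
          have "v n (r, \<omega>) = 0" if "n \<ge> n0" for n
          proof -
            have "\<forall>\<^sub>F k in sequentially. u n k (r, \<omega>) = 0"
              using n0[OF that] by eventually_elim (simp add: u_def)
            then have "v n (r, \<omega>) = limsup (\<lambda>k. 0)"
              unfolding v_def by (rule Limsup_eq)
            then show ?thesis by (simp add: Limsup_const)
          qed
          then have "\<forall>\<^sub>F n in sequentially. v n (r, \<omega>) = 0"
            by (auto simp: eventually_sequentially)
          then have "limsup (\<lambda>n. v n (r, \<omega>)) = limsup (\<lambda>n. 0)" by (rule Limsup_eq)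
          then show ?thesis by (simp add: Limsup_const)
        qed
      qed
      then show ?case
        by (subst nn_integral_cong_AE[where v = "\<lambda>_. 0"]) auto
    qed
  qed
  finally have v0: "limsup (\<lambda>n. \<integral>\<^sup>+p. v n p \<partial>?M) = 0" by simp
  \<comment> \<open>Fatou's lemma bounds the limit of the sums, and its reverse the limit of the
    compensating integrals.\<close>
  have Jv: "(\<integral>\<^sup>+\<omega>. liminf (\<lambda>k. J n k \<omega>) \<partial>law Z x) \<le> (\<integral>\<^sup>+p. v n p \<partial>?M)" for n
  proof -
    have "(\<integral>\<^sup>+\<omega>. liminf (\<lambda>k. J n k \<omega>) \<partial>law Z x) \<le> liminf (\<lambda>k. \<integral>\<^sup>+\<omega>. J n k \<omega> \<partial>law Z x)"
      by (intro nn_integral_liminf J)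
    also have "\<dots> \<le> limsup (\<lambda>k. \<integral>\<^sup>+\<omega>. J n k \<omega> \<partial>law Z x)"
      by (intro Liminf_le_Limsup) simp
    also have "\<dots> \<le> limsup (\<lambda>k. \<integral>\<^sup>+p. u n k p \<partial>?M)"
      by (intro Limsup_mono always_eventually allI EJ)
    also have "\<dots> \<le> (\<integral>\<^sup>+p. v n p \<partial>?M)"
      unfolding v_def using uw w_fin by (intro nn_integral_limsup[where w = w]) auto
    finally show ?thesis .
  qed
  have "(\<integral>\<^sup>+\<omega>. liminf (\<lambda>n. liminf (\<lambda>k. J n k \<omega>)) \<partial>law Z x) \<le> liminf (\<lambda>n. \<integral>\<^sup>+\<omega>. liminf (\<lambda>k. J n k \<omega>) \<partial>law Z x)"
    by (intro nn_integral_liminf) measurable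
  also have "\<dots> \<le> limsup (\<lambda>n. \<integral>\<^sup>+\<omega>. liminf (\<lambda>k. J n k \<omega>) \<partial>law Z x)"
    by (intro Liminf_le_Limsup) simp
  also have "\<dots> \<le> limsup (\<lambda>n. \<integral>\<^sup>+p. v n p \<partial>?M)"
    by (intro Limsup_mono always_eventually allI Jv)
  finally have "(\<integral>\<^sup>+\<omega>. liminf (\<lambda>n. liminf (\<lambda>k. J n k \<omega>)) \<partial>law Z x) = 0"
    using v0 by simp
  then have "AE \<omega> in law Z x. liminf (\<lambda>n. liminf (\<lambda>k. J n k \<omega>)) = 0"
    by (subst (asm) nn_integral_0_iff_AE) measurable
  then show ?thesis
  proof eventually_elim
    case (elim \<omega>)
    show ?case
    proof
      assume "\<exists>c>0. \<forall>n. \<forall>\<^sub>F k in sequentially. c \<le> (\<Sum>i<Suc k. indicator (A n (real i * (T / real (Suc k)))) \<omega> * ext0 \<psi> (path Z (s + real (Suc i) * (T / real (Suc k))) \<omega>))"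
      then obtain c where c: "0 < c" "\<And>n. \<forall>\<^sub>F k in sequentially. c \<le> J n k \<omega>"
        unfolding J_def by blast
      have "c \<le> liminf (\<lambda>k. J n k \<omega>)" for n
        by (rule Liminf_bounded[OF c(2)])
      then have "c \<le> liminf (\<lambda>n. liminf (\<lambda>k. J n k \<omega>))"
        by (rule Liminf_bounded[OF always_eventually, OF allI])
      then show False using c(1) elim by simp
    qed
  qed
qed

end

section \<open>Jumps of right continuous paths with left limits\<close>

text \<open>Jumps of at least a given positive size cannot accumulate at a point of
  \<open>D\<close>, since on each side of it the function is close to a one-sided limit. For each
  size they form a sparse set, which is countable.\<close>

lemma countable_left_discontinuities:
  fixes f :: "real \<Rightarrow> 'a::metric_space"
  assumes D: "open D" and rc: "\<And>t. t \<in> D \<Longrightarrow> (f \<longlongrightarrow> f t) (at_right t)"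
    and ll: "\<And>t. t \<in> D \<Longrightarrow> \<exists>l. (f \<longlongrightarrow> l) (at_left t)"
  shows "countable {t \<in> D. \<not> (f \<longlongrightarrow> f t) (at_left t)}"
proof -
  obtain l where l: "\<And>t. t \<in> D \<Longrightarrow> (f \<longlongrightarrow> l t) (at_left t)"
    using ll by metis
  define J where "J j = {t \<in> D. 1 / real (Suc j) \<le> dist (l t) (f t)}" for j
  have "J j sparse_in D" for j
    unfolding sparse_in_def
  proof (intro ballI exI[of _ D] conjI D notI)
    fix x assume x: "x \<in> D" and lim: "x islimpt J j"
    define \<epsilon> where "\<epsilon> = 1 / real (Suc j) / 3"
    have \<epsilon>: "0 < \<epsilon>" "3 * \<epsilon> = 1 / real (Suc j)"
      unfolding \<epsilon>_def by (simp_all del: of_nat_Suc)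
    obtain b where b: "b < x" "\<And>u. b < u \<Longrightarrow> u < x \<Longrightarrow> dist (f u) (l x) < \<epsilon>"
      using tendstoD[OF l[OF x] \<epsilon>(1)] unfolding eventually_at_left_field by blast
    obtain c where c: "x < c" "\<And>u. x < u \<Longrightarrow> u < c \<Longrightarrow> dist (f u) (f x) < \<epsilon>"
      using tendstoD[OF rc[OF x] \<epsilon>(1)] unfolding eventually_at_right_field by blast
    have "0 < min (x - b) (c - x)" using b c by simp
    then obtain t where t: "t \<in> J j" "t \<noteq> x" "\<bar>t - x\<bar> < min (x - b) (c - x)"
      using lim unfolding islimpt_approachable_real by blast
    \<comment> \<open>Here \<open>q\<close> is the one-sided limit at \<open>x\<close> on the side
      of \<open>t\<close>. Just before \<open>t\<close> and at \<open>t\<close> the function is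
      within \<open>\<epsilon>\<close>, a third of the minimal jump size, of \<open>q\<close>; this
      contradicts the jump at \<open>t\<close>.\<close>
    obtain a q where a: "a < t" "\<And>u. a < u \<Longrightarrow> u \<le> t \<Longrightarrow> dist q (f u) < \<epsilon>"
    proof (cases "t < x")
      case True
      then have "dist (l x) (f u) < \<epsilon>" if "b < u" "u \<le> t" for u
        using b(2)[of u] that by (simp add: dist_commute)
      moreover have "b < t" using t(3) by linarith
      ultimately show ?thesis using that by blast
    next
      case False
      then have "x < t" using t(2) by simp
      moreover have "dist (f x) (f u) < \<epsilon>" if "x < u" "u \<le> t" for u
        using c(2)[of u] that t(3) by (simp add: dist_commute)
      ultimately show ?thesis using that by blast
    qed
    have "\<forall>\<^sub>F u in at_left t. dist q (f u) \<le> \<epsilon>"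
      unfolding eventually_at_left_field using a by (intro exI[of _ a]) (auto intro: less_imp_le)
    then have "dist q (l t) \<le> \<epsilon>"
      using t(1) by (intro Lim_dist_ubound[OF _ l]) (auto simp: J_def)
    moreover have "dist q (f t) < \<epsilon>" using a by simp
    moreover have "dist (l t) (f t) \<le> dist q (l t) + dist q (f t)"
      by (rule dist_triangle3)
    ultimately have "dist (l t) (f t) < 3 * \<epsilon>" using \<epsilon>(1) by linarith
    then show False using t(1) \<epsilon>(2) by (simp add: J_def)
  qed
  then have "countable (D \<inter> J j)" for j
    by (intro sparse_imp_countable D)
  then have "countable (\<Union>j. D \<inter> J j)" by (intro countable_UN) auto
  moreover have "{t \<in> D. \<not> (f \<longlongrightarrow> f t) (at_left t)} \<subseteq> (\<Union>j. D \<inter> J j)"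
  proof safe
    fix t assume t: "t \<in> D" "\<not> (f \<longlongrightarrow> f t) (at_left t)"
    then have "l t \<noteq> f t" using l[OF t(1)] by auto
    then obtain j where "1 / real (Suc j) < dist (l t) (f t)"
      using nat_approx_posE[of "dist (l t) (f t)"] by auto
    then show "t \<in> (\<Union>j. D \<inter> J j)" using t(1) by (auto simp: J_def intro!: exI[of _ j] less_imp_le)
  qed
  ultimately show ?thesis by (rule countable_subset[rotated])
qed

lemma AE_lborel_dense:
  assumes "AE x in lborel. P x" "a < (b::real)"
  obtains x where "a < x" "x < b" "P x"
proof -
  have "\<not> (\<forall>x\<in>{a<..<b}. \<not> P x)"
  proof
    assume *: "\<forall>x\<in>{a<..<b}. \<not> P x"
    have "AE x in lborel. x \<notin> {a<..<b}"
      using assms(1) by eventually_elim (use * in blast)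
    then have "{a<..<b} \<in> null_sets lborel"
      by (subst AE_iff_null_sets) auto
    then have "emeasure lborel {a<..<b} = 0" by (rule null_setsD1)
    then show False using assms(2) by simp
  qed
  then show ?thesis using that by auto
qed

text \<open>One suitable point is chosen in each of the countably many intervals with rational
  ends.\<close>

lemma AE_lborel_countable_dense:
  assumes "AE s in lborel. 0 \<le> s \<longrightarrow> P s"
  shows "\<exists>D. countable D \<and> (\<forall>s\<in>D. 0 \<le> s \<and> P s) \<and> (\<forall>a b. 0 \<le> a \<longrightarrow> a < b \<longrightarrow> (\<exists>s\<in>D. a < s \<and> s < (b::real)))"
proof -
  define I where "I = {p \<in> \<rat> \<times> \<rat>. 0 \<le> fst p \<and> fst p < (snd p :: real)}"
  have "\<exists>s. fst p < s \<and> s < snd p \<and> P s" if "p \<in> I" for p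
  proof -
    obtain s where "fst p < s" "s < snd p" "0 \<le> s \<longrightarrow> P s"
      by (rule AE_lborel_dense[OF assms, of "fst p" "snd p"]) (use \<open>p \<in> I\<close> in \<open>auto simp: I_def\<close>)
    then show ?thesis using that by (auto simp: I_def)
  qed
  then obtain \<sigma> where \<sigma>: "\<And>p. p \<in> I \<Longrightarrow> fst p < \<sigma> p \<and> \<sigma> p < snd p \<and> P (\<sigma> p)" by metis
  have "countable I"
    unfolding I_def by (rule countable_subset[of _ "\<rat> \<times> \<rat>"]) (auto intro: countable_rat)
  moreover have "\<exists>s\<in>\<sigma> ` I. a < s \<and> s < b" if ab: "0 \<le> a" "a < b" for a b
  proof -
    obtain a' where a': "a' \<in> \<rat>" "a < a'" "a' < b" using Rats_dense_in_real[OF ab(2)] by blast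
    obtain b' where b': "b' \<in> \<rat>" "a' < b'" "b' < b" using Rats_dense_in_real[OF a'(3)] by blast
    have "(a', b') \<in> I" using a' b' ab by (simp add: I_def)
    with \<sigma>[OF this] show ?thesis using a' b' by (intro bexI[of _ "\<sigma> (a', b')"]) auto
  qed
  moreover have "0 \<le> \<sigma> p \<and> P (\<sigma> p)" if "p \<in> I" for p
  proof -
    have "0 \<le> fst p" using that by (simp add: I_def)
    then show ?thesis using \<sigma>[OF that] by simp
  qed
  ultimately show ?thesis
    by (intro exI[of _ "\<sigma> ` I"] conjI countable_image allI impI) auto
qed

text \<open>The point \<open>z\<close> excludes the empty set, for which \<open>infdist\<close> is
  0.\<close>

lemma infdist_ge_ball:
  assumes "\<And>q. q \<in> ball l \<epsilon> \<Longrightarrow> \<psi> q = (0::real)" "\<psi> z \<noteq> 0"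
  shows "\<epsilon> \<le> infdist l {z. \<psi> z \<noteq> 0}"
proof -
  have "\<epsilon> \<le> (INF a\<in>{z. \<psi> z \<noteq> 0}. dist l a)"
    using assms by (intro cINF_greatest) (auto simp: not_less[symmetric])
  then show ?thesis using assms(2) by (subst infdist_notempty) auto
qed

context metric_right_process
begin

section \<open>Paths along grids that approach a time from below\<close>

definition cadlag_path :: "'w \<Rightarrow> bool" where
  "cadlag_path \<omega> \<longleftrightarrow> \<omega> \<in> space (events Z) \<and> right_continuous_path Z \<omega> \<and>
     (\<forall>t>0. ereal t < lifetime Z \<omega> \<longrightarrow> (\<exists>l\<in>S. ((\<lambda>s. pos s \<omega>) \<longlongrightarrow> l) (at_left t)))"

lemma AE_cadlag_path: "cadlag S Z \<Longrightarrow> x \<in> S \<Longrightarrow> AE \<omega> in law Z x. cadlag_path \<omega>"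
  unfolding cadlag_def cadlag_path_def using AE_space_law[of x] by auto

lemma path_eq_Some_the:
  assumes "cadlag_path \<omega>" "0 \<le> t" "ereal t < lifetime Z \<omega>"
  shows "path Z t \<omega> = Some (pos t \<omega>)" "pos t \<omega> \<in> S"
  using alive_before_lifetime[OF assms(2,3)] path_in[OF assms(2), of \<omega>] assms(1)
  by (auto simp: cadlag_path_def)

lemma path_right_limit:
  assumes "cadlag_path \<omega>" "0 \<le> t" "ereal t < lifetime Z \<omega>"
  shows "((\<lambda>s. pos s \<omega>) \<longlongrightarrow> pos t \<omega>) (at_right t)"
  using right_continuous_pathD(2)[OF _ assms(2) path_eq_Some_the(1)[OF assms] filterlim_ident] assms(1)
  by (simp add: cadlag_path_def)

lemma path_left_limit:
  assumes "cadlag_path \<omega>" "0 < t" "ereal t < lifetime Z \<omega>"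
  obtains l where "l \<in> S" "((\<lambda>s. pos s \<omega>) \<longlongrightarrow> l) (at_left t)"
  using assms unfolding cadlag_path_def by blast

text \<open>Before its lifetime a path has only countably many left discontinuities, and they remain
  countable after the shift by \<open>s\<close>.\<close>

lemma AE_path_left_continuous:
  assumes "cadlag_path \<omega>" and s: "0 \<le> s"
  shows "AE r in lborel. 0 < r \<longrightarrow> ereal (s + r) < lifetime Z \<omega> \<longrightarrow>
    ((\<lambda>u. pos u \<omega>) \<longlongrightarrow> pos (s + r) \<omega>) (at_left (s + r))"
proof -
  define D where "D = {t. 0 < t \<and> ereal t < lifetime Z \<omega>}"
  have "open D"
  proof (cases "lifetime Z \<omega>")
    case (real r)
    then have "D = {0<..<r}" by (auto simp: D_def)
    then show ?thesis by simp
  next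
    case PInf
    then have "D = {0<..}" by (auto simp: D_def)
    then show ?thesis by simp
  next
    case MInf
    then have "D = {}" by (auto simp: D_def)
    then show ?thesis by simp
  qed
  then have c: "countable {t \<in> D. \<not> ((\<lambda>u. pos u \<omega>) \<longlongrightarrow> pos t \<omega>) (at_left t)}" (is "countable ?J")
  proof (rule countable_left_discontinuities)
    fix t assume "t \<in> D"
    then have t: "0 < t" "ereal t < lifetime Z \<omega>" by (auto simp: D_def)
    show "((\<lambda>u. pos u \<omega>) \<longlongrightarrow> pos t \<omega>) (at_right t)"
      using t by (intro path_right_limit assms(1)) auto
    show "\<exists>l. ((\<lambda>u. pos u \<omega>) \<longlongrightarrow> l) (at_left t)"
      using path_left_limit[OF assms(1) t] by blast
  qed
  then have "countable ((\<lambda>t. t - s) ` ?J)" by simp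
  then have "AE r in lborel. r \<notin> (\<lambda>t. t - s) ` ?J"
    by (intro AE_not_in countable_imp_null_set_lborel)
  then show ?thesis
  proof eventually_elim
    case (elim r)
    show ?case
    proof (intro impI, rule ccontr)
      assume "0 < r" "ereal (s + r) < lifetime Z \<omega>"
        "\<not> ((\<lambda>u. pos u \<omega>) \<longlongrightarrow> pos (s + r) \<omega>) (at_left (s + r))"
      then have "s + r \<in> ?J" using s by (simp add: D_def)
      then have "r \<in> (\<lambda>t. t - s) ` ?J" by (intro image_eqI[of _ _ "s + r"]) auto
      with elim show False ..
    qed
  qed
qed

lemma grid_below_le: "0 < T \<Longrightarrow> 0 \<le> r \<Longrightarrow> grid_below T k r \<le> r"
proof -
  assume T: "0 < T" and r: "0 \<le> r"
  define h where "h = T / real (Suc k)"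
  have h: "0 < h" using T by (simp add: h_def)
  have "real (nat \<lfloor>r / h\<rfloor>) \<le> r / h" using r h by simp
  then show ?thesis using h unfolding grid_below_def h_def[symmetric] by (simp add: pos_le_divide_eq)
qed

lemma grid_below_greater: "0 < T \<Longrightarrow> r - T / real (Suc k) < grid_below T k r"
proof -
  assume T: "0 < T"
  define h where "h = T / real (Suc k)"
  have h: "0 < h" using T by (simp add: h_def)
  have "r / h < real (nat \<lfloor>r / h\<rfloor>) + 1" by linarith
  then have "r < (real (nat \<lfloor>r / h\<rfloor>) + 1) * h" using h by (simp add: pos_divide_less_eq)
  then show ?thesis using h unfolding grid_below_def h_def[symmetric] by (simp add: algebra_simps)
qed

lemma grid_below_tendsto:
  assumes T: "0 < T" and r: "0 \<le> r"
  shows "(\<lambda>k. grid_below T k r) \<longlonglongrightarrow> r"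
proof (rule tendsto_sandwich)
  have "(\<lambda>k. T * inverse (real (Suc k))) \<longlonglongrightarrow> T * 0"
    by (intro tendsto_intros LIMSEQ_inverse_real_of_nat)
  then have "(\<lambda>k. r - T * inverse (real (Suc k))) \<longlonglongrightarrow> r - T * 0"
    by (rule tendsto_diff[OF tendsto_const])
  then show "(\<lambda>k. r - T / real (Suc k)) \<longlonglongrightarrow> r" by (simp add: divide_inverse)
  show "\<forall>\<^sub>F k in sequentially. r - T / real (Suc k) \<le> grid_below T k r"
    using grid_below_greater[OF T, of r] by (intro always_eventually allI less_imp_le)
  show "\<forall>\<^sub>F k in sequentially. grid_below T k r \<le> r"
    using grid_below_le[OF T r] by simp
qed simp

lemma path_grid_below_tendsto:
  assumes T: "0 < T" and r: "0 \<le> r"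
    and lc: "((\<lambda>u. pos u \<omega>) \<longlongrightarrow> pos (s + r) \<omega>) (at_left (s + r))"
  shows "(\<lambda>k. pos (s + grid_below T k r) \<omega>) \<longlonglongrightarrow> pos (s + r) \<omega>"
proof (rule tendstoI)
  fix e :: real assume "0 < e"
  then obtain b where b: "b < s + r" "\<And>u. b < u \<Longrightarrow> u < s + r \<Longrightarrow> dist (pos u \<omega>) (pos (s + r) \<omega>) < e"
    using tendstoD[OF lc] unfolding eventually_at_left_field by blast
  have "\<forall>\<^sub>F k in sequentially. b - s < grid_below T k r"
    using b(1) by (intro order_tendstoD(1)[OF grid_below_tendsto[OF T r]]) simp
  then show "\<forall>\<^sub>F k in sequentially. dist (pos (s + grid_below T k r) \<omega>) (pos (s + r) \<omega>) < e"
  proof eventually_elim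
    case (elim k)
    show ?case
    proof (cases "grid_below T k r = r")
      case True then show ?thesis using \<open>0 < e\<close> by simp
    next
      case False
      then have "grid_below T k r < r" using grid_below_le[OF T r, of k] by simp
      then show ?thesis using b(2)[of "s + grid_below T k r"] elim by simp
    qed
  qed
qed

lemma eventually_left_path_less:
  assumes "0 \<le> s" "((\<lambda>u. pos u \<omega>) \<longlongrightarrow> l) (at_left (s + r))" "continuous_on UNIV f" "f l < (c::real)"
  shows "\<exists>b<r. \<forall>r'. b < r' \<longrightarrow> r' < r \<longrightarrow> f (pos (s + r') \<omega>) < c"
proof -
  have "isCont f l" using assms(3) by (simp add: continuous_on_eq_continuous_at)
  from isCont_tendsto_compose[OF this assms(2)]
  have "\<forall>\<^sub>F u in at_left (s + r). f (pos u \<omega>) < c"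
    using assms(4) by (rule order_tendstoD(2))
  then obtain b where "b < s + r" "\<And>u. b < u \<Longrightarrow> u < s + r \<Longrightarrow> f (pos u \<omega>) < c"
    unfolding eventually_at_left_field by blast
  then show ?thesis by (intro exI[of _ "b - s"]) auto
qed

lemma eventually_left_path_greater:
  assumes "0 \<le> s" "((\<lambda>u. pos u \<omega>) \<longlongrightarrow> l) (at_left (s + r))" "continuous_on UNIV f" "(c::real) < f l"
  shows "\<exists>b<r. \<forall>r'. b < r' \<longrightarrow> r' < r \<longrightarrow> c < f (pos (s + r') \<omega>)"
proof -
  have "continuous_on UNIV (\<lambda>q. - f q)" using assms(3) by (intro continuous_intros)
  from eventually_left_path_less[OF assms(1,2) this, of "- c"] assms(4) show ?thesis by simp
qed

text \<open>By left continuity the states at the grid times below \<open>r\<close> converge to the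
  state at \<open>r\<close>, which lies in the open complement.\<close>

lemma grid_leaves_closed:
  assumes \<omega>: "cadlag_path \<omega>" and s: "0 \<le> s" and T: "0 < T" and r: "0 < r"
    and lc: "((\<lambda>u. pos u \<omega>) \<longlongrightarrow> pos (s + r) \<omega>) (at_left (s + r))"
    and f: "continuous_on UNIV f" "f (pos (s + r) \<omega>) < (c::real)"
  shows "\<forall>\<^sub>F k in sequentially. path Z (s + grid_below T k r) \<omega> \<notin> Some ` {q. c \<le> f q}"
proof -
  have "isCont f (pos (s + r) \<omega>)" using f(1) by (simp add: continuous_on_eq_continuous_at)
  from isCont_tendsto_compose[OF this path_grid_below_tendsto[OF T less_imp_le[OF r] lc]]
  have "\<forall>\<^sub>F k in sequentially. f (pos (s + grid_below T k r) \<omega>) < c"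
    using f(2) by (rule order_tendstoD(2))
  then show ?thesis by eventually_elim auto
qed

text \<open>On every fine grid the cell around \<open>r\<close> has its left end where the events
  hold and its right end where, by right continuity, \<open>\<psi>\<close> is still above half its
  value at the landing point. That half is the constant, the same for all \<open>n\<close>.\<close>

lemma jump_detected:
  assumes \<omega>: "cadlag_path \<omega>" and s: "0 \<le> s" and r: "0 < r" "r < T" and alive: "ereal (s + r) < lifetime Z \<omega>"
    and \<psi>: "continuous_on UNIV \<psi>" "0 < \<psi> (pos (s + r) \<omega>)"
    and A: "\<And>n. \<exists>b<r. \<forall>r'. 0 \<le> r' \<longrightarrow> b < r' \<longrightarrow> r' < r \<longrightarrow> \<omega> \<in> A n r'"
  shows "\<exists>c>0. \<forall>n. \<forall>\<^sub>F k in sequentially. c \<le> (\<Sum>i<Suc k. indicator (A n (real i * (T / real (Suc k)))) \<omega> *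
    ext0 (\<lambda>q. ennreal (\<psi> q)) (path Z (s + real (Suc i) * (T / real (Suc k))) \<omega>))"
proof (intro exI conjI allI)
  define z where "z = pos (s + r) \<omega>"
  have sr: "0 \<le> s + r" using s r by simp
  have T: "0 < T" using r by simp
  show "0 < ennreal (\<psi> z / 2)" using \<psi>(2) by (simp add: z_def)
  fix n
  obtain b where b: "b < r" "\<And>r'. 0 \<le> r' \<Longrightarrow> b < r' \<Longrightarrow> r' < r \<Longrightarrow> \<omega> \<in> A n r'"
    using A by blast
  have "((\<lambda>u. \<psi> (pos u \<omega>)) \<longlongrightarrow> \<psi> z) (at_right (s + r))"
  proof -
    have "isCont \<psi> z" using \<psi>(1) by (simp add: continuous_on_eq_continuous_at)
    from isCont_tendsto_compose[OF this path_right_limit[OF \<omega> sr alive, folded z_def]] show ?thesis .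
  qed
  then have "\<forall>\<^sub>F u in at_right (s + r). \<psi> z / 2 < \<psi> (pos u \<omega>)"
    using \<psi>(2) by (intro order_tendstoD) (auto simp: z_def)
  moreover have "\<forall>\<^sub>F u in at_right (s + r). path Z u \<omega> \<noteq> None"
    using right_continuous_pathD(1)[OF _ sr path_eq_Some_the(1)[OF \<omega> sr alive] filterlim_ident] \<omega>
    by (simp add: cadlag_path_def)
  ultimately have "\<forall>\<^sub>F u in at_right (s + r). path Z u \<omega> \<noteq> None \<and> \<psi> z / 2 < \<psi> (pos u \<omega>)"
    by eventually_elim simp
  then obtain c where c: "s + r < c" "\<And>u. s + r < u \<Longrightarrow> u < c \<Longrightarrow> path Z u \<omega> \<noteq> None \<and> \<psi> z / 2 < \<psi> (pos u \<omega>)"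
    unfolding eventually_at_right_field by blast
  have c': "path Z u \<omega> \<noteq> None \<and> \<psi> z / 2 < \<psi> (pos u \<omega>)" if "s + r \<le> u" "u < c" for u
    using c(2)[of u] that path_eq_Some_the(1)[OF \<omega> sr alive] \<psi>(2) by (cases "u = s + r") (auto simp: z_def)
  have "(\<lambda>k. T * inverse (real (Suc k))) \<longlonglongrightarrow> T * 0"
    by (intro tendsto_intros LIMSEQ_inverse_real_of_nat)
  then have "\<forall>\<^sub>F k in sequentially. T * inverse (real (Suc k)) < min (r - b) (c - (s + r))"
    using b c by (intro order_tendstoD) auto
  then show "\<forall>\<^sub>F k in sequentially. ennreal (\<psi> z / 2) \<le> (\<Sum>i<Suc k. indicator (A n (real i * (T / real (Suc k)))) \<omega> *
    ext0 (\<lambda>q. ennreal (\<psi> q)) (path Z (s + real (Suc i) * (T / real (Suc k))) \<omega>))"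
  proof eventually_elim
    case (elim k)
    define h where "h = T / real (Suc k)"
    have h: "0 < h" "h < r - b" "h < c - (s + r)" "real (Suc k) * h = T"
      using elim T by (auto simp: h_def divide_inverse)
    \<comment> \<open>Chosen so that \<open>i * h < r\<close> and \<open>r \<le> Suc i * h\<close>:
      strict on the left because the events are assumed only strictly before \<open>r\<close>, while
      at \<open>r\<close> itself the path has already landed.\<close>
    define i where "i = nat (\<lceil>r / h\<rceil> - 1)"
    have "0 < r / h" using r h by simp
    then have "1 \<le> \<lceil>r / h\<rceil>" by linarith
    then have i: "real i < r / h" "r / h \<le> real i + 1" unfolding i_def by linarith+
    then have i': "real i * h < r" "r \<le> real (Suc i) * h"
      using h(1) by (auto simp: pos_less_divide_eq pos_divide_le_eq algebra_simps)
    have "real i * h < real (Suc k) * h" using i'(1) r(2) h(4) by linarith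
    then have ik: "i < Suc k" using h(1) by simp
    have SucI: "real (Suc i) * h = real i * h + h" by (simp add: algebra_simps)
    have "\<omega> \<in> A n (real i * h)"
      using i' h SucI by (intro b(2)) auto
    moreover have "path Z (s + real (Suc i) * h) \<omega> \<noteq> None \<and> \<psi> z / 2 < \<psi> (pos (s + real (Suc i) * h) \<omega>)"
      using i' h SucI by (intro c') linarith+
    ultimately have "ennreal (\<psi> z / 2) \<le> indicator (A n (real i * h)) \<omega> * ext0 (\<lambda>q. ennreal (\<psi> q)) (path Z (s + real (Suc i) * h) \<omega>)"
      by (auto intro!: ennreal_leI)
    also have "\<dots> \<le> (\<Sum>i<Suc k. indicator (A n (real i * h)) \<omega> * ext0 (\<lambda>q. ennreal (\<psi> q)) (path Z (s + real (Suc i) * h) \<omega>))"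
      using ik by (intro member_le_sum[where f = "\<lambda>i. indicator (A n (real i * h)) \<omega> * ext0 (\<lambda>q. ennreal (\<psi> q)) (path Z (s + real (Suc i) * h) \<omega>)"]) auto
    finally show ?case unfolding h_def .
  qed
qed

text \<open>Translation invariance of Lebesgue measure: the null set of bad times is merely shifted
  by \<open>c\<close>, so countably many offsets still leave almost every start good.\<close>

lemma AE_good_start_times:
  assumes f: "f \<in> borel_measurable BS" and x: "x \<in> S" and 0: "AE r in lborel. 0 \<le> r \<longrightarrow> transition r f x = 0"
    and c: "0 \<le> c"
  shows "AE s in lborel. 0 \<le> s \<longrightarrow> transition (s + c) f x = 0"
proof -
  define F where "F r = transition (max 0 r) f x * indicator {0..} r" for r :: real
  have [measurable]: "(\<lambda>r. transition (max 0 r) f x) \<in> borel_measurable borel"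
    by (rule transition_time_measurable[OF f x])
  have F [measurable]: "F \<in> borel_measurable borel" unfolding F_def by measurable
  have "(\<integral>\<^sup>+r. F r \<partial>lborel) = (\<integral>\<^sup>+(r::real). 0 \<partial>lborel)"
    using 0 by (intro nn_integral_cong_AE) (auto simp: F_def indicator_def elim!: eventually_mono)
  then have "(\<integral>\<^sup>+r. F (c + 1 * r) \<partial>lborel) = 0"
    using nn_integral_real_affine[OF F, of 1 c] by simp
  then have "AE s in lborel. F (c + 1 * s) = 0"
    by (subst (asm) nn_integral_0_iff_AE) measurable
  then show ?thesis
  proof eventually_elim
    case (elim s)
    show ?case
    proof
      assume "0 \<le> s"
      then have "0 \<le> s + c" using c by simp
      then show "transition (s + c) f x = 0" using elim by (simp add: F_def add.commute)
    qed
  qed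
qed

end

section \<open>Jumps of solutions of a martingale problem\<close>

text \<open>The open set is given by a function \<open>\<delta>\<close> that is positive exactly there.\<close>

locale separating_martingale_problem = metric_right_process S Z
  for S :: "'s::metric_space set" and Z :: "('w, 's) process" +
  fixes m :: "'s measure" and \<alpha> :: real and \<T> :: "('s \<Rightarrow> real) set"
    and L :: "('s \<Rightarrow> real) \<Rightarrow> 's \<Rightarrow> real" and \<delta> :: "'s \<Rightarrow> real"
  assumes cadlag: "cadlag S Z"
    and sets_m: "sets m = sets (restrict_space borel S)"
    and \<alpha>_pos: "0 < \<alpha>"
    and null_resolvent: "\<And>N. N \<in> null_sets m \<Longrightarrow> AE x in m. resolvent Z \<alpha> (indicator N) x = 0"
    and resolvent_finite: "\<And>\<psi>. \<psi> \<in> \<T> \<Longrightarrow> AE x in m. resolvent Z \<alpha> (\<lambda>y. ennreal \<bar>L \<psi> y\<bar>) x < \<top>"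
    and martingale_AE: "\<And>\<psi>. \<psi> \<in> \<T> \<Longrightarrow> AE x in m. solves_at \<psi> (L \<psi>) x"
    and countable_tests: "countable \<T>"
    and L_borel: "\<And>\<psi>. \<psi> \<in> \<T> \<Longrightarrow> L \<psi> \<in> borel_measurable (restrict_space borel S)"
    and test_continuous: "\<And>\<psi>. \<psi> \<in> \<T> \<Longrightarrow> continuous_on UNIV \<psi>"
    and test_bounds: "\<And>\<psi> q. \<psi> \<in> \<T> \<Longrightarrow> 0 \<le> \<psi> q" "\<And>\<psi> q. \<psi> \<in> \<T> \<Longrightarrow> \<psi> q \<le> 1"
    and separation: "\<And>y z. y \<in> S \<Longrightarrow> z \<in> S \<Longrightarrow> y \<noteq> z \<Longrightarrow>
        \<exists>\<psi>\<in>\<T>. 0 < \<psi> z \<and> (\<exists>\<epsilon>>0. \<forall>q\<in>ball y \<epsilon>. \<psi> q = 0)"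
    and \<delta>_continuous: "continuous_on UNIV \<delta>" and \<delta>_nonneg: "\<And>q. 0 \<le> \<delta> q"
    and locality: "\<And>\<psi> q \<epsilon>. \<psi> \<in> \<T> \<Longrightarrow> q \<in> S \<Longrightarrow> 0 < \<delta> q \<Longrightarrow> 0 < \<epsilon> \<Longrightarrow>
        (\<And>q'. q' \<in> ball q \<epsilon> \<Longrightarrow> \<psi> q' = 0) \<Longrightarrow> L \<psi> q = 0"
begin

lemma test_borel:
  assumes "\<psi> \<in> \<T>"
  shows "\<psi> \<in> borel_measurable BS"
  using borel_measurable_continuous_onI[OF test_continuous[OF assms]] by (rule measurable_restrict_space1)

definition gen :: "('s \<Rightarrow> real) \<Rightarrow> 's \<Rightarrow> ennreal" where
  "gen \<psi> q = ennreal \<bar>L \<psi> q\<bar>"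

lemma gen_borel: "\<psi> \<in> \<T> \<Longrightarrow> gen \<psi> \<in> borel_measurable BS"
  using L_borel[of \<psi>] unfolding gen_def by measurable

text \<open>Closed in \<open>S\<close>, so that leaving it is visible on fine grids, and with a
  uniform margin \<open>1 / Suc j\<close> on which \<open>\<psi>\<close> vanishes, as
  \<open>locality\<close> requires.\<close>

definition away :: "('s \<Rightarrow> real) \<Rightarrow> nat \<Rightarrow> 's set" where
  "away \<psi> j = {q \<in> S. 1 / real (Suc j) \<le> infdist q {z. \<psi> z \<noteq> 0}}"

lemma closed_in_BS: "closed F \<Longrightarrow> S \<inter> F \<in> sets BS"
  by (auto simp: sets_restrict_space)

lemma away_BS: "away \<psi> j \<in> sets BS"
proof -
  have "closed {q. 1 / real (Suc j) \<le> infdist q {z. \<psi> z \<noteq> 0}}"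
    by (intro closed_Collect_le continuous_intros)
  from closed_in_BS[OF this] show ?thesis by (simp add: away_def Collect_conj_eq)
qed

lemma level_BS: "{q \<in> S. c \<le> \<delta> q} \<in> sets BS"
proof -
  have "closed {q. c \<le> \<delta> q}"
    using \<delta>_continuous by (intro closed_Collect_le) auto
  from closed_in_BS[OF this] show ?thesis by (simp add: Collect_conj_eq)
qed

lemma zero_near:
  assumes "1 / real (Suc j) \<le> infdist q {z. \<psi> z \<noteq> 0}" "q' \<in> ball q (1 / real (Suc j))"
  shows "\<psi> q' = 0"
proof (rule ccontr)
  assume "\<psi> q' \<noteq> 0"
  then have "infdist q {z. \<psi> z \<noteq> 0} \<le> dist q q'" by (intro infdist_le) simp
  with assms show False by simp
qed

lemma away_zero: "q \<in> away \<psi> j \<Longrightarrow> \<psi> q = 0"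
  using zero_near[of j q \<psi> q] by (simp add: away_def)

lemma alive_lifetime:
  assumes "cadlag_path \<omega>" "0 \<le> t" "path Z t \<omega> \<noteq> None"
  shows "ereal t < lifetime Z \<omega>"
proof (rule ccontr)
  assume "\<not> ereal t < lifetime Z \<omega>"
  then have "lifetime Z \<omega> < ereal t \<or> lifetime Z \<omega> = ereal t" by auto
  then show False
    using dead_after_lifetime[of \<omega> t] dead_at_lifetime[of \<omega> t] assms by (auto simp: cadlag_path_def)
qed

text \<open>Starting the grids at \<open>s\<close>, none of their points hits \<open>N0\<close>.\<close>

definition admissible :: "'s set \<Rightarrow> 's \<Rightarrow> real \<Rightarrow> bool" where
  "admissible N0 x s \<longleftrightarrow> 0 \<le> s \<and>
     (\<forall>T i k :: nat. transition (s + real i * (real (Suc T) / real (Suc k))) (indicator N0) x = 0)"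

text \<open>Localises by the state at time \<open>s\<close>: on this event the integral of
  \<open>gen \<psi>\<close> along the path over a finite horizon has finite mean. Being known at
  time \<open>s\<close>, the event can be intersected with all later ones.\<close>

definition bounded_start :: "('s \<Rightarrow> real) \<Rightarrow> real \<Rightarrow> nat \<Rightarrow> 'w set" where
  "bounded_start \<psi> s K = {\<omega> \<in> space (events Z). path Z s \<omega> \<in> Some ` {q \<in> S. resolvent Z \<alpha> (gen \<psi>) q \<le> of_nat K}}"

text \<open>A jump from \<open>l\<close>, away from the support of \<open>\<psi>\<close>, into \<open>\<psi> > 0\<close>.\<close>

definition jump_at :: "('s \<Rightarrow> real) \<Rightarrow> real \<Rightarrow> nat \<Rightarrow> nat \<Rightarrow> nat \<Rightarrow> real \<Rightarrow> 's \<Rightarrow> 'w \<Rightarrow> bool" where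
  "jump_at \<psi> s T K j r l \<omega> \<longleftrightarrow> 0 < r \<and> r < real (Suc T) \<and> ereal (s + r) < lifetime Z \<omega> \<and>
     \<omega> \<in> bounded_start \<psi> s K \<and> ((\<lambda>u. pos u \<omega>) \<longlongrightarrow> l) (at_left (s + r)) \<and>
     1 / real (Suc j) < infdist l {z. \<psi> z \<noteq> 0} \<and> 0 < \<psi> (pos (s + r) \<omega>)"

text \<open>A uniform bound rather than mere positivity, so that left limits at times up to and
  including \<open>s + r\<close> are kept off the boundary as well.\<close>

definition stays_in :: "real \<Rightarrow> real \<Rightarrow> 'w \<Rightarrow> bool" where
  "stays_in s r \<omega> \<longleftrightarrow> (\<exists>\<eta>::nat. \<forall>u. 0 \<le> u \<longrightarrow> u < r \<longrightarrow> 1 / real (Suc \<eta>) \<le> \<delta> (pos (s + u) \<omega>))"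

section \<open>Excluding jumps along grids that avoid an exceptional null set\<close>

context
  fixes N0 :: "'s set"
  assumes N0: "N0 \<in> null_sets m"
    and mart: "\<And>y \<psi>. y \<in> S - N0 \<Longrightarrow> \<psi> \<in> \<T> \<Longrightarrow> solves_at \<psi> (L \<psi>) y"
    and fin: "\<And>y \<psi>. y \<in> S - N0 \<Longrightarrow> \<psi> \<in> \<T> \<Longrightarrow> resolvent Z \<alpha> (gen \<psi>) y < \<top>"
begin

lemma N0_BS: "N0 \<in> sets BS"
  using N0 sets_m by auto

lemma test_transition_bound:
  assumes "y \<in> S - N0" "\<psi> \<in> \<T>" "\<psi> y = 0" "0 \<le> h"
  shows "transition h (\<lambda>q. ennreal (\<psi> q)) y \<le> potential (indicator {0..h}) (gen \<psi>) y"
  unfolding gen_def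
  using assms test_bounds[OF assms(2)] mart[OF assms(1,2)]
  by (intro martingale_transition_bound[where c = 1] test_borel L_borel) auto

lemma admissible_AE:
  assumes x: "x \<in> S" and s: "admissible N0 x s"
  shows "AE \<omega> in law Z x. path Z (s + real i * (real (Suc T) / real (Suc k))) \<omega> \<notin> Some ` N0"
proof -
  have t: "0 \<le> s + real i * (real (Suc T) / real (Suc k))"
    using s by (simp add: admissible_def)
  have N: "(indicator N0 :: 's \<Rightarrow> ennreal) \<in> borel_measurable BS" using N0_BS by simp
  have "(\<integral>\<^sup>+\<omega>. ext0 (indicator N0) (path Z (s + real i * (real (Suc T) / real (Suc k))) \<omega>) \<partial>law Z x) = 0"
    using s by (simp add: admissible_def transition_def)
  then have "AE \<omega> in law Z x. ext0 (indicator N0) (path Z (s + real i * (real (Suc T) / real (Suc k))) \<omega>) = (0::ennreal)"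
    using nn_integral_0_iff_AE[OF measurable_path_ext0[OF t x N]] by blast
  then show ?thesis
    by eventually_elim (auto simp: indicator_def)
qed

lemma bounded_start_filt:
  assumes "\<psi> \<in> \<T>" "0 \<le> s"
  shows "bounded_start \<psi> s K \<in> sets (filt Z s)"
proof -
  have "resolvent Z \<alpha> (gen \<psi>) \<in> borel_measurable BS"
    by (rule resolvent_borel[OF \<alpha>_pos gen_borel[OF assms(1)]])
  from measurable_sets[OF this, of "{..of_nat K}"]
  have "{q \<in> S. resolvent Z \<alpha> (gen \<psi>) q \<le> of_nat K} \<in> sets BS"
    by (simp add: vimage_def Int_def space_BS conj_commute)
  then show ?thesis unfolding bounded_start_def by (rule adapted[OF assms(2)])
qed

text \<open>Up to the horizon \<open>T\<close> the weight 1 is at most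
  \<open>exp (\<alpha> * T)\<close> times the exponential weight. The Markov property at
  \<open>s\<close> turns the exponential integral into the resolvent at the state at time
  \<open>s\<close>, which is at most \<open>K\<close> on the event.\<close>

lemma bounded_start_finite:
  assumes \<psi>: "\<psi> \<in> \<T>" and s: "0 \<le> s" and x: "x \<in> S"
  shows "(\<integral>\<^sup>+\<omega>\<in>bounded_start \<psi> s K. (\<integral>\<^sup>+r\<in>{0..}. indicator {0..<T} r * ext0 (gen \<psi>) (path Z (s + r) \<omega>) \<partial>lborel) \<partial>law Z x) < \<infinity>"
proof -
  interpret prob_space "law Z x" using prob_law[OF x] .
  let ?\<Lambda> = "bounded_start \<psi> s K" and ?w = "\<lambda>r. ennreal (exp (- \<alpha> * r))"
  note g = gen_borel[OF \<psi>]
  have le: "indicator {0..<T} r * c \<le> ennreal (exp (\<alpha> * T)) * (?w r * c)" for r and c :: ennreal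
  proof (cases "r \<in> {0..<T}")
    case True
    have "1 \<le> exp (\<alpha> * T) * exp (- \<alpha> * r)"
      using True \<alpha>_pos by (simp add: exp_add[symmetric] mult_left_mono)
    then have "(1::ennreal) \<le> ennreal (exp (\<alpha> * T)) * ?w r"
      by (simp add: ennreal_mult[symmetric])
    from mult_right_mono[OF this, of c] show ?thesis using True by (simp add: mult.assoc)
  qed simp
  have "(\<integral>\<^sup>+\<omega>\<in>?\<Lambda>. (\<integral>\<^sup>+r\<in>{0..}. indicator {0..<T} r * ext0 (gen \<psi>) (path Z (s + r) \<omega>) \<partial>lborel) \<partial>law Z x) \<le>
    (\<integral>\<^sup>+\<omega>. ennreal (exp (\<alpha> * T)) * ((\<integral>\<^sup>+r\<in>{0..}. ?w r * ext0 (gen \<psi>) (path Z (s + r) \<omega>) \<partial>lborel) * indicator ?\<Lambda> \<omega>) \<partial>law Z x)"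
  proof (rule nn_integral_mono_AE)
    have "AE \<omega> in law Z x. (\<lambda>r. ?w r * ext0 (gen \<psi>) (path Z (s + r) \<omega>) * indicator {0..} r) \<in> borel_measurable lborel"
      by (rule path_occupation_time_measurable[OF g x s]) simp
    then show "AE \<omega> in law Z x. (\<integral>\<^sup>+r\<in>{0..}. indicator {0..<T} r * ext0 (gen \<psi>) (path Z (s + r) \<omega>) \<partial>lborel) * indicator ?\<Lambda> \<omega> \<le>
      ennreal (exp (\<alpha> * T)) * ((\<integral>\<^sup>+r\<in>{0..}. ?w r * ext0 (gen \<psi>) (path Z (s + r) \<omega>) \<partial>lborel) * indicator ?\<Lambda> \<omega>)"
    proof eventually_elim
      case (elim \<omega>)
      have "(\<integral>\<^sup>+r\<in>{0..}. indicator {0..<T} r * ext0 (gen \<psi>) (path Z (s + r) \<omega>) \<partial>lborel) \<le>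
        (\<integral>\<^sup>+r. ennreal (exp (\<alpha> * T)) * (?w r * ext0 (gen \<psi>) (path Z (s + r) \<omega>) * indicator {0..} r) \<partial>lborel)"
        using le by (intro nn_integral_mono) (auto simp: indicator_def mult.assoc)
      also have "\<dots> = ennreal (exp (\<alpha> * T)) * (\<integral>\<^sup>+r\<in>{0..}. ?w r * ext0 (gen \<psi>) (path Z (s + r) \<omega>) \<partial>lborel)"
        by (rule nn_integral_cmult[OF elim])
      finally show ?case
        by (simp add: mult.assoc[symmetric] mult_right_mono)
    qed
  qed
  also have "\<dots> = ennreal (exp (\<alpha> * T)) * (\<integral>\<^sup>+\<omega>\<in>?\<Lambda>. (\<integral>\<^sup>+r\<in>{0..}. ?w r * ext0 (gen \<psi>) (path Z (s + r) \<omega>) \<partial>lborel) \<partial>law Z x)"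
  proof -
    have \<Lambda>: "?\<Lambda> \<in> sets (law Z x)"
      using bounded_start_filt[OF \<psi> s, of K] sets_filt_subset[OF s] sets_law[OF x] by auto
    show ?thesis
      using nn_integral_cmult[OF path_occupation_Fubini(1)[OF g x s _ \<Lambda>, of ?w]]
      by (simp add: nn_integral_completion)
  qed
  finally have le_w: "(\<integral>\<^sup>+\<omega>\<in>?\<Lambda>. (\<integral>\<^sup>+r\<in>{0..}. indicator {0..<T} r * ext0 (gen \<psi>) (path Z (s + r) \<omega>) \<partial>lborel) \<partial>law Z x) \<le>
    ennreal (exp (\<alpha> * T)) * (\<integral>\<^sup>+\<omega>\<in>?\<Lambda>. (\<integral>\<^sup>+r\<in>{0..}. ?w r * ext0 (gen \<psi>) (path Z (s + r) \<omega>) \<partial>lborel) \<partial>law Z x)" .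
  have "(\<integral>\<^sup>+\<omega>\<in>?\<Lambda>. (\<integral>\<^sup>+r\<in>{0..}. ?w r * ext0 (gen \<psi>) (path Z (s + r) \<omega>) \<partial>lborel) \<partial>law Z x) =
    (\<integral>\<^sup>+\<omega>\<in>?\<Lambda>. ext0 (potential ?w (gen \<psi>)) (path Z s \<omega>) \<partial>law Z x)"
    by (rule markov_potential[OF g x s _ bounded_start_filt[OF \<psi> s], symmetric]) simp
  also have "\<dots> \<le> (\<integral>\<^sup>+\<omega>. of_nat K \<partial>law Z x)"
    by (intro nn_integral_mono)
       (auto simp: bounded_start_def indicator_def resolvent_eq_potential[OF g])
  also have "\<dots> = of_nat K" by (simp add: emeasure_space_1)
  finally have "(\<integral>\<^sup>+\<omega>\<in>?\<Lambda>. (\<integral>\<^sup>+r\<in>{0..}. ?w r * ext0 (gen \<psi>) (path Z (s + r) \<omega>) \<partial>lborel) \<partial>law Z x) < \<infinity>"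
    by (rule le_less_trans) (simp add: of_nat_less_top)
  then show ?thesis
    by (intro le_less_trans[OF le_w]) (simp add: ennreal_mult_less_top)
qed

text \<open>Grid points almost surely avoid \<open>N0\<close>, and on the events the state there is
  a zero of \<open>\<psi>\<close>, so the martingale bound is available at every grid time. A jump
  preceded by all the events would be detected on every fine grid.\<close>

lemma no_test_jumps:
  fixes A :: "nat \<Rightarrow> real \<Rightarrow> 'w set" and T :: nat
  assumes \<psi>: "\<psi> \<in> \<T>" and x: "x \<in> S" and s: "admissible N0 x s"
    and A: "\<And>n r. 0 \<le> r \<Longrightarrow> A n r \<in> sets (filt Z (s + r))"
    and sub: "\<And>n r \<omega>. 0 \<le> r \<Longrightarrow> \<omega> \<in> A n r \<Longrightarrow> \<omega> \<in> bounded_start \<psi> s K \<and> path Z (s + r) \<omega> \<in> Some ` away \<psi> j"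
    and vanish: "AE \<omega> in law Z x. AE r in lborel. 0 \<le> r \<longrightarrow> r < real (Suc T) \<longrightarrow> ext0 (gen \<psi>) (path Z (s + r) \<omega>) \<noteq> 0 \<longrightarrow>
      (\<exists>n0. \<forall>n\<ge>n0. \<forall>\<^sub>F k in sequentially. \<omega> \<notin> A n (grid_below (real (Suc T)) k r))"
  shows "AE \<omega> in law Z x. \<forall>r. 0 < r \<longrightarrow> r < real (Suc T) \<longrightarrow> ereal (s + r) < lifetime Z \<omega> \<longrightarrow>
    (\<forall>n. \<exists>b<r. \<forall>r'. 0 \<le> r' \<longrightarrow> b < r' \<longrightarrow> r' < r \<longrightarrow> \<omega> \<in> A n r') \<longrightarrow> \<psi> (pos (s + r) \<omega>) = 0"
proof -
  have s0: "0 \<le> s" using s by (simp add: admissible_def)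
  have \<psi>B: "(\<lambda>q. ennreal (\<psi> q)) \<in> borel_measurable BS" using test_borel[OF \<psi>] by measurable
  have "AE \<omega> in law Z x. \<not> (\<exists>c>0. \<forall>n. \<forall>\<^sub>F k in sequentially.
    c \<le> (\<Sum>i<Suc k. indicator (A n (real i * (real (Suc T) / real (Suc k)))) \<omega> *
      ext0 (\<lambda>q. ennreal (\<psi> q)) (path Z (s + real (Suc i) * (real (Suc T) / real (Suc k))) \<omega>)))"
  proof (rule no_compensated_jumps[OF \<psi>B gen_borel[OF \<psi>] x s0 _ A bounded_start_filt[OF \<psi> s0] _ bounded_start_finite[OF \<psi> s0 x] _ vanish])
    show "A n r \<subseteq> bounded_start \<psi> s K" if "0 \<le> r" for n r
      using sub[OF that] by blast
    fix n k i :: nat and h :: real assume h: "0 \<le> h"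
    show "AE \<omega> in law Z x. \<omega> \<in> A n (real i * (real (Suc T) / real (Suc k))) \<longrightarrow>
      ext0 (transition h (\<lambda>q. ennreal (\<psi> q))) (path Z (s + real i * (real (Suc T) / real (Suc k))) \<omega>)
      \<le> ext0 (potential (indicator {0..h}) (gen \<psi>)) (path Z (s + real i * (real (Suc T) / real (Suc k))) \<omega>)"
      using admissible_AE[OF x s, of i T k]
    proof eventually_elim
      case (elim \<omega>)
      show ?case
      proof
        assume "\<omega> \<in> A n (real i * (real (Suc T) / real (Suc k)))"
        then have "path Z (s + real i * (real (Suc T) / real (Suc k))) \<omega> \<in> Some ` away \<psi> j"
          using sub[of "real i * (real (Suc T) / real (Suc k))"] by simp
        then obtain y where y: "path Z (s + real i * (real (Suc T) / real (Suc k))) \<omega> = Some y" "y \<in> away \<psi> j"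
          by auto
        then have "y \<in> S - N0" using elim by (auto simp: away_def)
        then show "ext0 (transition h (\<lambda>q. ennreal (\<psi> q))) (path Z (s + real i * (real (Suc T) / real (Suc k))) \<omega>)
          \<le> ext0 (potential (indicator {0..h}) (gen \<psi>)) (path Z (s + real i * (real (Suc T) / real (Suc k))) \<omega>)"
          using test_transition_bound[OF _ \<psi> away_zero[OF y(2)] h] y(1) by simp
      qed
    qed
  qed simp
  with AE_cadlag_path[OF cadlag x] show ?thesis
  proof eventually_elim
    case (elim \<omega>)
    show ?case
    proof (intro allI impI)
      fix r assume r: "0 < r" "r < real (Suc T)" "ereal (s + r) < lifetime Z \<omega>"
        "\<forall>n. \<exists>b<r. \<forall>r'. 0 \<le> r' \<longrightarrow> b < r' \<longrightarrow> r' < r \<longrightarrow> \<omega> \<in> A n r'"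
      show "\<psi> (pos (s + r) \<omega>) = 0"
      proof (rule ccontr)
        assume "\<psi> (pos (s + r) \<omega>) \<noteq> 0"
        then have "0 < \<psi> (pos (s + r) \<omega>)"
          using test_bounds(1)[OF \<psi>] by (simp add: less_le)
        from jump_detected[OF elim(1) s0 r(1,2,3) test_continuous[OF \<psi>] this] r(4) elim(2)
        show False by blast
      qed
    qed
  qed
qed

text \<open>The events place the state in the set \<open>C\<close>, closed in \<open>S\<close>. By
  \<open>locality\<close>, a state where \<open>L \<psi>\<close> does not vanish lies outside
  \<open>C\<close>; at times of left continuity the grid states just before are then outside
  \<open>C\<close> too.\<close>

lemma no_jumps_inside:
  fixes T :: nat
  assumes \<psi>: "\<psi> \<in> \<T>" and x: "x \<in> S" and s: "admissible N0 x s"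
  shows "AE \<omega> in law Z x. \<forall>r l. jump_at \<psi> s T K j r l \<omega> \<longrightarrow> \<not> 1 / real (Suc j) < \<delta> l"
proof -
  have s0: "0 \<le> s" using s by (simp add: admissible_def)
  define C where "C = away \<psi> j \<inter> {q \<in> S. 1 / real (Suc j) \<le> \<delta> q}"
  \<comment> \<open>Constant in \<open>n\<close>: refining the grid is enough here, and the second
    limit serves only the boundary case.\<close>
  define A where "A (n::nat) r = bounded_start \<psi> s K \<inter> {\<omega> \<in> space (events Z). path Z (s + r) \<omega> \<in> Some ` C}" for n r
  have "AE \<omega> in law Z x. \<forall>r. 0 < r \<longrightarrow> r < real (Suc T) \<longrightarrow> ereal (s + r) < lifetime Z \<omega> \<longrightarrow>
    (\<forall>n. \<exists>b<r. \<forall>r'. 0 \<le> r' \<longrightarrow> b < r' \<longrightarrow> r' < r \<longrightarrow> \<omega> \<in> A n r') \<longrightarrow> \<psi> (pos (s + r) \<omega>) = 0"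
  proof (rule no_test_jumps[OF \<psi> x s])
    fix n and r :: real assume r: "0 \<le> r"
    have "C \<in> sets BS" unfolding C_def by (intro sets.Int away_BS level_BS)
    moreover have "bounded_start \<psi> s K \<in> sets (filt Z (s + r))"
      using bounded_start_filt[OF \<psi> s0] filt_mono[OF s0, of "s + r"] r by auto
    ultimately show "A n r \<in> sets (filt Z (s + r))"
      unfolding A_def using s0 r by (intro sets.Int adapted) auto
    show "\<omega> \<in> bounded_start \<psi> s K \<and> path Z (s + r) \<omega> \<in> Some ` away \<psi> j" if "\<omega> \<in> A n r" for \<omega>
      using that by (auto simp: A_def C_def)
  next
    show "AE \<omega> in law Z x. AE r in lborel. 0 \<le> r \<longrightarrow> r < real (Suc T) \<longrightarrow> ext0 (gen \<psi>) (path Z (s + r) \<omega>) \<noteq> 0 \<longrightarrow>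
      (\<exists>n0. \<forall>n\<ge>n0. \<forall>\<^sub>F k in sequentially. \<omega> \<notin> A n (grid_below (real (Suc T)) k r))"
      using AE_cadlag_path[OF cadlag x]
    proof eventually_elim
      case (elim \<omega>)
      show ?case
        using AE_path_left_continuous[OF elim s0] AE_lborel_singleton[of "0::real"]
      proof eventually_elim
        case (elim r)
        show ?case
        proof (intro impI exI[of _ 0] allI)
          assume r: "0 \<le> r" and g: "ext0 (gen \<psi>) (path Z (s + r) \<omega>) \<noteq> 0"
          fix n :: nat
          have r0: "0 < r" using r elim(2) by simp
          have T0: "0 < real (Suc T)" by simp
          have sr: "0 \<le> s + r" using s0 r by simp
          have alive: "path Z (s + r) \<omega> \<noteq> None" using g by (metis ext0_simps(1))
          have life: "ereal (s + r) < lifetime Z \<omega>" by (rule alive_lifetime[OF \<open>cadlag_path \<omega>\<close> sr alive])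
          note lc = elim(1)[rule_format, OF r0 life]
          define q where "q = pos (s + r) \<omega>"
          have q: "path Z (s + r) \<omega> = Some q" "q \<in> S"
            using path_eq_Some_the[OF \<open>cadlag_path \<omega>\<close> sr life] by (auto simp: q_def)
          have "\<not> (1 / real (Suc j) \<le> infdist q {z. \<psi> z \<noteq> 0} \<and> 1 / real (Suc j) \<le> \<delta> q)"
          proof
            assume *: "1 / real (Suc j) \<le> infdist q {z. \<psi> z \<noteq> 0} \<and> 1 / real (Suc j) \<le> \<delta> q"
            have "0 < \<delta> q" using * by (meson divide_pos_pos less_le_trans of_nat_0_less_iff zero_less_Suc zero_less_one)
            then have "L \<psi> q = 0"
              using * by (intro locality[OF \<psi> q(2), of "1 / real (Suc j)"] zero_near[of j q]) auto
            then show False using g q(1) by (simp add: gen_def)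
          qed
          then consider "infdist q {z. \<psi> z \<noteq> 0} < 1 / real (Suc j)" | "\<delta> q < 1 / real (Suc j)"
            by linarith
          then have "\<forall>\<^sub>F k in sequentially. path Z (s + grid_below (real (Suc T)) k r) \<omega> \<notin> Some ` C"
          proof cases
            case 1
            have "continuous_on UNIV (\<lambda>q. infdist q {z. \<psi> z \<noteq> 0})" by (intro continuous_intros)
            from grid_leaves_closed[OF \<open>cadlag_path \<omega>\<close> s0 T0 r0 lc this 1[unfolded q_def]]
            show ?thesis by (rule eventually_mono) (auto simp: C_def away_def)
          next
            case 2
            from grid_leaves_closed[OF \<open>cadlag_path \<omega>\<close> s0 T0 r0 lc \<delta>_continuous 2[unfolded q_def]]
            show ?thesis by (rule eventually_mono) (auto simp: C_def)
          qed
          then show "\<forall>\<^sub>F k in sequentially. \<omega> \<notin> A n (grid_below (real (Suc T)) k r)"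
            by eventually_elim (simp add: A_def)
        qed
      qed
    qed
  qed
  with AE_cadlag_path[OF cadlag x] show ?thesis
  proof eventually_elim
    case (elim \<omega>)
    show ?case
    proof (intro allI impI notI)
      fix r l assume J: "jump_at \<psi> s T K j r l \<omega>" and d: "1 / real (Suc j) < \<delta> l"
      from J have r: "0 < r" "r < real (Suc T)" "ereal (s + r) < lifetime Z \<omega>"
        and \<Lambda>: "\<omega> \<in> bounded_start \<psi> s K" and l: "((\<lambda>u. pos u \<omega>) \<longlongrightarrow> l) (at_left (s + r))"
        and i: "1 / real (Suc j) < infdist l {z. \<psi> z \<noteq> 0}" and z: "0 < \<psi> (pos (s + r) \<omega>)"
        by (simp_all add: jump_at_def)
      have "continuous_on UNIV (\<lambda>q. infdist q {z. \<psi> z \<noteq> 0})" by (intro continuous_intros)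
      from eventually_left_path_greater[OF s0 l this i] obtain b1 where
        b1: "b1 < r" "\<And>r'. b1 < r' \<Longrightarrow> r' < r \<Longrightarrow> 1 / real (Suc j) < infdist (pos (s + r') \<omega>) {z. \<psi> z \<noteq> 0}" by blast
      from eventually_left_path_greater[OF s0 l \<delta>_continuous d] obtain b2 where
        b2: "b2 < r" "\<And>r'. b2 < r' \<Longrightarrow> r' < r \<Longrightarrow> 1 / real (Suc j) < \<delta> (pos (s + r') \<omega>)" by blast
      have "\<omega> \<in> A n r'" if "0 \<le> r'" "max b1 b2 < r'" "r' < r" for n r'
      proof -
        have "ereal (s + r') < lifetime Z \<omega>"
          using r(3) that(3) by (meson add_strict_left_mono ereal_less_eq(3) le_less_trans less_imp_le)
        from path_eq_Some_the[OF elim(1) _ this] b1(2)[of r'] b2(2)[of r'] that s0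
        have "path Z (s + r') \<omega> \<in> Some ` C"
          by (intro image_eqI[of _ _ "pos (s + r') \<omega>"]) (auto simp: C_def away_def)
        then show ?thesis using \<Lambda> elim(1) by (simp add: A_def cadlag_path_def)
      qed
      then have "\<forall>n. \<exists>b<r. \<forall>r'. 0 \<le> r' \<longrightarrow> b < r' \<longrightarrow> r' < r \<longrightarrow> \<omega> \<in> A n r'"
        using b1(1) b2(1) by (intro allI exI[of _ "max b1 b2"]) auto
      then have "\<psi> (pos (s + r) \<omega>) = 0" using elim(2) r by blast
      then show False using z by simp
    qed
  qed
qed

text \<open>On the boundary \<open>locality\<close> says nothing, so the events themselves have to
  shrink. They hold only after the path has come within \<open>1 / Suc n\<close> of the boundary and
  while it has kept a uniform bound so far, which in the limit leaves at most one instant of each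
  path.\<close>

lemma no_jumps_from_boundary:
  fixes T :: nat
  assumes \<psi>: "\<psi> \<in> \<T>" and x: "x \<in> S" and s: "admissible N0 x s"
  shows "AE \<omega> in law Z x. \<forall>r l. jump_at \<psi> s T K j r l \<omega> \<longrightarrow> \<delta> l = 0 \<longrightarrow> \<not> (\<forall>r'<r. stays_in s r' \<omega>)"
proof -
  have s0: "0 \<le> s" using s by (simp add: admissible_def)
  \<comment> \<open>Only rational times enter, so that \<open>high\<close> and \<open>low\<close>
    are countable combinations of adapted events.\<close>
  define Q where "Q r = {u \<in> \<rat>. 0 \<le> u \<and> u < r}" for r :: real
  have Q: "countable (Q r)" for r
    unfolding Q_def by (rule countable_subset[OF _ countable_rat]) auto
  have Q_mono: "Q r \<subseteq> Q r'" if "r \<le> r'" for r r'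
    using that by (auto simp: Q_def)
  define high where "high r \<omega> \<longleftrightarrow> (\<exists>\<eta>::nat. \<forall>u\<in>Q r. path Z (s + u) \<omega> \<in> Some ` {q \<in> S. 1 / real (Suc \<eta>) \<le> \<delta> q})" for r \<omega>
  define low where "low n r \<omega> \<longleftrightarrow> (\<exists>u\<in>Q r. path Z (s + u) \<omega> \<in> Some ` {q \<in> S. \<not> 1 / real (Suc n) \<le> \<delta> q})" for n r \<omega>
  have high_mono: "high r \<omega>" if "r \<le> r'" "high r' \<omega>" for r r' \<omega>
    using that(2) Q_mono[OF that(1)] unfolding high_def by (meson subsetD)
  have low_mono: "low n r' \<omega>" if "n \<le> n'" "r \<le> r'" "low n' r \<omega>" for n n' r r' \<omega>
  proof -
    from that(3) obtain u where u: "u \<in> Q r" "path Z (s + u) \<omega> \<in> Some ` {q \<in> S. \<not> 1 / real (Suc n') \<le> \<delta> q}"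
      unfolding low_def by blast
    have "1 / real (Suc n') \<le> 1 / real (Suc n)" using that(1) by (simp add: frac_le)
    then have "{q \<in> S. \<not> 1 / real (Suc n') \<le> \<delta> q} \<subseteq> {q \<in> S. \<not> 1 / real (Suc n) \<le> \<delta> q}"
      by (auto intro: order_trans)
    then have "path Z (s + u) \<omega> \<in> Some ` {q \<in> S. \<not> 1 / real (Suc n) \<le> \<delta> q}"
      using u(2) by (meson image_mono subsetD)
    then show ?thesis
      using u(1) Q_mono[OF that(2)] unfolding low_def by blast
  qed
  \<comment> \<open>Before time \<open>s + r\<close> the path has come \<open>1 / Suc n\<close>-close to the boundary, but not arbitrarily close.\<close>
  define A where "A (n::nat) r = bounded_start \<psi> s K \<inter> {\<omega> \<in> space (events Z). path Z (s + r) \<omega> \<in> Some ` away \<psi> j}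
    \<inter> {\<omega> \<in> space (events Z). high r \<omega> \<and> low n r \<omega>}" for n r
  have "AE \<omega> in law Z x. \<forall>r. 0 < r \<longrightarrow> r < real (Suc T) \<longrightarrow> ereal (s + r) < lifetime Z \<omega> \<longrightarrow>
    (\<forall>n. \<exists>b<r. \<forall>r'. 0 \<le> r' \<longrightarrow> b < r' \<longrightarrow> r' < r \<longrightarrow> \<omega> \<in> A n r') \<longrightarrow> \<psi> (pos (s + r) \<omega>) = 0"
  proof (rule no_test_jumps[OF \<psi> x s])
    fix n and r :: real assume r: "0 \<le> r"
    have sr: "0 \<le> s + r" using s0 r by simp
    have p: "Measurable.pred (filt Z (s + r)) (\<lambda>\<omega>. path Z (s + u) \<omega> \<in> Some ` B)" if "u \<in> Q r" "B \<in> sets BS" for u B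
    proof -
      have u: "0 \<le> s + u" "s + u \<le> s + r" using that(1) s0 by (auto simp: Q_def)
      then show ?thesis
        using adapted[OF u(1) that(2)] filt_mono[OF u] by (auto simp: pred_def space_filt[OF sr])
    qed
    have B: "{q \<in> S. \<not> c \<le> \<delta> q} \<in> sets BS" for c
    proof -
      have "{q \<in> S. \<not> c \<le> \<delta> q} = S - {q \<in> S. c \<le> \<delta> q}" by auto
      then show ?thesis using level_BS S_in_BS by auto
    qed
    note p = p[unfolded pred_def space_filt[OF sr]]
    have "{\<omega> \<in> space (events Z). high r \<omega> \<and> low n r \<omega>} \<in> sets (filt Z (s + r))"
      unfolding high_def low_def space_filt[OF sr, symmetric]
      by (intro sets.sets_Collect_conj sets.sets_Collect_countable_Ex sets.sets_Collect_countable_All'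
          sets.sets_Collect_countable_Ex' Q p[folded space_filt[OF sr]] level_BS B)
    moreover have "bounded_start \<psi> s K \<in> sets (filt Z (s + r))"
      using bounded_start_filt[OF \<psi> s0] filt_mono[OF s0, of "s + r"] r by auto
    ultimately show "A n r \<in> sets (filt Z (s + r))"
      unfolding A_def using sr by (intro sets.Int adapted away_BS) auto
    show "\<omega> \<in> bounded_start \<psi> s K \<and> path Z (s + r) \<omega> \<in> Some ` away \<psi> j" if "\<omega> \<in> A n r" for \<omega>
      using that by (auto simp: A_def)
  next
    show "AE \<omega> in law Z x. AE r in lborel. 0 \<le> r \<longrightarrow> r < real (Suc T) \<longrightarrow> ext0 (gen \<psi>) (path Z (s + r) \<omega>) \<noteq> 0 \<longrightarrow>
      (\<exists>n0. \<forall>n\<ge>n0. \<forall>\<^sub>F k in sequentially. \<omega> \<notin> A n (grid_below (real (Suc T)) k r))"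
    proof (rule AE_I2)
      fix \<omega>
      \<comment> \<open>The only instant that survives both limits is the one at which the boundary is reached.\<close>
      define W where "W = {r. (\<forall>r'<r. high r' \<omega>) \<and> (\<forall>n. low n r \<omega>)}"
      have "r1 = r2" if r1: "r1 \<in> W" and r2: "r2 \<in> W" for r1 r2
      proof -
        have False if "r1 < r2" "r1 \<in> W" "r2 \<in> W" for r1 r2
        proof -
          \<comment> \<open>Of two instants in \<open>W\<close>, the earlier one has a uniform lower
            bound on \<open>\<delta>\<close> before it, which contradicts \<open>low\<close> at the
            index of that bound.\<close>
          have "high r1 \<omega>" using that by (auto simp: W_def)
          then obtain \<eta> :: nat where \<eta>: "\<forall>u\<in>Q r1. path Z (s + u) \<omega> \<in> Some ` {q \<in> S. 1 / real (Suc \<eta>) \<le> \<delta> q}"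
            unfolding high_def by blast
          have "low \<eta> r1 \<omega>" using that by (auto simp: W_def)
          then show False using \<eta> unfolding low_def by fastforce
        qed
        then show ?thesis using r1 r2 by (metis linorder_neqE)
      qed
      then have "W = {} \<or> (\<exists>r. W = {r})" by blast
      then have "finite W" by auto
      then have "W \<in> null_sets lborel" by (intro countable_imp_null_set_lborel countable_finite)
      then have "AE r in lborel. r \<notin> W" by (rule AE_not_in)
      then show "AE r in lborel. 0 \<le> r \<longrightarrow> r < real (Suc T) \<longrightarrow> ext0 (gen \<psi>) (path Z (s + r) \<omega>) \<noteq> 0 \<longrightarrow>
        (\<exists>n0. \<forall>n\<ge>n0. \<forall>\<^sub>F k in sequentially. \<omega> \<notin> A n (grid_below (real (Suc T)) k r))"
      proof eventually_elim
        case (elim r)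
        show ?case
        proof (intro impI)
          assume r: "0 \<le> r"
          have T: "0 < real (Suc T)" by simp
          \<comment> \<open>If \<open>high\<close> has failed before \<open>r\<close>, it has failed
            at all grid times close to \<open>r\<close>; if \<open>low\<close> fails at
            \<open>r\<close>, it fails at all earlier times and for all larger indices.\<close>
          consider r' where "r' < r" "\<not> high r' \<omega>" | n0 where "\<not> low n0 r \<omega>"
            using elim by (auto simp: W_def)
          then show "\<exists>n0. \<forall>n\<ge>n0. \<forall>\<^sub>F k in sequentially. \<omega> \<notin> A n (grid_below (real (Suc T)) k r)"
          proof cases
            case 1
            have "\<forall>\<^sub>F k in sequentially. r' < grid_below (real (Suc T)) k r"
              using 1(1) by (intro order_tendstoD(1)[OF grid_below_tendsto[OF T r]])
            then have "\<forall>\<^sub>F k in sequentially. \<omega> \<notin> A n (grid_below (real (Suc T)) k r)" for n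
            proof eventually_elim
              case (elim k)
              then have "\<not> high (grid_below (real (Suc T)) k r) \<omega>"
                using 1(2) high_mono[of r' "grid_below (real (Suc T)) k r" \<omega>] by auto
              then show ?case by (simp add: A_def)
            qed
            then show ?thesis by blast
          next
            case 2
            have "\<omega> \<notin> A n (grid_below (real (Suc T)) k r)" if "n0 \<le> n" for n k
            proof -
              have "\<not> low n (grid_below (real (Suc T)) k r) \<omega>"
                using 2 low_mono[OF that grid_below_le[OF T r, of k], of \<omega>] by auto
              then show ?thesis by (simp add: A_def)
            qed
            then show ?thesis by (auto intro!: exI[of _ n0] always_eventually)
          qed
        qed
      qed
    qed
  qed
  with AE_cadlag_path[OF cadlag x] show ?thesis
  proof eventually_elim
    case (elim \<omega>)
    show ?case
    proof (intro allI impI notI)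
      fix r l assume J: "jump_at \<psi> s T K j r l \<omega>" and d: "\<delta> l = 0" and pos: "\<forall>r'<r. stays_in s r' \<omega>"
      from J have r: "0 < r" "r < real (Suc T)" "ereal (s + r) < lifetime Z \<omega>"
        and \<Lambda>: "\<omega> \<in> bounded_start \<psi> s K" and l: "((\<lambda>u. pos u \<omega>) \<longlongrightarrow> l) (at_left (s + r))"
        and i: "1 / real (Suc j) < infdist l {z. \<psi> z \<noteq> 0}" and z: "0 < \<psi> (pos (s + r) \<omega>)"
        by (simp_all add: jump_at_def)
      have alive: "path Z (s + u) \<omega> = Some (pos (s + u) \<omega>)" "pos (s + u) \<omega> \<in> S" if "0 \<le> u" "u < r" for u
      proof -
        have "ereal (s + u) < lifetime Z \<omega>"
          using r(3) that(2) by (meson add_strict_left_mono ereal_less_eq(3) le_less_trans less_imp_le)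
        then show "path Z (s + u) \<omega> = Some (pos (s + u) \<omega>)" "pos (s + u) \<omega> \<in> S"
          using path_eq_Some_the[OF elim(1), of "s + u"] that s0 by auto
      qed
      have "continuous_on UNIV (\<lambda>q. infdist q {z. \<psi> z \<noteq> 0})" by (intro continuous_intros)
      from eventually_left_path_greater[OF s0 l this i] obtain b1 where
        b1: "b1 < r" "\<And>r'. b1 < r' \<Longrightarrow> r' < r \<Longrightarrow> 1 / real (Suc j) < infdist (pos (s + r') \<omega>) {z. \<psi> z \<noteq> 0}" by blast
      have "\<exists>b<r. \<forall>r'. 0 \<le> r' \<longrightarrow> b < r' \<longrightarrow> r' < r \<longrightarrow> \<omega> \<in> A n r'" for n
      proof -
        have "\<delta> l < 1 / real (Suc n)" using d by simp
        from eventually_left_path_less[OF s0 l \<delta>_continuous this] obtain b2 where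
          b2: "b2 < r" "\<And>r'. b2 < r' \<Longrightarrow> r' < r \<Longrightarrow> \<delta> (pos (s + r') \<omega>) < 1 / real (Suc n)" by blast
        have "\<omega> \<in> A n r'" if r': "0 \<le> r'" "max 0 (max b1 b2) < r'" "r' < r" for r'
        proof -
          have "path Z (s + r') \<omega> \<in> Some ` away \<psi> j"
            using alive[OF r'(1,3)] b1(2)[of r'] r'
            by (intro image_eqI[of _ _ "pos (s + r') \<omega>"]) (auto simp: away_def)
          moreover have "high r' \<omega>"
          proof -
            obtain \<eta> :: nat where \<eta>: "\<forall>u. 0 \<le> u \<longrightarrow> u < r' \<longrightarrow> 1 / real (Suc \<eta>) \<le> \<delta> (pos (s + u) \<omega>)"
              using pos r'(3) unfolding stays_in_def by blast
            have "path Z (s + u) \<omega> \<in> Some ` {q \<in> S. 1 / real (Suc \<eta>) \<le> \<delta> q}" if "u \<in> Q r'" for u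
              using alive[of u] \<eta>[rule_format, of u] that r'(3)
              by (intro image_eqI[of _ _ "pos (s + u) \<omega>"]) (auto simp: Q_def)
            then show ?thesis unfolding high_def by blast
          qed
          moreover have "low n r' \<omega>"
          proof -
            obtain u where u: "u \<in> \<rat>" "max 0 (max b1 b2) < u" "u < r'"
              using Rats_dense_in_real[OF r'(2)] by blast
            have "path Z (s + u) \<omega> \<in> Some ` {q \<in> S. \<not> 1 / real (Suc n) \<le> \<delta> q}"
              using alive[of u] b2(2)[of u] u r'(3)
              by (intro image_eqI[of _ _ "pos (s + u) \<omega>"]) auto
            moreover have "u \<in> Q r'" using u by (simp add: Q_def)
            ultimately show ?thesis unfolding low_def by blast
          qed
          ultimately show ?thesis using \<Lambda> elim(1) by (simp add: A_def cadlag_path_def)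
        qed
        then show ?thesis using b1(1) b2(1) r(1) by (intro exI[of _ "max 0 (max b1 b2)"]) auto
      qed
      then have "\<psi> (pos (s + r) \<omega>) = 0" using elim(2) r by blast
      then show False using z by simp
    qed
  qed
qed

text \<open>A jump at \<open>t\<close> from a left limit inside is excluded directly. Were the left
  limit on the boundary, one would pass to the first time after a start \<open>s > \<tau>\<close> at
  which the uniform lower bound is lost: there the left limit is on the boundary while the path
  itself is inside, so the path jumps from the boundary after staying uniformly inside up to every
  earlier time.\<close>

lemma left_continuous_inside:
  assumes x: "x \<in> S" and D: "countable D" "\<And>s. s \<in> D \<Longrightarrow> admissible N0 x s"
    and dense: "\<And>a b. 0 \<le> a \<Longrightarrow> a < b \<Longrightarrow> \<exists>s\<in>D. a < s \<and> s < b"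
  shows "AE \<omega> in law Z x. cadlag_path \<omega> \<and> (\<forall>t \<tau>. 0 \<le> \<tau> \<longrightarrow> \<tau> < t \<longrightarrow> ereal t < lifetime Z \<omega> \<longrightarrow>
    (\<forall>u. \<tau> < u \<longrightarrow> u \<le> t \<longrightarrow> 0 < \<delta> (pos u \<omega>)) \<longrightarrow>
    ((\<lambda>s. pos s \<omega>) \<longlongrightarrow> pos t \<omega>) (at_left t))"
proof -
  have "AE \<omega> in law Z x. \<forall>s\<in>D. path Z s \<omega> \<notin> Some ` N0"
    using admissible_AE[OF x D(2), of _ 0 0 0] by (simp add: AE_ball_countable[OF D(1)])
  moreover have "AE \<omega> in law Z x. \<forall>s\<in>D. \<forall>\<psi>\<in>\<T>. \<forall>T K j. \<forall>r l. jump_at \<psi> s T K j r l \<omega> \<longrightarrow> \<not> 1 / real (Suc j) < \<delta> l"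
    using no_jumps_inside[OF _ x D(2)]
    by (simp add: AE_ball_countable[OF D(1)] AE_ball_countable[OF countable_tests] AE_all_countable)
  moreover have "AE \<omega> in law Z x. \<forall>s\<in>D. \<forall>\<psi>\<in>\<T>. \<forall>T K j. \<forall>r l. jump_at \<psi> s T K j r l \<omega> \<longrightarrow> \<delta> l = 0 \<longrightarrow> \<not> (\<forall>r'<r. stays_in s r' \<omega>)"
    using no_jumps_from_boundary[OF _ x D(2)]
    by (simp add: AE_ball_countable[OF D(1)] AE_ball_countable[OF countable_tests] AE_all_countable)
  ultimately show ?thesis
    using AE_cadlag_path[OF cadlag x]
  proof eventually_elim
    case (elim \<omega>)
    note inside = elim(2)[rule_format] and boundary = elim(3)[rule_format] and cad = elim(4)
    \<comment> \<open>Finds members of the countable families that witness a given jump; the bound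
      \<open>c\<close> on \<open>1 / Suc j\<close> leaves room for the later comparison with
      \<open>\<delta> l\<close>.\<close>
    have separate: "\<exists>\<psi>\<in>\<T>. \<exists>T K j. jump_at \<psi> s T K j r l \<omega> \<and> 1 / real (Suc j) < c"
      if s: "s \<in> D" and r: "0 < r" "ereal (s + r) < lifetime Z \<omega>" and l: "l \<in> S" "l \<noteq> pos (s + r) \<omega>"
        and lim: "((\<lambda>u. pos u \<omega>) \<longlongrightarrow> l) (at_left (s + r))" and c: "0 < c" for s r l c
    proof -
      have s0: "0 \<le> s" using D(2)[OF s] by (simp add: admissible_def)
      have z: "pos (s + r) \<omega> \<in> S" using path_eq_Some_the(2)[OF cad _ r(2)] s0 r(1) by simp
      obtain \<psi> \<epsilon> where \<psi>: "\<psi> \<in> \<T>" "0 < \<psi> (pos (s + r) \<omega>)" "0 < \<epsilon>" "\<And>q. q \<in> ball l \<epsilon> \<Longrightarrow> \<psi> q = 0"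
        using separation[OF l(1) z l(2)] by blast
      have "ereal s < lifetime Z \<omega>" using r by (meson ereal_less_eq(3) le_less_trans less_add_same_cancel1 less_imp_le)
      note y = path_eq_Some_the[OF cad s0 this]
      have "pos s \<omega> \<notin> N0" using elim(1) s y(1) by (metis image_eqI)
      then have "resolvent Z \<alpha> (gen \<psi>) (pos s \<omega>) < \<top>" using fin[of _ \<psi>] y(2) \<psi>(1) by simp
      then obtain K :: nat where "resolvent Z \<alpha> (gen \<psi>) (pos s \<omega>) < of_nat K"
        using ennreal_Ex_less_of_nat by blast
      then have K: "\<omega> \<in> bounded_start \<psi> s K"
        using y cad unfolding bounded_start_def by (auto simp: cadlag_path_def intro!: image_eqI[of _ _ "pos s \<omega>"])
      obtain T where "r < real T" using reals_Archimedean2 by blast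
      then have T: "r < real (Suc T)" by simp
      have "\<psi> (pos (s + r) \<omega>) \<noteq> 0" using \<psi>(2) by simp
      with \<psi>(4) have inf: "\<epsilon> \<le> infdist l {z. \<psi> z \<noteq> 0}" by (rule infdist_ge_ball)
      have "0 < min \<epsilon> c" using \<psi>(3) c by simp
      then obtain j where "1 / real (Suc j) < min \<epsilon> c" by (rule nat_approx_posE)
      then have j: "1 / real (Suc j) < infdist l {z. \<psi> z \<noteq> 0}" "1 / real (Suc j) < c"
        using inf by linarith+
      show ?thesis
        unfolding jump_at_def
        by (intro bexI[of _ \<psi>] exI[of _ T] exI[of _ K] exI[of _ j] conjI K T j r lim \<psi>(1,2))
    qed
    have cont: "l = pos t \<omega>"
      if t: "0 < t" "ereal t < lifetime Z \<omega>" and l: "l \<in> S" "((\<lambda>u. pos u \<omega>) \<longlongrightarrow> l) (at_left t)" "0 < \<delta> l" for t l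
    proof (rule ccontr)
      assume ne: "l \<noteq> pos t \<omega>"
      obtain s where s: "s \<in> D" "0 < s" "s < t" using dense[of 0 t] t(1) by auto
      have *: "s + (t - s) = t" by simp
      show False
        using separate[OF s(1), of "t - s" l "\<delta> l"] inside[OF s(1), of _ _ _ _ "t - s" l] s t l ne
        unfolding * by auto
    qed
    show ?case
    proof (intro conjI cad allI impI)
      fix t \<tau> assume \<tau>: "0 \<le> \<tau>" "\<tau> < t" and t: "ereal t < lifetime Z \<omega>"
        and pos: "\<forall>u. \<tau> < u \<longrightarrow> u \<le> t \<longrightarrow> 0 < \<delta> (pos u \<omega>)"
      have t0: "0 < t" using \<tau> by simp
      obtain l where l: "l \<in> S" "((\<lambda>s. pos s \<omega>) \<longlongrightarrow> l) (at_left t)"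
        using path_left_limit[OF cad t0 t] .
      have "0 < \<delta> l"
      proof (rule ccontr)
        assume "\<not> 0 < \<delta> l"
        then have \<delta>l: "\<delta> l = 0" using \<delta>_nonneg[of l] by simp
        obtain s where s: "s \<in> D" "\<tau> < s" "s < t" using dense[OF \<tau>] by auto
        have s0: "0 \<le> s" using s \<tau> by simp
        define ok where "ok r \<longleftrightarrow> stays_in s r \<omega>" for r
        have ok_mono: "ok r'" if "ok r" "r' \<le> r" for r r'
          using that unfolding ok_def stays_in_def by (meson less_le_trans)
        have okI: "ok r" if "0 < c" "\<And>u. 0 \<le> u \<Longrightarrow> u < r \<Longrightarrow> c \<le> \<delta> (pos (s + u) \<omega>)" for c r
        proof -
          from that(1) obtain \<eta> where "1 / real (Suc \<eta>) < c" by (rule nat_approx_posE)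
          then show ?thesis using that(2) unfolding ok_def stays_in_def by (meson less_imp_le order_trans)
        qed
        have life: "ereal (s + u) < lifetime Z \<omega>" if "s + u \<le> t" for u
          using t that by (meson ereal_less_eq(3) le_less_trans)
        have right: "\<exists>e>0. \<forall>u'. u \<le> u' \<longrightarrow> u' < u + e \<longrightarrow> \<delta> (pos (s + u) \<omega>) / 2 \<le> \<delta> (pos (s + u') \<omega>)"
          if u: "0 \<le> u" "s + u \<le> t" for u
        proof -
          let ?d = "\<delta> (pos (s + u) \<omega>)"
          have p: "0 < ?d" using pos s u by simp
          have "isCont \<delta> (pos (s + u) \<omega>)" using \<delta>_continuous by (simp add: continuous_on_eq_continuous_at)
          from isCont_tendsto_compose[OF this path_right_limit[OF cad _ life[OF u(2)]]]
          have "\<forall>\<^sub>F v in at_right (s + u). ?d / 2 < \<delta> (pos v \<omega>)"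
            using p s0 u(1) by (intro order_tendstoD(1)[where y = "?d"]) auto
          then obtain c where c: "s + u < c" "\<And>v. s + u < v \<Longrightarrow> v < c \<Longrightarrow> ?d / 2 < \<delta> (pos v \<omega>)"
            unfolding eventually_at_right_field by blast
          have "?d / 2 \<le> \<delta> (pos (s + u') \<omega>)" if "u \<le> u'" "u' < u + (c - (s + u))" for u'
            using c(2)[of "s + u'"] that p by (cases "u' = u") auto
          then show ?thesis using c(1) by (intro exI[of _ "c - (s + u)"]) auto
        qed
        \<comment> \<open>Earlier jumps from the boundary may precede \<open>t\<close>; the first one after \<open>s\<close> is excluded.\<close>
        define R where "R = {r. 0 < r \<and> r \<le> t - s \<and> \<not> ok r}"
        have tR: "t - s \<in> R"
        proof -
          have "\<not> ok (t - s)"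
          proof
            assume "ok (t - s)"
            then obtain \<eta> :: nat where \<eta>: "\<And>u. 0 \<le> u \<Longrightarrow> u < t - s \<Longrightarrow> 1 / real (Suc \<eta>) \<le> \<delta> (pos (s + u) \<omega>)"
              unfolding ok_def stays_in_def by blast
            have "((\<lambda>s. pos s \<omega>) \<longlongrightarrow> l) (at_left (s + (t - s)))" using l(2) by simp
            from eventually_left_path_less[OF s0 this \<delta>_continuous, of "1 / real (Suc \<eta>)"] \<delta>l
            obtain b where b: "b < t - s" "\<And>r'. b < r' \<Longrightarrow> r' < t - s \<Longrightarrow> \<delta> (pos (s + r') \<omega>) < 1 / real (Suc \<eta>)"
              by auto
            obtain r' where "max 0 b < r'" "r' < t - s" using dense[of "max 0 b" "t - s"] b(1) s(3) by auto
            then show False using b(2)[of r'] \<eta>[of r'] by simp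
          qed
          then show ?thesis using s by (simp add: R_def)
        qed
        have bdd: "bdd_below R" by (intro bdd_belowI[of _ 0]) (auto simp: R_def)
        define r0 where "r0 = Inf R"
        have r0_le: "r0 \<le> t - s" unfolding r0_def by (rule cInf_lower[OF tR bdd])
        \<comment> \<open>Right continuity at \<open>s\<close> keeps the infimum \<open>r0\<close>
          away from 0.\<close>
        obtain e where e: "0 < e" "\<And>u. 0 \<le> u \<Longrightarrow> u < e \<Longrightarrow> \<delta> (pos (s + 0) \<omega>) / 2 \<le> \<delta> (pos (s + u) \<omega>)"
          using right[of 0] s by auto
        have "ok e" using pos s e(2) by (intro okI[of "\<delta> (pos (s + 0) \<omega>) / 2"]) auto
        then have "e \<le> r0" unfolding r0_def using tR ok_mono
          by (intro cInf_greatest) (auto simp: R_def intro: leI dest: less_imp_le)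
        then have r0: "0 < r0" using e(1) by simp
        have ok_lt: "ok r" if "r < r0" for r
        proof (cases "0 < r")
          case True
          have "r \<notin> R" using that cInf_lower[OF _ bdd, of r] by (auto simp: r0_def)
          then show ?thesis using True that r0_le by (auto simp: R_def)
        next
          case False
          then show ?thesis unfolding ok_def stays_in_def by auto
        qed
        have life0: "ereal (s + r0) < lifetime Z \<omega>" using life r0_le by simp
        obtain l0 where l0: "l0 \<in> S" "((\<lambda>s. pos s \<omega>) \<longlongrightarrow> l0) (at_left (s + r0))"
          using path_left_limit[OF cad _ life0] s0 r0 by auto
        \<comment> \<open>Were this left limit inside, the lower bounds before \<open>r1\<close>,
          from \<open>r1\<close> to \<open>r0\<close>, and from \<open>r0\<close> on would combine
          and carry \<open>ok\<close> past the infimum.\<close>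
        have \<delta>l0: "\<delta> l0 = 0"
        proof (rule ccontr)
          assume "\<delta> l0 \<noteq> 0"
          then have p: "0 < \<delta> l0" using \<delta>_nonneg[of l0] by simp
          then have "\<delta> l0 / 2 < \<delta> l0" by simp
          from eventually_left_path_greater[OF s0 l0(2) \<delta>_continuous this]
          obtain b where b: "b < r0" "\<And>r'. b < r' \<Longrightarrow> r' < r0 \<Longrightarrow> \<delta> l0 / 2 < \<delta> (pos (s + r') \<omega>)" by blast
          obtain r1 where r1: "b < r1" "r1 < r0" using dense[of "max 0 b" r0] b(1) r0 by auto
          obtain \<eta> :: nat where \<eta>: "\<And>u. 0 \<le> u \<Longrightarrow> u < r1 \<Longrightarrow> 1 / real (Suc \<eta>) \<le> \<delta> (pos (s + u) \<omega>)"
            using ok_lt[OF r1(2)] unfolding ok_def stays_in_def by blast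
          define d0 where "d0 = \<delta> (pos (s + r0) \<omega>) / 2"
          have d0: "0 < d0" using pos s r0 r0_le by (simp add: d0_def)
          obtain e' where e': "0 < e'" "\<And>u. r0 \<le> u \<Longrightarrow> u < r0 + e' \<Longrightarrow> d0 \<le> \<delta> (pos (s + u) \<omega>)"
            using right[of r0] r0 r0_le unfolding d0_def by auto
          have "ok (r0 + e')"
          proof (rule okI[of "min (1 / real (Suc \<eta>)) (min (\<delta> l0 / 2) d0)"])
            show "0 < min (1 / real (Suc \<eta>)) (min (\<delta> l0 / 2) d0)" using p d0 by simp
            fix u assume u: "0 \<le> u" "u < r0 + e'"
            consider "u < r1" | "r1 \<le> u" "u < r0" | "r0 \<le> u" by linarith
            then show "min (1 / real (Suc \<eta>)) (min (\<delta> l0 / 2) d0) \<le> \<delta> (pos (s + u) \<omega>)"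
            proof cases
              case 1 then show ?thesis using \<eta>[of u] u by simp
            next
              case 2 then show ?thesis using b(2)[of u] r1 by simp
            next
              case 3 then show ?thesis using e'(2)[of u] u by simp
            qed
          qed
          moreover obtain r where "r \<in> R" "r < r0 + e'"
            using cInf_lessD[of R "r0 + e'"] tR e'(1) by (auto simp: r0_def)
          ultimately show False using ok_mono[of "r0 + e'" r] by (auto simp: R_def)
        qed
        have ne: "l0 \<noteq> pos (s + r0) \<omega>"
          using \<delta>l0 pos s r0 r0_le by (auto dest: spec[of _ "s + r0"])
        show False
          using separate[OF s(1) r0 life0 l0(1) ne l0(2), of 1] boundary[OF s(1), of _ _ _ _ r0 l0] \<delta>l0 ok_lt
          unfolding ok_def by auto
      qed
      from cont[OF t0 t l this] l(2) show "((\<lambda>s. pos s \<omega>) \<longlongrightarrow> pos t \<omega>) (at_left t)"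
        by simp
    qed
  qed
qed

end

section \<open>Sojourn sets, and the diffusion property on the set where \<open>\<delta>\<close> is
  positive\<close>

lemma hit_nonneg: "0 \<le> hit Z A \<omega>"
  unfolding hit_def by (rule Inf_greatest) auto

lemma hit_after_ge: "0 \<le> \<tau> \<omega> \<Longrightarrow> \<tau> \<omega> \<le> hit_after Z A \<tau> \<omega>"
  unfolding hit_after_def using hit_nonneg by (auto simp: add_increasing2)

lemma entry_time_nonneg: "0 \<le> entry_time S Z G G' k \<omega>"
proof (induction k)
  case (Suc k)
  have "0 \<le> hit_after Z (S - G) (entry_time S Z G G' k) \<omega>"
    by (rule order_trans[OF Suc hit_after_ge[where \<tau> = "entry_time S Z G G' k", OF Suc]])
  from order_trans[OF this hit_after_ge[where \<tau> = "hit_after Z (S - G) (entry_time S Z G G' k)", OF this]] show ?case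
    by simp
qed (simp add: hit_nonneg)

text \<open>Here \<open>\<tau>\<close> is the entry time that opens the sojourn interval; a visit to
  \<open>S - G\<close> after it and no later than \<open>t\<close> would bring the exit time down to
  at most \<open>t\<close>. The instant \<open>\<tau>\<close> itself is left out because
  \<open>hit\<close> ignores the initial instant.\<close>

lemma sojourn_stays:
  assumes \<omega>: "cadlag_path \<omega>" and t: "t \<in> sojourn S Z G \<G> \<omega>" "ereal t < lifetime Z \<omega>"
  obtains \<tau> where "0 \<le> \<tau>" "\<tau> < t" "\<And>u. \<tau> < u \<Longrightarrow> u \<le> t \<Longrightarrow> pos u \<omega> \<in> G"
proof -
  obtain n k where nk: "entry_time S Z G (\<G> n) k \<omega> < ereal t" "ereal t < exit_time S Z G (\<G> n) k \<omega>"
    using t(1) unfolding sojourn_def by auto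
  obtain \<tau> where \<tau>: "entry_time S Z G (\<G> n) k \<omega> = ereal \<tau>" "0 \<le> \<tau>" "\<tau> < t"
    using nk(1) entry_time_nonneg[of G "\<G> n" k \<omega>]
    by (cases "entry_time S Z G (\<G> n) k \<omega>") auto
  have exit: "ereal t < ereal \<tau> + hit Z (S - G) (shift Z \<tau> \<omega>)"
    using nk(2) \<tau>(1) by (simp add: exit_time_def hit_after_def)
  have "pos u \<omega> \<in> G" if u: "\<tau> < u" "u \<le> t" for u
  proof (rule ccontr)
    assume nG: "pos u \<omega> \<notin> G"
    have "ereal u < lifetime Z \<omega>" using t(2) u(2) by (meson ereal_less_eq(3) le_less_trans)
    from path_eq_Some_the[OF \<omega> _ this] have p: "path Z u \<omega> \<in> Some ` (S - G)"
      using nG u \<tau> by (metis DiffI image_eqI less_imp_le order_trans)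
    have "path Z (u - \<tau>) (shift Z \<tau> \<omega>) = path Z u \<omega>"
      using path_shift[of "u - \<tau>" \<tau> \<omega>] u \<tau> \<omega> by (simp add: cadlag_path_def)
    then have "hit Z (S - G) (shift Z \<tau> \<omega>) \<le> ereal (u - \<tau>)"
      unfolding hit_def using p u(1) by (intro Inf_lower) auto
    then have "ereal \<tau> + hit Z (S - G) (shift Z \<tau> \<omega>) \<le> ereal \<tau> + ereal (u - \<tau>)"
      by (rule add_left_mono)
    with exit have "ereal t < ereal u" by (auto dest: less_le_trans)
    then show False using u(2) by simp
  qed
  with \<tau> that show thesis by blast
qed

text \<open>The set \<open>N0\<close> itself may be hit, but from a point of zero potential almost
  every fixed time avoids it almost surely, which is what the grid starts need. The inessential set
  \<open>N\<close> is built from \<open>N0\<close> alone and hence serves all exhaustions.\<close>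

theorem diffusion_qe_positive:
  assumes G: "G = {q \<in> S. 0 < \<delta> q}"
  shows "diffusion_qe S Z m G"
proof -
  have sp: "space m = S" using sets_m by (auto dest: sets_eq_imp_space_eq simp: space_BS)
  have ae: "AE y in m. (\<forall>\<psi>\<in>\<T>. solves_at \<psi> (L \<psi>) y) \<and> (\<forall>\<psi>\<in>\<T>. resolvent Z \<alpha> (gen \<psi>) y < \<top>)"
    using martingale_AE resolvent_finite
    by (simp add: AE_ball_countable[OF countable_tests] gen_def[abs_def])
  obtain N0 where sub: "{y \<in> space m. \<not> ((\<forall>\<psi>\<in>\<T>. solves_at \<psi> (L \<psi>) y) \<and> (\<forall>\<psi>\<in>\<T>. resolvent Z \<alpha> (gen \<psi>) y < \<top>))} \<subseteq> N0"
    and N0': "emeasure m N0 = 0" "N0 \<in> sets m"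
    by (rule AE_E[OF ae])
  have N0: "N0 \<in> null_sets m" using N0' by (rule null_setsI)
  have mart: "solves_at \<psi> (L \<psi>) y"
    and fin: "resolvent Z \<alpha> (gen \<psi>) y < \<top>" if "y \<in> S - N0" "\<psi> \<in> \<T>" for y \<psi>
    using that sub by (auto simp: sp)
  define u where "u = resolvent Z \<alpha> (indicator N0)"
  have f: "(indicator N0 :: 's \<Rightarrow> ennreal) \<in> borel_measurable BS"
    using N0 sets_m by (intro borel_measurable_indicator) auto
  have u: "u \<in> borel_measurable BS" unfolding u_def by (rule resolvent_borel[OF \<alpha>_pos f])
  define N where "N = {y \<in> S. u y \<noteq> 0}"
  have N: "N \<in> sets BS"
  proof -
    have "u -` (- {0}) \<inter> space BS \<in> sets BS" using u by (rule measurable_sets) simp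
    moreover have "u -` (- {0}) \<inter> space BS = N" by (auto simp: N_def space_BS)
    ultimately show ?thesis by simp
  qed
  have "inessential S Z m N"
    unfolding inessential_def
  proof (intro conjI ballI N)
    have "AE y in m. y \<notin> N"
      using null_resolvent[OF N0] by eventually_elim (simp add: N_def u_def)
    then have "N \<in> null_sets m" using N sets_m by (subst AE_iff_null_sets) auto
    then show "emeasure m N = 0" by auto
    fix x assume x: "x \<in> S - N"
    then have "AE \<omega> in law Z x. \<forall>t\<ge>0. ext0 u (path Z t \<omega>) = 0"
      unfolding u_def by (intro resolvent_zero_absorbing f \<alpha>_pos) (auto simp: N_def u_def)
    then show "AE \<omega> in law Z x. \<not> hit Z N \<omega> < \<infinity>"
    proof eventually_elim
      case (elim \<omega>)
      have "path Z t \<omega> \<notin> Some ` N" if "0 < t" for t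
        using elim that by (auto simp: N_def dest!: spec[of _ t])
      then have "{ereal t | t. 0 < t \<and> path Z t \<omega> \<in> Some ` N} = {}" by blast
      then show ?case unfolding hit_def by (simp only:) (simp add: top_ereal_def)
    qed
  qed
  moreover have "AE \<omega> in law Z x. continuous_on {t \<in> sojourn S Z G \<G> \<omega>. 0 \<le> t \<and> ereal t < lifetime Z \<omega>}
         (\<lambda>t. pos t \<omega>)" if x: "x \<in> S - N" for x \<G>
  proof -
    have xS: "x \<in> S" and ux: "u x = 0" using x by (auto simp: N_def)
    have "AE s in lborel. 0 \<le> s \<longrightarrow> transition (s + real i * (real (Suc T) / real (Suc k))) (indicator N0) x = 0" for T i k :: nat
      using ux by (intro AE_good_start_times f xS resolvent_zero_transition) (auto simp: u_def)
    then have "AE s in lborel. \<forall>T i k :: nat. 0 \<le> s \<longrightarrow> transition (s + real i * (real (Suc T) / real (Suc k))) (indicator N0) x = 0"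
      unfolding AE_all_countable by blast
    then have "AE s in lborel. 0 \<le> s \<longrightarrow> admissible N0 x s"
      by eventually_elim (simp add: admissible_def)
    from AE_lborel_countable_dense[OF this] obtain D where
      D: "countable D" "\<And>s. s \<in> D \<Longrightarrow> admissible N0 x s" "\<And>a b. 0 \<le> a \<Longrightarrow> a < b \<Longrightarrow> \<exists>s\<in>D. a < s \<and> s < b"
      by blast
    have "AE \<omega> in law Z x. cadlag_path \<omega> \<and> (\<forall>t \<tau>. 0 \<le> \<tau> \<longrightarrow> \<tau> < t \<longrightarrow> ereal t < lifetime Z \<omega> \<longrightarrow>
      (\<forall>u. \<tau> < u \<longrightarrow> u \<le> t \<longrightarrow> 0 < \<delta> (pos u \<omega>)) \<longrightarrow>
      ((\<lambda>s. pos s \<omega>) \<longlongrightarrow> pos t \<omega>) (at_left t))"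
      by (rule left_continuous_inside[OF N0 mart fin xS D])
    then show ?thesis
    proof eventually_elim
      case (elim \<omega>)
      show ?case
        unfolding continuous_on_def
      proof (intro ballI)
        fix t assume "t \<in> {t \<in> sojourn S Z G \<G> \<omega>. 0 \<le> t \<and> ereal t < lifetime Z \<omega>}"
        then have t: "t \<in> sojourn S Z G \<G> \<omega>" "0 \<le> t" "ereal t < lifetime Z \<omega>" by auto
        obtain \<tau> where \<tau>: "0 \<le> \<tau>" "\<tau> < t" "\<And>u. \<tau> < u \<Longrightarrow> u \<le> t \<Longrightarrow> pos u \<omega> \<in> G"
          using sojourn_stays[OF _ t(1,3)] elim by blast
        have "((\<lambda>s. pos s \<omega>) \<longlongrightarrow> pos t \<omega>) (at_left t)"
          using elim \<tau> t(3) by (simp add: G)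
        moreover have "((\<lambda>s. pos s \<omega>) \<longlongrightarrow> pos t \<omega>) (at_right t)"
          using elim t by (intro path_right_limit) auto
        ultimately have "((\<lambda>s. pos s \<omega>) \<longlongrightarrow> pos t \<omega>) (at t)"
          by (simp add: filterlim_at_split)
        then show "((\<lambda>s. pos s \<omega>) \<longlongrightarrow> pos t \<omega>) (at t within {t \<in> sojourn S Z G \<G> \<omega>. 0 \<le> t \<and> ereal t < lifetime Z \<omega>})"
          by (rule tendsto_within_subset) simp
      qed
    qed
  qed
  ultimately show ?thesis
    unfolding diffusion_qe_def quasi_everywhere_def by blast
qed

end

section \<open>Smooth functions with compact support\<close>

text \<open>Differentiability to order \<open>k\<close> on the line, in a recursive form that
  matches the recursion of \<open>C_k\<close> factor by factor.\<close>

primrec smooth_upto :: "nat \<Rightarrow> (real \<Rightarrow> real) \<Rightarrow> bool" where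
  "smooth_upto 0 f \<longleftrightarrow> continuous_on UNIV f"
| "smooth_upto (Suc k) f \<longleftrightarrow> (\<exists>f'. (\<forall>s. (f has_real_derivative f' s) (at s)) \<and> smooth_upto k f')"

lemma smooth_upto_Suc: "smooth_upto (Suc k) f \<Longrightarrow> smooth_upto k f"
proof (induction k arbitrary: f)
  case 0
  then show ?case
    by (auto simp: continuous_on_eq_continuous_at intro: DERIV_isCont)
next
  case (Suc k)
  from Suc.prems obtain f' where "\<forall>s. (f has_real_derivative f' s) (at s)" "smooth_upto (Suc k) f'"
    by auto
  then show ?case using Suc.IH by auto
qed

lemma smooth_upto_continuous: "smooth_upto k f \<Longrightarrow> continuous_on UNIV f"
proof (induction k)
  case (Suc k)
  then show ?case using smooth_upto_Suc by blast
qed simp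

lemma smooth_upto_const: "smooth_upto k (\<lambda>_. c)"
proof (induction k arbitrary: c)
  case (Suc k)
  then show ?case by (auto intro!: exI[of _ "\<lambda>_. 0"])
qed simp

lemma smooth_upto_add: "smooth_upto k f \<Longrightarrow> smooth_upto k g \<Longrightarrow> smooth_upto k (\<lambda>s. f s + g s)"
proof (induction k arbitrary: f g)
  case 0
  then show ?case by (auto intro: continuous_on_add)
next
  case (Suc k)
  from Suc.prems obtain f' g' where "\<forall>s. (f has_real_derivative f' s) (at s)" "smooth_upto k f'"
    "\<forall>s. (g has_real_derivative g' s) (at s)" "smooth_upto k g'" by auto
  then show ?case
    using Suc.IH[of f' g'] by (auto intro!: exI[of _ "\<lambda>s. f' s + g' s"] DERIV_add)
qed

lemma smooth_upto_mult: "smooth_upto k f \<Longrightarrow> smooth_upto k g \<Longrightarrow> smooth_upto k (\<lambda>s. f s * g s)"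
proof (induction k arbitrary: f g)
  case 0
  then show ?case by (auto intro: continuous_on_mult)
next
  case (Suc k)
  from Suc.prems obtain f' g' where f': "\<forall>s. (f has_real_derivative f' s) (at s)" "smooth_upto k f'"
    and g': "\<forall>s. (g has_real_derivative g' s) (at s)" "smooth_upto k g'" by auto
  have "smooth_upto k (\<lambda>s. f' s * g s + g' s * f s)"
    using Suc.IH smooth_upto_Suc[OF Suc.prems(1)] smooth_upto_Suc[OF Suc.prems(2)] f'(2) g'(2)
    by (intro smooth_upto_add) auto
  then show ?case
    using f'(1) g'(1) by (auto intro!: exI[of _ "\<lambda>s. f' s * g s + g' s * f s"] DERIV_mult)
qed

lemma smooth_upto_affine: "smooth_upto k f \<Longrightarrow> smooth_upto k (\<lambda>s. f (c * s + d))"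
proof (induction k arbitrary: f)
  case 0
  then show ?case
    by (auto intro!: continuous_on_compose2[of UNIV f UNIV "\<lambda>s. c * s + d"] continuous_intros)
next
  case (Suc k)
  from Suc.prems obtain f' where f': "\<forall>s. (f has_real_derivative f' s) (at s)" "smooth_upto k f'" by auto
  have "((\<lambda>s. f (c * s + d)) has_real_derivative f' (c * s + d) * c) (at s)" for s
    using f'(1) by (intro DERIV_chain2[of f]) (auto intro!: derivative_eq_intros)
  then show ?case
    using Suc.IH[OF f'(2)] smooth_upto_const[of k c]
    by (auto intro!: exI[of _ "\<lambda>s. f' (c * s + d) * c"] smooth_upto_mult)
qed

text \<open>A class closed under differentiation that contains the classical flat function,
  \<open>exp (- (1 / s))\<close> for positive \<open>s\<close>, as \<open>flat 1\<close>.\<close>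

definition flat :: "real poly \<Rightarrow> real \<Rightarrow> real" where
  "flat p s = (if 0 < s then poly p (1 / s) * exp (- (1 / s)) else 0)"

lemma poly_exp_tendsto_0: "((\<lambda>u::real. poly p u * exp (- u)) \<longlongrightarrow> 0) at_top"
proof -
  have "((\<lambda>u::real. \<Sum>i\<le>degree p. coeff p i * (u ^ i / exp u)) \<longlongrightarrow> (\<Sum>i\<le>degree p. coeff p i * 0)) at_top"
    by (intro tendsto_sum tendsto_mult tendsto_const tendsto_power_div_exp_0)
  moreover have "(\<Sum>i\<le>degree p. coeff p i * (u ^ i / exp u)) = poly p u * exp (- u)" for u :: real
    by (simp add: poly_altdef sum_distrib_right exp_minus divide_inverse mult.assoc)
  ultimately show ?thesis by simp
qed

text \<open>The factor \<open>[:0, 0, 1:]\<close> stands for the \<open>1 / s^2\<close> that comes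
  from differentiating \<open>1 / s\<close>, and \<open>p - pderiv p\<close> collects the two terms
  of the product rule. At 0 the exponential beats every polynomial in \<open>1 / s\<close>.\<close>

lemma flat_derivative:
  "(flat p has_real_derivative flat ([:0, 0, 1:] * (p - pderiv p)) s) (at s)"
proof -
  consider "0 < s" | "s < 0" | "s = 0" by linarith
  then show ?thesis
  proof cases
    case 1
    have "((\<lambda>s. poly p (1 / s) * exp (- (1 / s))) has_real_derivative flat ([:0, 0, 1:] * (p - pderiv p)) s) (at s)"
      using 1 unfolding flat_def
      by (auto intro!: derivative_eq_intros DERIV_chain2[OF poly_DERIV] simp: field_simps power2_eq_square)
    then show ?thesis
      by (rule has_field_derivative_transform_within_open[of _ _ _ "{0<..}"]) (use 1 in \<open>auto simp: flat_def\<close>)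
  next
    case 2
    have "((\<lambda>_. 0) has_real_derivative flat ([:0, 0, 1:] * (p - pderiv p)) s) (at s)"
      using 2 by (simp add: flat_def)
    then show ?thesis
      by (rule has_field_derivative_transform_within_open[of _ _ _ "{..<0}"]) (use 2 in \<open>auto simp: flat_def\<close>)
  next
    case 3
    \<comment> \<open>With \<open>u = 1 / h\<close> the difference quotient at 0 is
      \<open>u * poly p u * exp (- u)\<close>; the extra \<open>u\<close> is the factor
      \<open>[:0, 1:]\<close>.\<close>
    have "((\<lambda>h. poly ([:0, 1:] * p) (inverse h) * exp (- inverse h)) \<longlongrightarrow> 0) (at_right (0::real))"
      by (rule filterlim_compose[OF poly_exp_tendsto_0 filterlim_inverse_at_top_right])
    then have "((\<lambda>h. flat p h / h) \<longlongrightarrow> 0) (at_right 0)"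
      by (rule Lim_transform_eventually)
         (auto simp: eventually_at_right_field flat_def field_simps intro!: exI[of _ 1])
    moreover have "((\<lambda>h. flat p h / h) \<longlongrightarrow> 0) (at_left 0)"
      by (rule Lim_transform_eventually[OF tendsto_const])
         (auto simp: eventually_at_left_field flat_def intro!: exI[of _ "-1"])
    ultimately have "((\<lambda>h. flat p h / h) \<longlongrightarrow> 0) (at 0)"
      by (simp add: filterlim_at_split)
    then show ?thesis
      unfolding DERIV_def using 3 by (simp add: flat_def)
  qed
qed

lemma smooth_upto_flat: "smooth_upto k (flat p)"
proof (induction k arbitrary: p)
  case 0
  show ?case
    using flat_derivative by (auto simp: continuous_on_eq_continuous_at intro: DERIV_isCont)
next
  case (Suc k)
  then show ?case using flat_derivative by auto
qed

definition bump :: "real \<Rightarrow> real \<Rightarrow> real \<Rightarrow> real" where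
  "bump a b s = flat 1 (s - a) * flat 1 (b - s)"

lemma smooth_upto_bump: "smooth_upto k (bump a b)"
proof -
  have "smooth_upto k (\<lambda>s. flat 1 (1 * s + - a) * flat 1 (- 1 * s + b))"
    by (intro smooth_upto_mult smooth_upto_affine smooth_upto_flat)
  then show ?thesis by (simp add: bump_def[abs_def])
qed

lemma bump_pos: "a < s \<Longrightarrow> s < b \<Longrightarrow> 0 < bump a b s"
  by (simp add: bump_def flat_def)

lemma bump_zero: "\<not> (a < s \<and> s < b) \<Longrightarrow> bump a b s = 0"
  by (auto simp: bump_def flat_def)

lemma bump_nonneg: "0 \<le> bump a b s"
  by (simp add: bump_def flat_def)

lemma bump_le_1: "bump a b s \<le> 1"
proof -
  have "flat 1 r \<le> 1" "0 \<le> flat 1 r" for r by (auto simp: flat_def)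
  then show ?thesis unfolding bump_def by (intro mult_le_one) auto
qed

lemma continuous_on_prod_coordinates:
  fixes B :: "nat \<Rightarrow> real \<Rightarrow> real"
  assumes "\<And>i. continuous_on UNIV (B i)"
  shows "continuous_on A (\<lambda>z. \<Prod>i\<le>n. B i (z i))"
proof (intro continuous_on_prod)
  fix i
  have "continuous_on A (\<lambda>z. z i)"
    by (rule continuous_on_product_coordinates[THEN continuous_on_subset]) simp
  then show "continuous_on A (\<lambda>z. B i (z i))"
    by (intro continuous_on_compose2[OF assms]) auto
qed

text \<open>A partial derivative replaces one factor by its derivative, so products of one-variable
  functions are stable under differentiation; derivatives on the line restrict to \<open>I\<close>,
  one-sided at its end points.\<close>

lemma C_k_prod:
  assumes "\<And>i. smooth_upto k (B i)"
  shows "C_k I n k (\<lambda>z. \<Prod>i\<le>n. B i (z i))"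
  using assms
proof (induction k arbitrary: B)
  case 0
  then show ?case using continuous_on_prod_coordinates by simp
next
  case (Suc k)
  have "\<exists>\<psi>. C_k I n k \<psi> \<and> (\<forall>z\<in>time_space I n. ((\<lambda>s. \<Prod>j\<le>n. B j ((z(i := s)) j)) has_real_derivative \<psi> z)
            (at (z i) within {s. z(i := s) \<in> time_space I n}))" if i: "i \<le> n" for i
  proof -
    obtain B' where B': "\<And>s. (B i has_real_derivative B' s) (at s)" "smooth_upto k B'"
      using Suc.prems[of i] by auto
    let ?\<psi> = "\<lambda>z. \<Prod>j\<le>n. (B(i := B')) j (z j)"
    have "C_k I n k ?\<psi>"
      using B'(2) smooth_upto_Suc[OF Suc.prems] by (intro Suc.IH) auto
    moreover have "((\<lambda>s. \<Prod>j\<le>n. B j ((z(i := s)) j)) has_real_derivative ?\<psi> z) (at (z i) within A)" for z A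
    proof -
      define c where "c = (\<Prod>j\<in>{..n} - {i}. B j (z j))"
      have 1: "(\<Prod>j\<le>n. B j ((z(i := s)) j)) = B i s * c" for s
        using i unfolding c_def by (subst prod.remove[of _ i]) (auto intro!: prod.cong)
      have 2: "?\<psi> z = B' (z i) * c"
        using i unfolding c_def by (subst prod.remove[of _ i]) (auto intro!: prod.cong)
      show ?thesis
        unfolding 1 2 using B'(1) by (intro DERIV_cmult_right) (rule has_field_derivative_at_within)
    qed
    ultimately show ?thesis by blast
  qed
  then show ?case
    using continuous_on_prod_coordinates[OF smooth_upto_continuous[OF Suc.prems]] by simp
qed

text \<open>Tychonoff's theorem, in the product topology that \<open>C_c_inf\<close> refers
  to.\<close>

lemma compact_box:
  assumes "\<And>i. compact (F i :: real set)"
  shows "compact {z :: nat \<Rightarrow> real. \<forall>i. z i \<in> F i}"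
proof -
  have "compactin (product_topology (\<lambda>i. euclidean) UNIV) (PiE UNIV F)"
    using assms by (simp add: compactin_PiE)
  moreover have "PiE UNIV F = {z. \<forall>i. z i \<in> F i}" by (auto simp: PiE_def)
  ultimately show ?thesis
    by (simp only: euclidean_product_topology compactin_euclidean_iff)
qed

text \<open>Compactness is asked of the time side only, since \<open>I\<close> need not be closed;
  the bump may well be positive at an end point belonging to \<open>I\<close>.\<close>

lemma C_c_inf_bump:
  assumes "compact (I \<inter> {a 0..b 0})"
  shows "C_c_inf I n (\<lambda>z. \<Prod>i\<le>n. bump (a i) (b i) (z i))"
  unfolding C_c_inf_def
proof (intro conjI allI exI ballI)
  show "C_k I n k (\<lambda>z. \<Prod>i\<le>n. bump (a i) (b i) (z i))" for k
    by (intro C_k_prod smooth_upto_bump)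
  \<comment> \<open>Coordinates beyond \<open>n\<close> are confined to 0, as in
    \<open>time_space\<close>, so that every side of the box is compact.\<close>
  define F where "F i = (if i = 0 then I \<inter> {a 0..b 0} else if i \<le> n then {a i..b i} else {0})" for i
  let ?K = "{z :: nat \<Rightarrow> real. \<forall>i. z i \<in> F i}"
  show "compact ?K" using assms by (intro compact_box) (simp add: F_def)
  show "?K \<subseteq> time_space I n"
  proof
    fix z assume "z \<in> ?K"
    then have "z i \<in> F i" for i by simp
    from this[of 0] this show "z \<in> time_space I n"
      unfolding time_space_def F_def by (auto split: if_splits) (metis not_less_zero not_le singletonD)
  qed
  fix z assume z: "z \<in> time_space I n - ?K"
  then obtain i where i: "z i \<notin> F i" by auto
  have "i \<le> n \<and> \<not> (a i < z i \<and> z i < b i)"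
    using i z unfolding F_def time_space_def by (auto split: if_splits simp: not_le)
  then show "(\<Prod>i\<le>n. bump (a i) (b i) (z i)) = 0"
    using bump_zero by (intro prod_zero) auto
qed

section \<open>Orthonormal bases\<close>

text \<open>One Gram-Schmidt step without normalisation. The new vector may be 0, and a zero vector
  in \<open>C\<close> is harmless because division by 0 gives 0.\<close>

lemma orthogonal_extension_step:
  fixes a :: "'a::real_inner"
  assumes "finite C" "pairwise orthogonal C"
  shows "\<exists>y. pairwise orthogonal (insert y C) \<and> span (insert y C) = span (insert a C)"
proof -
  define p where "p = (\<Sum>x\<in>C. (x \<bullet> a / (x \<bullet> x)) *\<^sub>R x)"
  have p: "p \<in> span C" unfolding p_def by (intro span_sum span_scale span_base)
  have "orthogonal (a - p) c" if c: "c \<in> C" for c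
  proof -
    have "p \<bullet> c = (\<Sum>x\<in>C. (x \<bullet> a / (x \<bullet> x)) * (x \<bullet> c))" by (simp add: p_def inner_sum_left)
    also have "\<dots> = (\<Sum>x\<in>C. if x = c then c \<bullet> a else 0)"
    proof (rule sum.cong[OF refl])
      fix x assume "x \<in> C"
      then show "(x \<bullet> a / (x \<bullet> x)) * (x \<bullet> c) = (if x = c then c \<bullet> a else 0)"
        using assms(2) c by (auto simp: pairwise_def orthogonal_def)
    qed
    also have "\<dots> = c \<bullet> a" using assms(1) c by simp
    finally have "(a - p) \<bullet> c = 0" by (simp add: inner_diff_left inner_commute[of a c])
    then show ?thesis by (simp add: orthogonal_def)
  qed
  then have "pairwise orthogonal (insert (a - p) C)"
    by (intro pairwise_orthogonal_insert assms)
  moreover have "span (insert (a - p) C) = span (insert a C)"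
  proof (rule span_eq[THEN iffD2, OF conjI])
    have "a - p \<in> span (insert a C)"
      using p span_mono[of C "insert a C"] by (intro span_diff) (auto intro: span_base)
    then show "insert (a - p) C \<subseteq> span (insert a C)" by (auto intro: span_base)
    have "(a - p) + p \<in> span (insert (a - p) C)"
      using p span_mono[of C "insert (a - p) C"] by (intro span_add) (auto intro: span_base)
    then show "insert a C \<subseteq> span (insert (a - p) C)" by (auto intro: span_base)
  qed
  ultimately show ?thesis by blast
qed

text \<open>The definite description in \<open>op_trace\<close> quantifies over all orthonormal
  bases, so without one it would determine no value. Gram-Schmidt runs along the total sequence;
  zero vectors are then dropped and the others normalised.\<close>

lemma ex_orthonormal_basis:
  fixes e :: "nat \<Rightarrow> 'a::real_inner"
  assumes "closure (span (range e)) = UNIV"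
  shows "\<exists>B::'a set. orthonormal_basis B"
proof -
  have "\<exists>C. \<forall>n. (finite (C n) \<and> pairwise orthogonal (C n) \<and> span (C n) = span (e ` {..<n})) \<and> C n \<subseteq> C (Suc n)"
  proof (rule dependent_nat_choice)
    show "\<exists>C. finite C \<and> pairwise orthogonal C \<and> span C = span (e ` {..<0})"
      by (intro exI[of _ "{}"]) auto
    fix C n assume C: "finite C \<and> pairwise orthogonal C \<and> span C = span (e ` {..<n})"
    then obtain y where "pairwise orthogonal (insert y C)" "span (insert y C) = span (insert (e n) C)"
      using orthogonal_extension_step by blast
    moreover have "span (insert (e n) C) = span (e ` {..<Suc n})"
      using C unfolding lessThan_Suc image_insert span_insert by simp
    ultimately show "\<exists>D. (finite D \<and> pairwise orthogonal D \<and> span D = span (e ` {..<Suc n})) \<and> C \<subseteq> D"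
      using C by (intro exI[of _ "insert y C"]) auto
  qed
  then obtain C where C: "\<And>n. pairwise orthogonal (C n)" "\<And>n. span (C n) = span (e ` {..<n})" "\<And>n. C n \<subseteq> C (Suc n)"
    by blast
  have mono: "C i \<subseteq> C j" if "i \<le> j" for i j
    using C(3) that by (rule lift_Suc_mono_le)
  define U where "U = (\<Union>n. C n)"
  have U: "pairwise orthogonal U"
    unfolding pairwise_def
  proof (intro ballI impI)
    fix x y assume "x \<in> U" "y \<in> U" "x \<noteq> y"
    then obtain i j where "x \<in> C i" "y \<in> C j" by (auto simp: U_def)
    then have "x \<in> C (max i j)" "y \<in> C (max i j)" using mono by (meson max.cobounded1 max.cobounded2 subsetD)+
    then show "orthogonal x y" using C(1)[of "max i j"] \<open>x \<noteq> y\<close> by (auto simp: pairwise_def)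
  qed
  define B where "B = (\<lambda>x. (1 / norm x) *\<^sub>R x) ` (U - {0})"
  have "U \<subseteq> span B"
  proof
    fix x assume x: "x \<in> U"
    show "x \<in> span B"
    proof (cases "x = 0")
      case False
      then have "norm x *\<^sub>R ((1 / norm x) *\<^sub>R x) \<in> span B"
        using x by (intro span_scale span_base) (auto simp: B_def)
      then show ?thesis using False by simp
    qed (simp add: span_zero)
  qed
  moreover have "range e \<subseteq> span U"
  proof safe
    fix n
    have "e n \<in> span (C (Suc n))" unfolding C(2) by (intro span_base) auto
    then show "e n \<in> span U" using span_mono[of "C (Suc n)" U] by (auto simp: U_def)
  qed
  ultimately have "span (range e) \<subseteq> span B"
    by (metis span_minimal span_mono span_span subspace_span order_trans)
  then have "closure (span B) = UNIV" using closure_mono assms by blast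
  moreover have "pairwise orthogonal B"
    using U unfolding B_def pairwise_def by (auto simp: orthogonal_def)
  moreover have "\<forall>u\<in>B. norm u = 1" by (auto simp: B_def)
  ultimately show ?thesis unfolding orthonormal_basis_def by blast
qed

lemma op_trace_zero:
  assumes "\<exists>B::'h::real_inner set. orthonormal_basis B"
  shows "op_trace (\<lambda>_::'h. 0) = 0"
  unfolding op_trace_def
proof (rule the_equality)
  show "\<forall>B::'h set. orthonormal_basis B \<longrightarrow> ((\<lambda>u. 0 \<bullet> u) has_sum (0::real)) B" by simp
  fix s :: real assume s: "\<forall>B::'h set. orthonormal_basis B \<longrightarrow> ((\<lambda>u. 0 \<bullet> u) has_sum s) B"
  obtain B :: "'h set" where "orthonormal_basis B" using assms by blast
  with s have "((\<lambda>u. 0) has_sum s) B" by simp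
  then show "s = 0" using has_sum_unique has_sum_0_simp by blast
qed

section \<open>Locality of the operator\<close>

lemma grad_eqI:
  fixes f :: "'h::real_inner \<Rightarrow> real"
  assumes "GDERIV f x :> D"
  shows "grad f x = D"
  unfolding grad_def
proof (rule the_equality)
  fix D' assume "GDERIV f x :> D'"
  then have "(\<lambda>h. h \<bullet> D') = (\<lambda>h. h \<bullet> D)"
    using assms unfolding gderiv_def by (rule has_derivative_unique)
  then show "D' = D" by (metis inner_commute vector_eq_ldot)
qed (fact assms)

lemma grad_zero_near:
  fixes f :: "'h::real_inner \<Rightarrow> real"
  assumes "\<And>y. y \<in> ball x \<epsilon> \<Longrightarrow> f y = 0" "y \<in> ball x \<epsilon>"
  shows "grad f y = 0"
proof (rule grad_eqI)
  have "((\<lambda>_. 0) has_derivative (\<lambda>h. h \<bullet> 0)) (at y)" by simp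
  then show "GDERIV f y :> 0"
    unfolding gderiv_def
    by (rule has_derivative_transform_within_open[OF _ open_ball assms(2)]) (simp add: assms(1))
qed

lemma hessian_zero_near:
  fixes f :: "'h::real_inner \<Rightarrow> real"
  assumes "\<And>y. y \<in> ball x \<epsilon> \<Longrightarrow> f y = 0" "0 < \<epsilon>"
  shows "hessian f x h = 0"
proof -
  have "((\<lambda>_. 0) has_derivative (\<lambda>h. 0)) (at x)" by simp
  then have "(grad f has_derivative (\<lambda>h. 0)) (at x)"
    by (rule has_derivative_transform_within_open[OF _ open_ball[of x \<epsilon>]])
       (use assms(2) grad_zero_near[OF assms(1)] in auto)
  then show ?thesis unfolding hessian_def by (metis frechet_derivative_at)
qed

text \<open>Density of the domain leaves 0 as the only vector orthogonal to it, so the definite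
  description is determined.\<close>

lemma adjoint_op_zero:
  assumes "densely_defined D A"
  shows "adjoint_op D A 0 = 0"
  unfolding adjoint_op_def
proof (rule the_equality)
  fix z assume z: "\<forall>x\<in>D. A x \<bullet> 0 = x \<bullet> z"
  have "closed {x. x \<bullet> z = 0}" by (intro closed_Collect_eq continuous_intros)
  moreover have "D \<subseteq> {x. x \<bullet> z = 0}" using z by auto
  ultimately have "closure D \<subseteq> {x. x \<bullet> z = 0}" by (rule closure_minimal[rotated])
  then have "z \<in> {x. x \<bullet> z = 0}" using assms unfolding densely_defined_def by blast
  then show "z = 0" by simp
qed simp

text \<open>The first three terms involve only derivatives at \<open>x\<close>, which vanish; the
  integral term sees \<open>f\<close> far from \<open>x\<close> and vanishes because the measure
  does.\<close>

lemma L_op_zero_near: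
  fixes f :: "'h::real_inner \<Rightarrow> real"
  assumes f: "\<And>y. y \<in> ball x \<epsilon> \<Longrightarrow> f y = 0" and \<epsilon>: "0 < \<epsilon>"
    and D: "densely_defined (DA t) (A t)" and n: "n t x = null_measure borel"
    and B: "\<exists>B::'h set. orthonormal_basis B"
  shows "L_op \<sigma> DA A b n t f x = 0"
proof -
  have "hessian f x h = 0" for h by (rule hessian_zero_near[OF f \<epsilon>])
  moreover have "grad f x = 0" by (rule grad_zero_near[OF f]) (use \<epsilon> in auto)
  moreover have "(\<integral>y. g y \<partial>null_measure borel) = 0" for g :: "'h \<Rightarrow> real"
  proof (rule integral_eq_zero_AE, rule AE_I')
    show "UNIV \<in> null_sets (null_measure (borel :: 'h measure))" by (simp add: null_sets_def)
  qed simp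
  ultimately show ?thesis
    unfolding L_op_def n by (simp add: op_trace_zero[OF B] adjoint_op_zero[OF D])
qed

text \<open>An interval with interior points has no isolated point, so the derivative within
  \<open>I\<close> is unique, also where it is one-sided.\<close>

lemma parabolic_op_zero_near:
  fixes f :: "real \<times> 'h::real_inner \<Rightarrow> real"
  assumes f: "\<And>q. q \<in> ball (t, x) \<epsilon> \<Longrightarrow> f q = 0" and \<epsilon>: "0 < \<epsilon>"
    and I: "is_interval I" "interior I \<noteq> {}" "t \<in> I"
    and D: "densely_defined (DA t) (A t)" and n: "n t x = null_measure borel"
    and B: "\<exists>B::'h set. orthonormal_basis B"
  shows "parabolic_op I \<sigma> DA A b n f (t, x) = 0"
proof -
  have "L_op \<sigma> DA A b n t (\<lambda>y. f (t, y)) x = 0"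
    using \<epsilon> D n B by (intro L_op_zero_near[where \<epsilon> = \<epsilon>]) (auto intro!: f simp: dist_Pair_Pair)
  moreover have "vector_derivative (\<lambda>s. f (s, x)) (at t within I) = 0"
  proof (rule vector_derivative_within)
    have "\<nexists>a. I = {a}" using I(2) by (metis interior_singleton)
    then have "t islimpt I"
      using I by (intro connected_imp_perfect) (auto simp: is_interval_connected)
    then show "at t within I \<noteq> bot" by (simp add: trivial_limit_within)
    have "((\<lambda>_. 0) has_vector_derivative 0) (at t within I)" by simp
    then show "((\<lambda>s. f (s, x)) has_vector_derivative 0) (at t within I)"
      unfolding has_vector_derivative_def
    proof (rule has_derivative_transform_within[OF _ \<epsilon> I(3)])
      fix s assume "dist s t < \<epsilon>"
      then have "(s, x) \<in> ball (t, x) \<epsilon>" by (simp add: dist_Pair_Pair dist_commute)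
      then show "0 = f (s, x)" using f by simp
    qed
  qed
  ultimately show ?thesis by (simp add: parabolic_op_def)
qed

section \<open>A countable separating family of test functions\<close>

text \<open>Time is coordinate 0, as in \<open>time_space\<close>, so that separation in time and in
  space can be treated alike.\<close>

definition coordinate :: "(nat \<Rightarrow> 'h::real_inner) \<Rightarrow> nat \<Rightarrow> real \<times> 'h \<Rightarrow> real" where
  "coordinate e i q = (if i = 0 then fst q else snd q \<bullet> e i)"

definition bump_test :: "(nat \<Rightarrow> 'h::real_inner) \<Rightarrow> nat \<Rightarrow> (nat \<Rightarrow> real) \<Rightarrow> (nat \<Rightarrow> real) \<Rightarrow> real \<times> 'h \<Rightarrow> real" where
  "bump_test e n a b q = (\<Prod>i\<le>n. bump (a i) (b i) (coordinate e i q))"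

lemma continuous_coordinate: "continuous_on UNIV (coordinate e i)"
  unfolding coordinate_def[abs_def] by (cases "i = 0") (auto intro!: continuous_intros)

lemma bump_test_continuous: "continuous_on UNIV (bump_test e n a b)"
  unfolding bump_test_def[abs_def]
  by (intro continuous_on_prod continuous_on_compose2[OF smooth_upto_continuous[OF smooth_upto_bump[of 0]] continuous_coordinate]) auto

lemma bump_test_bounds: "0 \<le> bump_test e n a b q" "bump_test e n a b q \<le> 1"
  unfolding bump_test_def by (auto intro!: prod_nonneg prod_le_1 bump_nonneg bump_le_1)

lemma bump_test_in_test_functions:
  assumes "1 \<le> n" "compact (I \<inter> {a 0..b 0})"
  shows "bump_test e n a b \<in> test_functions I e"
  unfolding test_functions_def
proof (intro CollectI exI conjI ballI allI)
  show "C_c_inf I n (\<lambda>z. \<Prod>i\<le>n. bump (a i) (b i) (z i))" by (rule C_c_inf_bump[of I a b n, OF assms(2)])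
  show "bump_test e n a b (t, x) = (\<Prod>i\<le>n. bump (a i) (b i) (if i = 0 then t else if i \<le> n then x \<bullet> e i else 0))" for t x
    unfolding bump_test_def coordinate_def by (intro prod.cong) auto
qed (fact assms)

text \<open>On a side where \<open>I\<close> extends beyond \<open>t\<close>, a short closed
  interval lies in \<open>I\<close>; on a side where \<open>I\<close> ends at \<open>t\<close>, the
  intersection is the single point \<open>t\<close>. Rational ends keep the resulting family
  countable.\<close>

lemma interval_compact_neighbourhood:
  assumes I: "is_interval I" "t \<in> I" and d: "0 < (d::real)"
  obtains a b :: rat where "of_rat a < t" "t < of_rat b" "t - d < of_rat a" "of_rat b < t + d"
    "compact (I \<inter> {of_rat a..of_rat b})"
proof -
  have "\<exists>b::rat. t < of_rat b \<and> of_rat b < t + d \<and> compact (I \<inter> {t..of_rat b})"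
  proof (cases "\<exists>u\<in>I. t < u")
    case True
    then obtain u where u: "u \<in> I" "t < u" by blast
    obtain b :: rat where b: "t < of_rat b" "of_rat b < min u (t + d)"
      using of_rat_dense[of t "min u (t + d)"] u d by auto
    have "{t..of_rat b} \<subseteq> I"
      using u b by (auto intro: mem_is_interval_1_I[OF I(1) I(2) u(1)])
    then have "I \<inter> {t..of_rat b} = {t..of_rat b}" by auto
    then show ?thesis using b by auto
  next
    case False
    obtain b :: rat where b: "t < of_rat b" "of_rat b < t + d"
      using of_rat_dense[of t "t + d"] d by auto
    have "I \<inter> {t..of_rat b} = {t}" using False I(2) b by force
    then show ?thesis using b by auto
  qed
  moreover have "\<exists>a::rat. of_rat a < t \<and> t - d < of_rat a \<and> compact (I \<inter> {of_rat a..t})"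
  proof (cases "\<exists>u\<in>I. u < t")
    case True
    then obtain u where u: "u \<in> I" "u < t" by blast
    obtain a :: rat where a: "max u (t - d) < of_rat a" "of_rat a < t"
      using of_rat_dense[of "max u (t - d)" t] u d by auto
    have "{of_rat a..t} \<subseteq> I"
      using u a by (auto intro: mem_is_interval_1_I[OF I(1) u(1) I(2)])
    then have "I \<inter> {of_rat a..t} = {of_rat a..t}" by auto
    then show ?thesis using a by auto
  next
    case False
    obtain a :: rat where a: "t - d < of_rat a" "of_rat a < t"
      using of_rat_dense[of "t - d" t] d by auto
    have "I \<inter> {of_rat a..t} = {t}" using False I(2) a by force
    then show ?thesis using a by auto
  qed
  ultimately obtain a b :: rat where ab: "t < of_rat b" "of_rat b < t + d" "compact (I \<inter> {t..of_rat b})"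
    "of_rat a < t" "t - d < of_rat a" "compact (I \<inter> {of_rat a..t})" by blast
  have "I \<inter> {of_rat a..of_rat b} = (I \<inter> {of_rat a..t}) \<union> (I \<inter> {t..of_rat b})"
    using ab by auto
  then have "compact (I \<inter> {of_rat a..of_rat b})" using ab by (simp add: compact_Un)
  with ab that show thesis by blast
qed

text \<open>If the times agree, the difference of the space parts is a nonzero vector, which cannot
  be orthogonal to a total sequence.\<close>

lemma coordinates_separate:
  fixes e :: "nat \<Rightarrow> 'h::real_inner"
  assumes "closure (span (e ` {1..})) = UNIV" "y \<noteq> z"
  obtains c where "coordinate e c y \<noteq> coordinate e c z"
proof (cases "fst y = fst z")
  case False
  then show ?thesis using that[of 0] by (simp add: coordinate_def)
next
  case True
  define w where "w = snd y - snd z"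
  have w: "w \<noteq> 0" using True assms(2) by (auto simp: w_def prod_eq_iff)
  have "\<exists>i\<ge>1. w \<bullet> e i \<noteq> 0"
  proof (rule ccontr)
    assume "\<not> (\<exists>i\<ge>1. w \<bullet> e i \<noteq> 0)"
    then have "e ` {1..} \<subseteq> {v. w \<bullet> v = 0}" by auto
    then have "span (e ` {1..}) \<subseteq> {v. w \<bullet> v = 0}"
      by (intro span_minimal) (auto simp: subspace_def inner_add_right)
    moreover have "closed {v. w \<bullet> v = 0}" by (intro closed_Collect_eq continuous_intros)
    ultimately have "closure (span (e ` {1..})) \<subseteq> {v. w \<bullet> v = 0}" by (rule closure_minimal)
    then have "w \<in> {v. w \<bullet> v = 0}" using assms(1) by blast
    then show False using w by simp
  qed
  then obtain i where "1 \<le> i" "w \<bullet> e i \<noteq> 0" by blast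
  then show ?thesis using that[of i] by (auto simp: coordinate_def w_def inner_diff_left)
qed

lemma separating_test_functions:
  fixes e :: "nat \<Rightarrow> 'h::real_inner"
  assumes e: "closure (span (e ` {1..})) = UNIV" and I: "is_interval I"
  obtains \<T> where "countable \<T>" "\<T> \<subseteq> test_functions I e"
    "\<And>\<psi>. \<psi> \<in> \<T> \<Longrightarrow> continuous_on UNIV \<psi>" "\<And>\<psi> q. \<psi> \<in> \<T> \<Longrightarrow> 0 \<le> \<psi> q" "\<And>\<psi> q. \<psi> \<in> \<T> \<Longrightarrow> \<psi> q \<le> 1"
    "\<And>y z. fst z \<in> I \<Longrightarrow> y \<noteq> z \<Longrightarrow> \<exists>\<psi>\<in>\<T>. 0 < \<psi> z \<and> (\<exists>\<epsilon>>0. \<forall>q\<in>ball y \<epsilon>. \<psi> q = 0)"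
proof -
  \<comment> \<open>A parameter \<open>(c, k, a0, b0, a, b)\<close> stands for the box with sides \<open>(a0, b0)\<close> in time, \<open>(a, b)\<close> in
    the separated coordinate \<open>c\<close>, and \<open>(-k, k)\<close> in the others; \<open>c = 0\<close> means separation in time.\<close>
  define lo :: "nat \<times> nat \<times> rat \<times> rat \<times> rat \<times> rat \<Rightarrow> nat \<Rightarrow> real" where
    "lo = (\<lambda>(c, k, a0, b0, a, b) i. if i = 0 then of_rat a0 else if i = c then of_rat a else - real k)"
  define hi :: "nat \<times> nat \<times> rat \<times> rat \<times> rat \<times> rat \<Rightarrow> nat \<Rightarrow> real" where
    "hi = (\<lambda>(c, k, a0, b0, a, b) i. if i = 0 then of_rat b0 else if i = c then of_rat b else real k)"
  \<comment> \<open>The \<open>max 1\<close> is due to \<open>c = 0\<close>: a test function has to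
    use at least one space coordinate.\<close>
  define \<psi> where "\<psi> p = bump_test e (max 1 (fst p)) (lo p) (hi p)" for p
  define \<T> where "\<T> = \<psi> ` {p. compact (I \<inter> {lo p 0..hi p 0})}"
  have "countable \<T>" unfolding \<T>_def by simp
  moreover have "\<T> \<subseteq> test_functions I e"
    unfolding \<T>_def \<psi>_def by (auto intro!: bump_test_in_test_functions)
  moreover have "\<exists>\<psi>\<in>\<T>. 0 < \<psi> z \<and> (\<exists>\<epsilon>>0. \<forall>q\<in>ball y \<epsilon>. \<psi> q = 0)" if z: "fst z \<in> I" and yz: "y \<noteq> z" for y z
  proof -
    obtain c where c: "coordinate e c y \<noteq> coordinate e c z"
      using coordinates_separate[OF e yz] .
    \<comment> \<open>The sides of the box in time and in coordinate \<open>c\<close> stay within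
      \<open>d\<close> of \<open>z\<close>. In coordinate \<open>c\<close> this excludes the value
      of \<open>y\<close> even from the closed side, so the bump vanishes in a whole neighbourhood
      of \<open>y\<close>.\<close>
    define d where "d = \<bar>coordinate e c y - coordinate e c z\<bar>"
    have d: "0 < d" using c by (simp add: d_def)
    obtain a0 b0 :: rat where ab0: "of_rat a0 < fst z" "fst z < of_rat b0" "fst z - d < of_rat a0" "of_rat b0 < fst z + d"
      "compact (I \<inter> {of_rat a0..of_rat b0})"
      using interval_compact_neighbourhood[OF I z d] .
    obtain a :: rat where a: "coordinate e c z - d < of_rat a" "of_rat a < coordinate e c z"
      using of_rat_dense[of "coordinate e c z - d" "coordinate e c z"] d by auto
    obtain b :: rat where b: "coordinate e c z < of_rat b" "of_rat b < coordinate e c z + d"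
      using of_rat_dense[of "coordinate e c z" "coordinate e c z + d"] d by auto
    \<comment> \<open>Large enough for the box to contain \<open>z\<close> in all coordinates other
      than time and \<open>c\<close>.\<close>
    obtain k :: nat where k: "(\<Sum>i\<le>max 1 c. \<bar>coordinate e i z\<bar>) < real k"
      using reals_Archimedean2 by blast
    define p where "p = (c, k, a0, b0, a, b)"
    have zi: "lo p i < coordinate e i z \<and> coordinate e i z < hi p i" if "i \<le> max 1 c" for i
    proof -
      have "\<bar>coordinate e i z\<bar> \<le> (\<Sum>i\<le>max 1 c. \<bar>coordinate e i z\<bar>)"
        using that by (intro member_le_sum) auto
      then have "\<bar>coordinate e i z\<bar> < real k" using k by linarith
      then show ?thesis
        using ab0 a b by (auto simp: p_def lo_def hi_def coordinate_def[of e 0])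
    qed
    have "\<psi> p \<in> \<T>"
      using ab0(5) by (auto simp: \<T>_def p_def lo_def hi_def)
    moreover have "0 < \<psi> p z"
      using zi unfolding \<psi>_def bump_test_def p_def[symmetric] by (intro prod_pos bump_pos) (auto simp: p_def)
    moreover have "\<exists>\<epsilon>>0. \<forall>q\<in>ball y \<epsilon>. \<psi> p q = 0"
    proof -
      have yc: "coordinate e c y \<notin> {lo p c..hi p c}"
        using ab0 a b by (cases "c = 0") (auto simp: p_def lo_def hi_def d_def coordinate_def[of e 0])
      have "open (coordinate e c -` (- {lo p c..hi p c}))"
        using continuous_coordinate by (intro open_vimage) auto
      then obtain \<epsilon> where \<epsilon>: "0 < \<epsilon>" "ball y \<epsilon> \<subseteq> coordinate e c -` (- {lo p c..hi p c})"
        using yc open_contains_ball_eq by (metis ComplI vimageI2)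
      have "\<psi> p q = 0" if "q \<in> ball y \<epsilon>" for q
      proof -
        have "coordinate e c q \<notin> {lo p c..hi p c}" using \<epsilon>(2) that by auto
        then have "bump (lo p c) (hi p c) (coordinate e c q) = 0" by (intro bump_zero) auto
        then show ?thesis
          unfolding \<psi>_def bump_test_def by (intro prod_zero bexI[of _ c]) (auto simp: p_def)
      qed
      then show ?thesis using \<epsilon>(1) by blast
    qed
    ultimately show ?thesis by blast
  qed
  ultimately show thesis
    using bump_test_continuous bump_test_bounds
    by (intro that[of \<T>]) (auto simp: \<T>_def \<psi>_def)
qed

section \<open>Consequences of boundedness on Lebesgue spaces\<close>

lemma strongly_continuous_Lp_resolvent:
  assumes "strongly_continuous_Lp Z m p \<alpha>\<^sub>0" "\<alpha>\<^sub>0 < \<alpha>" "f \<in> Lp m p" "\<And>x. x \<in> space m \<Longrightarrow> 0 \<le> f x"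
  shows "AE x in m. resolvent Z \<alpha> (\<lambda>y. ennreal (f y)) x < \<top>"
  using assms unfolding strongly_continuous_Lp_def by (auto elim!: eventually_mono)

text \<open>The indicator of a null set has norm 0 in \<open>L^p\<close>, hence so has its image
  under the bounded extension, which the resolvent kernel represents almost everywhere.\<close>

lemma strongly_continuous_Lp_null:
  assumes sc: "strongly_continuous_Lp Z m p \<alpha>\<^sub>0" "\<alpha>\<^sub>0 < \<alpha>" and p: "1 \<le> p" and N: "N \<in> null_sets m"
  shows "AE x in m. resolvent Z \<alpha> (indicator N) x = 0"
proof -
  define f :: "_ \<Rightarrow> real" where "f = indicator N"
  have zero: "AE x in m. \<bar>f x\<bar> powr p = 0"
    using AE_not_in[OF N] by eventually_elim (simp add: f_def)
  have f_meas: "f \<in> borel_measurable m" using N by (auto simp: f_def)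
  have f: "f \<in> Lp m p"
    unfolding Lp_def
  proof (intro CollectI conjI f_meas integrable_cong_AE_imp[OF integrable_zero])
    show "(\<lambda>x. \<bar>f x\<bar> powr p) \<in> borel_measurable m" using f_meas by measurable
    show "AE x in m. 0 = \<bar>f x\<bar> powr p" using zero by eventually_elim simp
  qed
  have f0: "Lp_norm m p f = 0"
    using integral_eq_zero_AE[OF zero] p by (simp add: Lp_norm_def)
  obtain V where V: "bounded_Lp_operator m p V"
    "AE x in m. resolvent Z \<alpha> (\<lambda>y. ennreal (f y)) x < \<top> \<and> V f x = enn2real (resolvent Z \<alpha> (\<lambda>y. ennreal (f y)) x)"
    using sc f unfolding strongly_continuous_Lp_def by (auto simp: f_def)
  obtain C where C: "V f \<in> Lp m p" "Lp_norm m p (V f) \<le> C * Lp_norm m p f"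
    using V(1) f unfolding bounded_Lp_operator_def by blast
  have "(\<integral>x. \<bar>V f x\<bar> powr p \<partial>m) powr (1 / p) \<le> 0"
    using C(2) f0 by (simp add: Lp_norm_def)
  then have "(\<integral>x. \<bar>V f x\<bar> powr p \<partial>m) = 0"
    by (metis antisym powr_ge_zero powr_eq_0_iff)
  moreover have "integrable m (\<lambda>x. \<bar>V f x\<bar> powr p)" using C(1) by (simp add: Lp_def)
  ultimately have "AE x in m. \<bar>V f x\<bar> powr p = 0"
    by (subst (asm) integral_nonneg_eq_0_iff_AE) auto
  with V(2) show ?thesis
  proof eventually_elim
    case (elim x)
    \<comment> \<open>Finiteness of the resolvent matters here, because \<open>enn2real\<close>
      sends \<open>\<top>\<close> to 0 as well.\<close>
    then have "resolvent Z \<alpha> (\<lambda>y. ennreal (f y)) x = 0"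
      by (cases "resolvent Z \<alpha> (\<lambda>y. ennreal (f y)) x") auto
    then show ?case by (simp add: f_def ennreal_indicator)
  qed
qed

text \<open>The distance to the complement of an open set inducing \<open>G\<close>, or the constant
  1 if that complement is empty, where \<open>infdist\<close> would be 0.\<close>

lemma openin_positive_function:
  fixes S :: "'a::metric_space set"
  assumes "openin (top_of_set S) G"
  obtains \<delta> :: "'a \<Rightarrow> real" where "continuous_on UNIV \<delta>" "\<And>q. 0 \<le> \<delta> q" "G = {q \<in> S. 0 < \<delta> q}"
proof -
  obtain U where U: "open U" "G = S \<inter> U" using assms by (auto simp: openin_open)
  show thesis
  proof (cases "U = UNIV")
    case True
    then show ?thesis using U by (intro that[of "\<lambda>_. 1"]) auto
  next
    case False
    have "0 < infdist q (- U) \<longleftrightarrow> q \<in> U" for q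
      using False U(1) infdist_pos_not_in_closed[of "- U" q] by (cases "q \<in> U") auto
    then show ?thesis
      using U by (intro that[of "\<lambda>q. infdist q (- U)"]) (auto intro!: continuous_intros infdist_nonneg)
  qed
qed

theorem corollary4p1:
  fixes \<sigma> :: "real \<Rightarrow> 'h::{real_inner, banach, polish_space} \<Rightarrow> 'h \<Rightarrow>\<^sub>L 'h"
    and DA :: "real \<Rightarrow> 'h set" and A :: "real \<Rightarrow> 'h \<Rightarrow> 'h"
    and Db :: "'h set" and b :: "real \<Rightarrow> 'h \<Rightarrow> 'h"
    and n :: "real \<Rightarrow> 'h \<Rightarrow> 'h measure"
    and e :: "nat \<Rightarrow> 'h"
    and I :: "real set" and M :: "'h set"
    and X :: "('w, real \<times> 'h) process"
    and m :: "(real \<times> 'h) measure"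
    and p \<alpha>\<^sub>0 :: real
  defines "S \<equiv> I \<times> M"
    and "\<D> \<equiv> test_functions I e"
    and "L \<equiv> parabolic_op I \<sigma> DA A b n"
    and "F \<equiv> {(t, x). 0 \<le> t \<and> n t x = null_measure borel}"
  assumes sigma_symmetric: "\<And>t x u v. 0 \<le> t \<Longrightarrow>
        blinfun_apply (\<sigma> t x) u \<bullet> v = u \<bullet> blinfun_apply (\<sigma> t x) v"
    and sigma_measurable: "\<And>u. (\<lambda>(t, x). blinfun_apply (\<sigma> t x) u)
        \<in> borel_measurable (restrict_space borel ({0..} \<times> UNIV))"
    and A_densely_defined: "\<And>t. 0 \<le> t \<Longrightarrow> densely_defined (DA t) (A t)"
    and e_in_domain: "\<And>i t. 1 \<le> i \<Longrightarrow> 0 \<le> t \<Longrightarrow> e i \<in> adjoint_domain (DA t) (A t)"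
    and e_total: "closure (span (e ` {1..})) = UNIV"
    and A_adjoint_measurable: "\<And>x. x \<in> (\<Inter>t\<in>{0..}. adjoint_domain (DA t) (A t)) \<Longrightarrow>
        (\<lambda>t. adjoint_op (DA t) (A t) x) \<in> borel_measurable (restrict_space borel {0..})"
    and Db_borel: "Db \<in> sets borel"
    and b_measurable: "(\<lambda>(t, x). b t x) \<in> borel_measurable (restrict_space borel ({0..} \<times> Db))"
    and n_levy: "\<And>t x. 0 \<le> t \<Longrightarrow> levy_measure (n t x)"
    and n_measurable: "\<And>B. B \<in> sets borel \<Longrightarrow>
        (\<lambda>(t, x). \<integral>\<^sup>+y\<in>B. ennreal (min 1 ((norm y)\<^sup>2)) \<partial>n t x)
          \<in> borel_measurable (restrict_space borel ({0..} \<times> UNIV))"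
    and I_interval: "is_interval I" "interior I \<noteq> {}" "I \<subseteq> {0..}"
    and M_borel: "M \<in> sets borel" "M \<subseteq> Db"
    and X_right: "right_process S X"
    and X_cadlag: "cadlag S X"
    and m_measure: "sets m = sets (restrict_space borel S)" "sigma_finite_measure m"
    and p: "1 \<le> p"
    and resolvent_Lp: "0 < \<alpha>\<^sub>0" "strongly_continuous_Lp X m p \<alpha>\<^sub>0"
    and test_Lp: "\<D> \<union> L ` \<D> \<subseteq> Lp m p"
    and martingale_problem: "solves_martingale_problem S X m \<D> L"
  shows "diffusion_qe S X m (top_of_set S interior_of (F \<inter> S))"
proof -
  let ?G = "top_of_set S interior_of (F \<inter> S)"
  have "openin (top_of_set S) ?G" by (rule openin_interior_of)
  then obtain \<delta> :: "real \<times> 'h \<Rightarrow> real" where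
    \<delta>: "continuous_on UNIV \<delta>" "\<And>q. 0 \<le> \<delta> q" "?G = {q \<in> S. 0 < \<delta> q}"
    by (rule openin_positive_function) blast
  obtain \<T> where \<T>: "countable \<T>" "\<T> \<subseteq> \<D>"
    "\<And>\<psi>. \<psi> \<in> \<T> \<Longrightarrow> continuous_on UNIV \<psi>" "\<And>\<psi> q. \<psi> \<in> \<T> \<Longrightarrow> 0 \<le> \<psi> q" "\<And>\<psi> q. \<psi> \<in> \<T> \<Longrightarrow> \<psi> q \<le> 1"
    "\<And>y z. fst z \<in> I \<Longrightarrow> y \<noteq> z \<Longrightarrow> \<exists>\<psi>\<in>\<T>. 0 < \<psi> z \<and> (\<exists>\<epsilon>>0. \<forall>q\<in>ball y \<epsilon>. \<psi> q = 0)"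
    unfolding \<D>_def using separating_test_functions[OF e_total I_interval(1)] by blast
  have "UNIV = closure (span (e ` {1..}))" using e_total by simp
  also have "\<dots> \<subseteq> closure (span (range e))" by (intro closure_mono span_mono) auto
  finally have "\<exists>B::'h set. orthonormal_basis B" by (intro ex_orthonormal_basis) auto
  note onb = this
  have "metric_right_process S X" using X_right by (rule metric_right_process.intro)
  then interpret metric_right_process S X .
  \<comment> \<open>Any rate strictly above \<open>\<alpha>\<^sub>0\<close> serves; the extension to
    \<open>L^p\<close> is assumed for those rates.\<close>
  interpret separating_martingale_problem S X m "\<alpha>\<^sub>0 + 1" \<T> L \<delta>
  proof unfold_locales
    show "AE x in m. resolvent X (\<alpha>\<^sub>0 + 1) (indicator N) x = 0" if "N \<in> null_sets m" for N
      using strongly_continuous_Lp_null[OF resolvent_Lp(2) _ p that] by simp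
    fix \<psi> assume \<psi>: "\<psi> \<in> \<T>"
    then have "\<psi> \<in> \<D>" using \<T>(2) by blast
    then have "L \<psi> \<in> Lp m p" using test_Lp by blast
    then have "(\<lambda>y. \<bar>L \<psi> y\<bar>) \<in> Lp m p" by (auto simp: Lp_def)
    from strongly_continuous_Lp_resolvent[OF resolvent_Lp(2) _ this]
    show "AE x in m. resolvent X (\<alpha>\<^sub>0 + 1) (\<lambda>y. ennreal \<bar>L \<psi> y\<bar>) x < \<top>" by simp
    show "AE x in m. martingale (law X x) (filt X)
        (\<lambda>t \<omega>. ext0 \<psi> (path X (stop_at_lifetime X t \<omega>) \<omega>)
           - (LBINT r:{0..stop_at_lifetime X t \<omega>}. ext0 (L \<psi>) (path X r \<omega>)))"
      "L \<psi> \<in> borel_measurable (restrict_space borel S)"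
      using martingale_problem \<open>\<psi> \<in> \<D>\<close> unfolding solves_martingale_problem_def by blast+
  next
    fix y z assume "y \<in> S" "z \<in> S" "y \<noteq> z"
    then show "\<exists>\<psi>\<in>\<T>. 0 < \<psi> z \<and> (\<exists>\<epsilon>>0. \<forall>q\<in>ball y \<epsilon>. \<psi> q = 0)"
      by (intro \<T>(6)) (auto simp: S_def)
  next
    fix \<psi> q and \<epsilon> :: real
    assume \<psi>: "\<psi> \<in> \<T>" and q: "q \<in> S" "0 < \<delta> q" and \<epsilon>: "0 < \<epsilon>" and zero: "\<And>q'. q' \<in> ball q \<epsilon> \<Longrightarrow> \<psi> q' = 0"
    obtain t x where tx: "q = (t, x)" by (cases q)
    have "q \<in> ?G" using q \<delta>(3) by auto
    then have "q \<in> F" using interior_of_subset[of "top_of_set S" "F \<inter> S"] by blast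
    then have "0 \<le> t" "n t x = null_measure borel" by (auto simp: F_def tx)
    moreover have "t \<in> I" using q(1) by (auto simp: S_def tx)
    ultimately show "L \<psi> q = 0"
      unfolding L_def tx
      by (intro parabolic_op_zero_near[where \<epsilon> = \<epsilon>] zero[unfolded tx] \<epsilon> I_interval A_densely_defined onb)
  qed (use X_cadlag m_measure resolvent_Lp(1) \<T> \<delta> in auto)
  show ?thesis by (rule diffusion_qe_positive[OF \<delta>(3)])
qed

end
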